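(* Let $w\in S_n$ avoid the patterns $1432$, $1423$, $13254$, and write $\mathfrak{G}_w(x)=\sum_\alpha c_\alpha x^\alpha$ with support $\mathrm{supp}(\mathfrak{G}_w)=\{\alpha\in\mathbb{Z}_{\ge0}^n:c_\alpha\ne0\}$. Then: (1) if $\alpha\in\mathrm{supp}(\mathfrak{G}_w)$ and $|\alpha|<\deg\mathfrak{G}_w$, there exists $\beta\in\mathrm{supp}(\mathfrak{G}_w)$ with $\alpha<\beta$ and $|\beta|=|\alpha|+1$; (2) $\mathrm{supp}(\mathfrak{G}_w)$ is closed under taking intervals: if $\alpha,\gamma\in\mathrm{supp}(\mathfrak{G}_w)$ and $\beta\in\mathbb{Z}^n$ with $\alpha\le\beta\le\gamma$, then $\beta\in\mathrm{supp}(\mathfrak{G}_w)$; (3) $\mathfrak{G}_w$ has saturated Newton polytope, i.e. $\mathrm{Newton}(\mathfrak{G}_w)\cap\mathbb{Z}^n=\mathrm{supp}(\mathfrak{G}_w)$, and $\mathrm{Newton}(\mathfrak{G}_w)$ is a generalized polymatroid; (4) for every $\beta\in\mathrm{supp}(\mathfrak{G}_w)$ with $|\beta|=\deg\mathfrak{G}_w$, $\sum_{\alpha\in\mathrm{supp}(\mathfrak{G}_w),\,\alpha\le\beta}c_\alpha=1$.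
   Context: Grothendieck polynomials: with $\partial_i f=(f-s_if)/(x_i-x_{i+1})$ ($s_i$ swaps $x_i,x_{i+1}$), $\mathfrak{G}_{w_0}=x_1^{n-1}\cdots x_{n-1}$ for $w_0=n(n-1)\cdots1$, and $\mathfrak{G}_w=\partial_i((1-x_{i+1})\mathfrak{G}_{ws_i})$ whenever $w(i)<w(i+1)$. Pattern avoidance: $w$ contains $\tau\in S_k$ if some subsequence $w(i_1),\ldots,w(i_k)$, $i_1<\cdots<i_k$, is order-isomorphic to $\tau$; otherwise it avoids $\tau$. For $\alpha\in\mathbb{Z}^n$, $|\alpha|=\sum_i\alpha_i$; $\alpha\le\beta$ is componentwise comparison and $\alpha<\beta$ means $\alpha\le\beta$, $\alpha\ne\beta$. $\deg\mathfrak{G}_w$ is the maximal $|\alpha|$ over the support. $\mathrm{Newton}(f)=\mathrm{conv}(\mathrm{supp} f)$. A paramodular pair is $(y,z)$, $y,z:2^{[n]}\to\mathbb{R}$ with $y(\emptyset)=z(\emptyset)=0$, $y$ supermodular, $z$ submodular, and $z(I)-y(J)\ge z(I\setminus J)-y(J\setminus I)$ for all $I,J$; a generalized polymatroid is a polytope of the form $\{x\in\mathbb{R}^n: y(I)\le\sum_{i\in I}x_i\le z(I)\ \forall I\subseteq[n]\}$ for a paramodular pair $(y,z)$. *)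

theory Defs
  imports "HOL-Analysis.Analysis" "HOL-Analysis.Finite_Function_Topology"
    "HOL-Combinatorics.Permutations"
begin

text \<open>
  Monomials in \<open>x\<^sub>1, x\<^sub>2, \<dots>\<close> are exponent vectors of type \<^typ>\<open>nat \<Rightarrow>\<^sub>0 nat\<close>, and
  polynomials with integer coefficients are finitely supported functions on monomials, so
  that \<open>Poly_Mapping.keys f\<close> is the support of \<open>f\<close> and \<open>Poly_Mapping.lookup f \<alpha>\<close> is the
  coefficient of \<open>x\<close> to the \<open>\<alpha>\<close>.  Vectors of \<open>\<int>\<^sup>n\<close> and \<open>\<real>\<^sup>n\<close> are finitely supported functions
  on \<^typ>\<open>nat\<close> vanishing outside \<open>{1..n}\<close>.

  The library order on \<^typ>\<open>nat \<Rightarrow>\<^sub>0 nat\<close> is a lexicographic one.  Componentwise comparison is the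
  pointwise order on the functions \<open>Poly_Mapping.lookup \<alpha>\<close>.
\<close>

type_synonym mpoly = "(nat \<Rightarrow>\<^sub>0 nat) \<Rightarrow>\<^sub>0 int"

definition X :: "nat \<Rightarrow> mpoly" where
  "X i = Poly_Mapping.single (Poly_Mapping.single i 1) 1"

text \<open>\<open>Poly_Mapping.map_key\<close> precomposes with an injection: the coefficient of
  \<open>\<alpha>\<close> in \<open>swap_vars i f\<close> is the coefficient of \<open>\<alpha> \<circ> s\<^sub>i\<close> in \<open>f\<close>.\<close>

definition swap_vars :: "nat \<Rightarrow> mpoly \<Rightarrow> mpoly" where
  "swap_vars i f = Poly_Mapping.map_key (Poly_Mapping.map_key (Transposition.transpose i (Suc i))) f"

text \<open>The quotient \<open>(f - s\<^sub>i f) / (x\<^sub>i - x\<^bsub>i+1\<^esub>)\<close>, which is exact.\<close>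

definition divided_difference :: "nat \<Rightarrow> mpoly \<Rightarrow> mpoly" where
  "divided_difference i f = (THE g. (X i - X (Suc i)) * g = f - swap_vars i f)"

definition longest_perm :: "nat \<Rightarrow> nat \<Rightarrow> nat" where
  "longest_perm n i = (if i \<in> {1..n} then n + 1 - i else i)"

text \<open>\<open>grothendieck n w G\<close>: \<open>G\<close> is the Grothendieck polynomial of \<open>w \<in> S\<^sub>n\<close>, i.e. it is obtained
  from that of \<open>w\<^sub>0\<close> by some sequence of applications of the defining recursion.  (That the
  result does not depend on the sequence is not built in.)\<close>

inductive grothendieck :: "nat \<Rightarrow> (nat \<Rightarrow> nat) \<Rightarrow> mpoly \<Rightarrow> bool" for n where
  longest: "grothendieck n (longest_perm n) (\<Prod>i = 1..<n. X i ^ (n - i))"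
| step: "\<lbrakk> w permutes {1..n}; 1 \<le> i; i < n; w i < w (Suc i);
           grothendieck n (w \<circ> Transposition.transpose i (Suc i)) G \<rbrakk>
         \<Longrightarrow> grothendieck n w (divided_difference i ((1 - X (Suc i)) * G))"

text \<open>Patterns are given in one-line notation.\<close>

definition contains_pattern :: "nat \<Rightarrow> (nat \<Rightarrow> nat) \<Rightarrow> nat list \<Rightarrow> bool" where
  "contains_pattern n w \<tau> \<longleftrightarrow>
     (\<exists>p. strict_mono_on {..<length \<tau>} p \<and> p ` {..<length \<tau>} \<subseteq> {1..n} \<and>
        (\<forall>a<length \<tau>. \<forall>b<length \<tau>. w (p a) < w (p b) \<longleftrightarrow> \<tau> ! a < \<tau> ! b))"

definition avoids_pattern :: "nat \<Rightarrow> (nat \<Rightarrow> nat) \<Rightarrow> nat list \<Rightarrow> bool" where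
  "avoids_pattern n w \<tau> \<longleftrightarrow> \<not> contains_pattern n w \<tau>"

definition exp_size :: "(nat \<Rightarrow>\<^sub>0 nat) \<Rightarrow> nat" where
  "exp_size \<alpha> = (\<Sum>i\<in>Poly_Mapping.keys \<alpha>. Poly_Mapping.lookup \<alpha> i)"

definition poly_deg :: "mpoly \<Rightarrow> nat" where
  "poly_deg f = Max (exp_size ` Poly_Mapping.keys f)"

definition supp_int :: "mpoly \<Rightarrow> (nat \<Rightarrow>\<^sub>0 int) set" where
  "supp_int f = Poly_Mapping.map int ` Poly_Mapping.keys f"

definition supp_real :: "mpoly \<Rightarrow> (nat \<Rightarrow>\<^sub>0 real) set" where
  "supp_real f = Poly_Mapping.map real ` Poly_Mapping.keys f"

definition newton :: "mpoly \<Rightarrow> (nat \<Rightarrow>\<^sub>0 real) set" where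
  "newton f = convex hull (supp_real f)"

definition real_space :: "nat \<Rightarrow> (nat \<Rightarrow>\<^sub>0 real) set" where
  "real_space n = {x. Poly_Mapping.keys x \<subseteq> {1..n}}"

definition int_lattice :: "nat \<Rightarrow> (nat \<Rightarrow>\<^sub>0 real) set" where
  "int_lattice n = {x \<in> real_space n. \<forall>i. Poly_Mapping.lookup x i \<in> \<int>}"

definition saturated_newton_polytope :: "nat \<Rightarrow> mpoly \<Rightarrow> bool" where
  "saturated_newton_polytope n f \<longleftrightarrow> newton f \<inter> int_lattice n = supp_real f"

definition supermodular :: "nat \<Rightarrow> (nat set \<Rightarrow> real) \<Rightarrow> bool" where
  "supermodular n y \<longleftrightarrow>
     (\<forall>I J. I \<subseteq> {1..n} \<longrightarrow> J \<subseteq> {1..n} \<longrightarrow> y I + y J \<le> y (I \<union> J) + y (I \<inter> J))"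

definition submodular :: "nat \<Rightarrow> (nat set \<Rightarrow> real) \<Rightarrow> bool" where
  "submodular n z \<longleftrightarrow>
     (\<forall>I J. I \<subseteq> {1..n} \<longrightarrow> J \<subseteq> {1..n} \<longrightarrow> z I + z J \<ge> z (I \<union> J) + z (I \<inter> J))"

definition paramodular :: "nat \<Rightarrow> (nat set \<Rightarrow> real) \<Rightarrow> (nat set \<Rightarrow> real) \<Rightarrow> bool" where
  "paramodular n y z \<longleftrightarrow>
     y {} = 0 \<and> z {} = 0 \<and> supermodular n y \<and> submodular n z \<and>
     (\<forall>I J. I \<subseteq> {1..n} \<longrightarrow> J \<subseteq> {1..n} \<longrightarrow> z I - y J \<ge> z (I - J) - y (J - I))"

definition generalized_polymatroid :: "nat \<Rightarrow> (nat \<Rightarrow>\<^sub>0 real) set \<Rightarrow> bool" where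
  "generalized_polymatroid n P \<longleftrightarrow>
     (\<exists>y z. paramodular n y z \<and>
        P = {x \<in> real_space n. \<forall>I. I \<subseteq> {1..n} \<longrightarrow>
               y I \<le> (\<Sum>i\<in>I. Poly_Mapping.lookup x i) \<and>
               (\<Sum>i\<in>I. Poly_Mapping.lookup x i) \<le> z I})"

end

theory Submission
  imports Defs
begin

text \<open>
  Index the columns of the Rothe diagram of \<open>w\<close> by positions: \<open>C\<^sub>q = {t < q. w q < w t}\<close>.  To a set \<open>R\<close> of
  rows attach the multilinear polynomial \<open>F\<^sub>R\<close> whose value at a 0/1 vector \<open>1\<^sub>T\<close> is 1 if \<open>T\<close> contains a
  basis of the Schubert matroid of \<open>R\<close> (every initial segment \<open>{1..t}\<close> meets \<open>T\<close> in at least as many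
  elements as \<open>R\<close>), and 0 otherwise.  If \<open>w\<close> avoids 1432 and 1423, its Grothendieck polynomial is the
  product of the \<open>F\<close> over all columns.  This is proved by descending from \<open>w\<^sub>0\<close> along first ascents
  \<open>i\<close>: at most one column contains \<open>i + 1\<close> but not \<open>i\<close>, and all the others give factors symmetric in
  \<open>x\<^sub>i, x\<^bsub>i+1\<^esub>\<close>.  The braid relations make the result independent of the chain of ascents.

  Since the Schubert matroid has no loops below \<open>max R\<close>, all coefficients of \<open>F\<^sub>R\<close> at spanning subsets
  of \<open>{1..max R}\<close> are nonzero.  Avoiding 13254 makes the non-coloops of different columns disjoint
  intervals.  The support is then cut out by bounds on coordinates and on sums over intervals of consecutive
  coordinates, a system of difference constraints in the partial sums, so its convex hull is an
  integral polytope, dual to a direct sum of independence polytopes.  Finally \<open>F\<^sub>R(1,\<dots>,1) = 1\<close>.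
\<close>

section \<open>Isobaric divided differences\<close>

text \<open>Read \<open>F_R\<close> as the probability that a random set, containing each
  \<open>k\<close> independently with probability \<open>x_k\<close>, satisfies all prefix
  conditions. Moving a row of \<open>R\<close> from \<open>i\<close> to \<open>i + 1\<close> changes
  only the condition at t = i, and this makes a difference only for sets containing
  \<open>i + 1\<close> but not \<open>i\<close>. After multiplication by \<open>x_i\<close> the
  terms of exactly these sets are annihilated by the operator, so one application to
  \<open>x_i F_R\<close> moves the row. First ascents serve two purposes. All entries before
  position \<open>i\<close> exceed \<open>w i\<close>, so an initial-segment column supplies the
  factor \<open>x_i\<close>; and a pattern whose first letter is its smallest cannot be created by
  exchanging the two entries. The support of the product could still shrink by cancellation.
  Disjoint ranges exclude this, as each monomial then factors in one way only. Apart from the upper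
  bounds on coordinates all constraints are lower bounds. Hence the support has a greatest vector,
  any other vector can be raised by one step, and (4) concerns the sum of all coefficients.\<close>

lemma poly_mapping_single_induct [case_names zero single add]:
  fixes P :: "('a \<Rightarrow>\<^sub>0 'b::monoid_add) \<Rightarrow> bool"
  assumes zero: "P 0" and single: "\<And>k v. P (Poly_Mapping.single k v)"
    and add: "\<And>p q. P p \<Longrightarrow> P q \<Longrightarrow> P (p + q)"
  shows "P p"
proof (induction p rule: update_induct)
  case const
  show ?case by (metis zero Abs_poly_mapping)
next
  case (update p a b)
  have "Poly_Mapping.update a b p = Poly_Mapping.single a b + p"
    using update(1) by (intro poly_mapping_eqI)
      (auto simp: lookup_update lookup_add lookup_single in_keys_iff)
  then show ?case using add single update.IH by simp
qed

lemma of_int_mpoly: "(of_int c :: mpoly) = Poly_Mapping.single 0 c"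
  by (rule poly_mapping_eqI) (simp add: lookup_of_int lookup_single eq_commute)

text \<open>Ring homomorphisms such as \<open>swap_vars\<close> are determined by their values on
  variables, so this rule reduces identities between them to a check on a single
  \<open>X k\<close>.\<close>

lemma mpoly_induct [case_names zero add mult var of_int]:
  fixes P :: "mpoly \<Rightarrow> bool"
  assumes zero: "P 0"
    and add: "\<And>f g. P f \<Longrightarrow> P g \<Longrightarrow> P (f + g)"
    and mult: "\<And>f g. P f \<Longrightarrow> P g \<Longrightarrow> P (f * g)"
    and var: "\<And>k. P (X k)"
    and const: "\<And>c. P (of_int c)"
  shows "P f"
proof -
  have pow: "P (X k ^ e)" for k e
    by (induction e) (use const[of 1] in \<open>auto intro: mult var\<close>)
  have single_power: "Poly_Mapping.single (Poly_Mapping.single k e) 1 = X k ^ e" for k e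
  proof (induction e)
    case (Suc e)
    have "Poly_Mapping.single k (Suc e) = Poly_Mapping.single k 1 + Poly_Mapping.single k e"
      by (simp flip: single_add)
    then have "Poly_Mapping.single (Poly_Mapping.single k (Suc e)) (1::int) =
      Poly_Mapping.single (Poly_Mapping.single k 1) 1 * Poly_Mapping.single (Poly_Mapping.single k e) 1"
      by (simp only: mult_single mult_1)
    then show ?case using Suc by (simp add: X_def)
  qed simp
  have monom: "P (Poly_Mapping.single \<alpha> 1)" for \<alpha> :: "nat \<Rightarrow>\<^sub>0 nat"
  proof (induction \<alpha> rule: poly_mapping_single_induct)
    case zero
    show ?case using const[of 1] by simp
  next
    case (single k v)
    show ?case by (simp add: single_power pow)
  next
    case (add \<alpha> \<beta>)
    then show ?case
      using mult[of "Poly_Mapping.single \<alpha> 1" "Poly_Mapping.single \<beta> 1"] by (simp add: mult_single)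
  qed
  show ?thesis
  proof (induction f rule: poly_mapping_single_induct)
    case (single \<alpha> c)
    have "Poly_Mapping.single \<alpha> c = of_int c * Poly_Mapping.single \<alpha> 1"
      by (simp add: of_int_mpoly mult_single)
    then show ?case using mult const monom by simp
  qed (auto intro: zero add)
qed

section \<open>Exchange of adjacent variables as a ring automorphism\<close>

lemma map_key_transpose_single:
  "Poly_Mapping.map_key (Transposition.transpose i j) (Poly_Mapping.single k v)
     = Poly_Mapping.single (Transposition.transpose i j k) v"
  using map_key_single[of "Transposition.transpose i j" "Transposition.transpose i j k" v] by simp

lemma map_key_transpose_involution:
  "Poly_Mapping.map_key (Transposition.transpose i j)
     (Poly_Mapping.map_key (Transposition.transpose i j) p) = p"
  by (simp add: map_key_compose o_def map_key_id)

lemma inj_map_key_transpose: "inj (Poly_Mapping.map_key (Transposition.transpose i j))"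
  by (rule inj_on_inverseI[of _ "Poly_Mapping.map_key (Transposition.transpose i j)"])
     (rule map_key_transpose_involution)

lemma swap_vars_single:
  "swap_vars i (Poly_Mapping.single \<alpha> c)
     = Poly_Mapping.single (Poly_Mapping.map_key (Transposition.transpose i (Suc i)) \<alpha>) c"
  unfolding swap_vars_def
  using map_key_single[OF inj_map_key_transpose, of i "Suc i"
    "Poly_Mapping.map_key (Transposition.transpose i (Suc i)) \<alpha>" c]
  by (simp add: map_key_transpose_involution)

lemma swap_vars_X [simp]: "swap_vars i (X k) = X (Transposition.transpose i (Suc i) k)"
  by (simp add: X_def swap_vars_single map_key_transpose_single)

lemma swap_vars_0 [simp]: "swap_vars i 0 = 0"
  by (simp add: swap_vars_def inj_map_key_transpose)

lemma swap_vars_of_int [simp]: "swap_vars i (of_int c) = of_int c"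
  by (simp add: of_int_mpoly swap_vars_single inj_map_key_transpose)

lemma swap_vars_1 [simp]: "swap_vars i 1 = 1"
  using swap_vars_of_int[of i 1] by simp

lemma swap_vars_add [simp]: "swap_vars i (f + g) = swap_vars i f + swap_vars i g"
  by (simp add: swap_vars_def map_key_plus inj_map_key_transpose)

lemma swap_vars_diff [simp]: "swap_vars i (f - g) = swap_vars i f - swap_vars i g"
  by (metis add_diff_cancel_right' diff_add_cancel swap_vars_add)

lemma swap_vars_mult [simp]: "swap_vars i (f * g) = swap_vars i f * swap_vars i g"
proof (induction f rule: poly_mapping_single_induct)
  case (single \<alpha> c)
  show ?case
    by (induction g rule: poly_mapping_single_induct)
       (simp_all add: mult_single swap_vars_single map_key_plus distrib_left)
qed (simp_all add: distrib_right)

lemma swap_vars_sum: "swap_vars i (sum f A) = (\<Sum>a\<in>A. swap_vars i (f a))"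
  by (induction A rule: infinite_finite_induct) auto

lemma swap_vars_prod: "swap_vars i (prod f A) = (\<Prod>a\<in>A. swap_vars i (f a))"
  by (induction A rule: infinite_finite_induct) auto

lemma swap_vars_swap_vars [simp]: "swap_vars i (swap_vars i f) = f"
  by (simp add: swap_vars_def map_key_compose inj_map_key_transpose o_def map_key_transpose_involution map_key_id)

lemma swap_vars_commute:
  assumes "Suc i < j"
  shows "swap_vars i (swap_vars j f) = swap_vars j (swap_vars i f)"
  using assms
  by (induction f rule: mpoly_induct) (auto simp: Transposition.transpose_def)

lemma swap_vars_braid:
  "swap_vars i (swap_vars (Suc i) (swap_vars i f)) = swap_vars (Suc i) (swap_vars i (swap_vars (Suc i) f))"
  by (induction f rule: mpoly_induct) (auto simp: Transposition.transpose_def)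

lemma X_eq_iff [simp]: "X i = X j \<longleftrightarrow> i = j"
proof
  assume "X i = X j"
  then have "Poly_Mapping.keys (X i) = Poly_Mapping.keys (X j)" by simp
  then have "Poly_Mapping.single i (1::nat) = Poly_Mapping.single j 1" by (simp add: X_def)
  then have "Poly_Mapping.keys (Poly_Mapping.single i (1::nat)) = Poly_Mapping.keys (Poly_Mapping.single j (1::nat))" by simp
  then show "i = j" by simp
qed simp

section \<open>Exactness of divided differences\<close>

lemma divided_difference_unique:
  assumes "(X i - X (Suc i)) * g = f - swap_vars i f"
  shows "divided_difference i f = g"
  unfolding divided_difference_def
proof (rule the_equality)
  fix h assume "(X i - X (Suc i)) * h = f - swap_vars i f"
  with assms have "(X i - X (Suc i)) * h = (X i - X (Suc i)) * g" by simp
  then show "h = g" by simp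
qed (rule assms)

text \<open>Divisibility passes to sums and, by the twisted Leibniz rule with quotient f' g + s_i(f)
  g', to products, so variables and constants suffice. The ring has no zero divisors, hence the
  quotient is unique and the \<open>THE\<close> in the definition is meaningful.\<close>

lemma divided_difference_exact:
  "(X i - X (Suc i)) * divided_difference i f = f - swap_vars i f"
proof -
  have "\<exists>g. (X i - X (Suc i)) * g = f - swap_vars i f"
  proof (induction f rule: mpoly_induct)
    case (add f g)
    then obtain f' g' where "(X i - X (Suc i)) * f' = f - swap_vars i f"
      "(X i - X (Suc i)) * g' = g - swap_vars i g" by blast
    then have "(X i - X (Suc i)) * (f' + g') = (f + g) - swap_vars i (f + g)"
      by (simp add: algebra_simps)
    then show ?case by blast
  next
    case (mult f g)
    then obtain f' g' where f': "(X i - X (Suc i)) * f' = f - swap_vars i f"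
      and g': "(X i - X (Suc i)) * g' = g - swap_vars i g" by blast
    have "(X i - X (Suc i)) * (f' * g + swap_vars i f * g')
      = (X i - X (Suc i)) * f' * g + swap_vars i f * ((X i - X (Suc i)) * g')"
      by (simp add: algebra_simps)
    also have "\<dots> = f * g - swap_vars i (f * g)"
      unfolding f' g' by (simp add: algebra_simps)
    finally show ?case by blast
  next
    case (var k)
    have "(X i - X (Suc i)) * (if k = i then 1 else if k = Suc i then - 1 else 0)
      = X k - swap_vars i (X k)" by (auto simp: Transposition.transpose_def)
    then show ?case by blast
  qed (auto intro: exI[of _ 0])
  then show ?thesis using divided_difference_unique by metis
qed

text \<open>The recursion step as a single operator, the K-theoretic isobaric divided difference. It
  fixes 1 and is linear over the polynomials symmetric in \<open>X i\<close> and
  \<open>X (Suc i)\<close>.\<close>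

definition demazure :: "nat \<Rightarrow> mpoly \<Rightarrow> mpoly" where
  "demazure i f = divided_difference i ((1 - X (Suc i)) * f)"

lemma demazure_exact:
  "(X i - X (Suc i)) * demazure i f = (1 - X (Suc i)) * f - (1 - X i) * swap_vars i f"
  by (simp add: demazure_def divided_difference_exact)

lemma demazure_eqI:
  assumes "(X i - X (Suc i)) * g = (1 - X (Suc i)) * f - (1 - X i) * swap_vars i f"
  shows "demazure i f = g"
  unfolding demazure_def by (rule divided_difference_unique) (simp add: assms)

lemma demazure_symmetric:
  "swap_vars i (demazure i f) = demazure i f"
proof -
  have "(X (Suc i) - X i) * swap_vars i (demazure i f) = (1 - X i) * swap_vars i f - (1 - X (Suc i)) * f"
    using arg_cong[OF demazure_exact, of "swap_vars i" i f] by simp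
  then have "(X i - X (Suc i)) * swap_vars i (demazure i f) = (X i - X (Suc i)) * demazure i f"
    unfolding demazure_exact by algebra
  then show ?thesis by simp
qed

section \<open>Commutation and braid relations\<close>

lemma swap_demazure_commute:
  assumes "Suc i < j \<or> Suc j < i"
  shows "swap_vars i (demazure j f) = demazure j (swap_vars i f)"
proof -
  have c: "swap_vars i (swap_vars j f) = swap_vars j (swap_vars i f)"
    using assms swap_vars_commute by metis
  have "swap_vars i ((X j - X (Suc j)) * demazure j f)
     = swap_vars i ((1 - X (Suc j)) * f - (1 - X j) * swap_vars j f)"
    by (simp only: demazure_exact)
  moreover have "Transposition.transpose i (Suc i) j = j" "Transposition.transpose i (Suc i) (Suc j) = Suc j"
    using assms by (auto simp: Transposition.transpose_def)
  ultimately show ?thesis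
    by (intro demazure_eqI[symmetric]) (simp add: c)
qed

lemma demazure_commute:
  assumes "Suc i < j"
  shows "demazure i (demazure j f) = demazure j (demazure i f)"
proof (rule demazure_eqI)
  define a b c d where "a = X i" and "b = X (Suc i)" and "c = X j" and "d = X (Suc j)"
  define s where "s = swap_vars i f"
  have 1: "(a - b) * demazure i f = (1 - b) * f - (1 - a) * s"
    by (simp add: a_def b_def s_def demazure_exact)
  have tr: "Transposition.transpose j (Suc j) i = i" "Transposition.transpose j (Suc j) (Suc i) = Suc i"
    using assms by (auto simp: Transposition.transpose_def)
  have 2: "(a - b) * swap_vars j (demazure i f) = (1 - b) * swap_vars j f - (1 - a) * swap_vars j s"
  proof -
    have "swap_vars j ((a - b) * demazure i f) = swap_vars j ((1 - b) * f - (1 - a) * s)"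
      by (simp only: 1)
    then show ?thesis by (simp add: a_def b_def tr)
  qed
  have 3: "(c - d) * demazure j (demazure i f) = (1 - d) * demazure i f - (1 - c) * swap_vars j (demazure i f)"
    by (simp add: c_def d_def demazure_exact)
  have 4: "(c - d) * demazure j f = (1 - d) * f - (1 - c) * swap_vars j f"
    by (simp add: c_def d_def demazure_exact)
  have 5: "(c - d) * demazure j s = (1 - d) * s - (1 - c) * swap_vars j s"
    by (simp add: c_def d_def demazure_exact)
  \<comment> \<open>The extra factor \<open>c - d\<close> lets every outer operator be replaced by
    its exactness equation; it is cancelled afterwards.\<close>
  have "(c - d) * ((a - b) * demazure j (demazure i f)) = (c - d) * ((1 - b) * demazure j f - (1 - a) * demazure j s)"
    using 1 2 3 4 5 by algebra
  moreover have "c - d \<noteq> 0" by (simp add: c_def d_def)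
  ultimately show "(X i - X (Suc i)) * demazure j (demazure i f) =
    (1 - X (Suc i)) * demazure j f - (1 - X i) * swap_vars i (demazure j f)"
    using assms by (simp add: a_def b_def s_def swap_demazure_commute)
qed

text \<open>Multiplied by the three differences of the variables, both sides become the alternating
  sum of \<sigma>((1 - b)(1 - c)^2 f) over the six permutations \<sigma> of \<open>a\<close>,
  \<open>b\<close>, \<open>c\<close>. This common value is the \<open>w\<close> of the
  proof.\<close>

lemma demazure_braid:
  "demazure i (demazure (Suc i) (demazure i f)) = demazure (Suc i) (demazure i (demazure (Suc i) f))"
proof -
  define a b c where "a = X i" and "b = X (Suc i)" and "c = X (Suc (Suc i))"
  define s t where "s = swap_vars i" and "t = swap_vars (Suc i)"
  have sX: "s a = b" "s b = a" "s c = c" "t a = a" "t b = c" "t c = b"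
    by (auto simp: s_def t_def a_def b_def c_def Transposition.transpose_def)
  have hom: "s (u * v) = s u * s v" "s (u - v) = s u - s v" "s 1 = 1" "s (s u) = u"
    "t (u * v) = t u * t v" "t (u - v) = t u - t v" "t 1 = 1" "t (t u) = u"
    "t (s (t u)) = s (t (s u))" for u v
    by (simp_all add: s_def t_def swap_vars_braid)
  let ?d = "demazure i" and ?e = "demazure (Suc i)"
  have d: "(a - b) * ?d u = (1 - b) * u - (1 - a) * s u" for u
    by (simp add: a_def b_def s_def demazure_exact)
  have e: "(b - c) * ?e u = (1 - c) * u - (1 - b) * t u" for u
    by (simp add: b_def c_def t_def demazure_exact)
  have td: "(a - c) * t (?d u) = (1 - c) * t u - (1 - a) * t (s u)" for u
    using arg_cong[OF d, of t u] by (simp add: hom sX)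
  have se: "(a - c) * s (?e u) = (1 - c) * s u - (1 - a) * s (t u)" for u
    using arg_cong[OF e, of s u] by (simp add: hom sX)
  have std: "(b - c) * s (t (?d u)) = (1 - c) * s (t u) - (1 - b) * s (t (s u))" for u
    using arg_cong[OF td, of s u] by (simp add: hom sX)
  have tse: "(a - b) * t (s (?e u)) = (1 - b) * t (s u) - (1 - a) * s (t (s u))" for u
    using arg_cong[OF se, of t u] by (simp add: hom sX)
  have sd: "s (?d u) = ?d u" for u by (simp add: s_def demazure_symmetric)
  have te: "t (?e u) = ?e u" for u by (simp add: t_def demazure_symmetric)
  have L: "(a - b) * ?d (?e (?d f)) = (1 - b) * ?e (?d f) - (1 - a) * s (?e (?d f))" by (rule d)
  have R: "(b - c) * ?e (?d (?e f)) = (1 - c) * ?d (?e f) - (1 - b) * t (?d (?e f))" by (rule e)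
  define w where "w = (1-b)*(1-c)*(1-c) * f - (1-a)*(1-c)*(1-c) * s f - (1-b)*(1-b)*(1-c) * t f
     + (1-a)*(1-a)*(1-c) * s (t f) + (1-b)*(1-b)*(1-a) * t (s f) - (1-a)*(1-a)*(1-b) * s (t (s f))"
  have "(a - c) * (b - c) * ((a - b) * ?d (?e (?d f))) =
     (1 - b) * ((a - c) * ((b - c) * ?e (?d f))) - (1 - a) * ((b - c) * ((a - c) * s (?e (?d f))))"
    unfolding L by (simp add: algebra_simps)
  also have "\<dots> = (1 - b) * ((a - c) * ((1 - c) * ?d f) - (1 - b) * ((a - c) * t (?d f)))
      - (1 - a) * ((b - c) * ((1 - c) * ?d f) - (1 - a) * ((b - c) * s (t (?d f))))"
    unfolding e se sd by (simp add: algebra_simps)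
  also have "\<dots> = (1 - c) * ((a - b) * ?d f) * (1 - c) - (1 - b) * (1 - b) * ((a - c) * t (?d f))
      + (1 - a) * (1 - a) * ((b - c) * s (t (?d f)))"
    by (simp add: algebra_simps)
  also have "\<dots> = w"
    unfolding d td std w_def by (simp add: algebra_simps)
  finally have 1: "(a - c) * (b - c) * ((a - b) * ?d (?e (?d f))) = w" .
  have "(a - c) * (a - b) * ((b - c) * ?e (?d (?e f))) =
     (1 - c) * ((a - c) * ((a - b) * ?d (?e f))) - (1 - b) * ((a - b) * ((a - c) * t (?d (?e f))))"
    unfolding R by (simp add: algebra_simps)
  also have "\<dots> = (1 - c) * ((a - c) * ((1 - b) * ?e f) - (1 - a) * ((a - c) * s (?e f)))
      - (1 - b) * ((a - b) * ((1 - c) * ?e f) - (1 - a) * ((a - b) * t (s (?e f))))"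
    unfolding d td te by (simp add: algebra_simps)
  also have "\<dots> = (1 - c) * ((b - c) * ?e f) * (1 - b) - (1 - c) * (1 - a) * ((a - c) * s (?e f))
      + (1 - b) * (1 - a) * ((a - b) * t (s (?e f)))"
    by (simp add: algebra_simps)
  also have "\<dots> = w"
    unfolding e se tse w_def by (simp add: algebra_simps)
  finally have 2: "(a - c) * (a - b) * ((b - c) * ?e (?d (?e f))) = w" .
  have "(a - c) * (b - c) * (a - b) * ?d (?e (?d f)) = (a - c) * (b - c) * (a - b) * ?e (?d (?e f))"
    using 1 2 by (simp add: algebra_simps)
  moreover have "(a - c) * (b - c) * (a - b) \<noteq> 0" by (simp add: a_def b_def c_def)
  ultimately show ?thesis using mult_left_cancel by blast
qed

section \<open>Uniqueness of Grothendieck polynomials\<close>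

lemma grothendieck_demazure:
  assumes "w permutes {1..n}" "1 \<le> i" "i < n" "w i < w (Suc i)"
    and "grothendieck n (w \<circ> Transposition.transpose i (Suc i)) G"
  shows "grothendieck n w (demazure i G)"
  unfolding demazure_def using assms by (intro grothendieck.step)

lemma permutes_comp_adjacent_transpose:
  assumes "w permutes {1..n}" "1 \<le> i" "i < n"
  shows "(w \<circ> Transposition.transpose i (Suc i)) permutes {1..n}"
  using assms by (intro permutes_compose permutes_swap_id) auto

text \<open>An induction measure that replaces counting non-inversions: exchanging an ascent lowers
  it by \<open>w (Suc i) - w i\<close>, as two summands show.\<close>

definition perm_weight :: "nat \<Rightarrow> (nat \<Rightarrow> nat) \<Rightarrow> nat" where
  "perm_weight n w = (\<Sum>k\<in>{1..n}. k * w k)"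

lemma perm_weight_less:
  assumes "1 \<le> i" "i < n" "w i < w (Suc i)"
  shows "perm_weight n (w \<circ> Transposition.transpose i (Suc i)) < perm_weight n w"
proof -
  define S where "S = {1..n} - {i, Suc i}"
  have S: "{1..n} = insert i (insert (Suc i) S)" "i \<notin> insert (Suc i) S" "Suc i \<notin> S" "finite S"
    using assms by (auto simp: S_def)
  have "(\<Sum>k\<in>S. k * (w \<circ> Transposition.transpose i (Suc i)) k) = (\<Sum>k\<in>S. k * w k)"
    by (intro sum.cong) (auto simp: S_def Transposition.transpose_def)
  then show ?thesis
    using S assms(3) unfolding perm_weight_def by (simp add: algebra_simps)
qed

text \<open>Without ascents \<open>w i + i\<close> cannot increase with \<open>i\<close>. It is at
  most n + 1 at the start and at least n + 1 at the end, hence constantly n + 1.\<close>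

lemma no_ascent_imp_longest:
  assumes w: "w permutes {1..n}"
    and desc: "\<And>i. 1 \<le> i \<Longrightarrow> i < n \<Longrightarrow> \<not> w i < w (Suc i)"
  shows "w = longest_perm n"
proof
  have inj: "inj w" using w permutes_inj by blast
  have desc': "w (Suc i) + Suc i \<le> w i + i" if "1 \<le> i" "i < n" for i
    using desc[OF that] injD[OF inj, of i "Suc i"] by (cases "w i = w (Suc i)") auto
  have mono: "w j + j \<le> w i + i" if "i \<le> j" "1 \<le> i" "j \<le> n" for i j
    using that
  proof (induction j rule: dec_induct)
    case (step k)
    then show ?case using desc'[of k] by simp
  qed simp
  fix i
  show "w i = longest_perm n i"
  proof (cases "i \<in> {1..n}")
    case True
    have "w 1 \<in> {1..n}" "w n \<in> {1..n}"
      using True permutes_in_image[OF w] by auto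
    then show ?thesis
      using mono[of 1 i] mono[of i n] True by (auto simp: longest_perm_def)
  next
    case False
    then show ?thesis using w by (auto simp: longest_perm_def permutes_def)
  qed
qed

lemma first_ascent:
  assumes w: "w permutes {1..n}" and "w \<noteq> longest_perm n"
  obtains i where "1 \<le> i" "i < n" "w i < w (Suc i)"
    "\<And>a b. 1 \<le> a \<Longrightarrow> a < b \<Longrightarrow> b \<le> i \<Longrightarrow> w b < w a"
proof -
  define P where "P i \<longleftrightarrow> 1 \<le> i \<and> i < n \<and> w i < w (Suc i)" for i
  define i where "i = (LEAST i. P i)"
  have "\<exists>i. P i" using no_ascent_imp_longest assms unfolding P_def by blast
  then have i: "P i" unfolding i_def by (rule LeastI_ex)
  have inj: "inj w" using w permutes_inj by blast
  have step: "w (Suc k) < w k" if "1 \<le> k" "k < i" for k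
  proof -
    have "\<not> P k" using that(2) not_less_Least unfolding i_def by blast
    then show ?thesis using that i injD[OF inj, of k "Suc k"]
      unfolding P_def by (cases "w k = w (Suc k)") auto
  qed
  have "w b < w a" if "1 \<le> a" "a < b" "b \<le> i" for a b
    using that
  proof (induction b)
    case (Suc b)
    then show ?case using step[of b] by (cases "a = b") auto
  qed simp
  then show thesis using that i unfolding P_def by blast
qed

lemma grothendieck_exists:
  assumes "w permutes {1..n}"
  shows "\<exists>G. grothendieck n w G"
  using assms
proof (induction "perm_weight n w" arbitrary: w rule: less_induct)
  case less
  show ?case
  proof (cases "w = longest_perm n")
    case True
    then show ?thesis using grothendieck.longest by blast
  next
    case False
    then obtain i where "1 \<le> i" "i < n" "w i < w (Suc i)"
      using first_ascent less.prems by metis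
    then show ?thesis
      using less.hyps[OF perm_weight_less] permutes_comp_adjacent_transpose[OF less.prems]
        grothendieck.step[OF less.prems] by metis
  qed
qed

text \<open>Termination plus local confluence: for two different last steps at \<open>i\<close> and
  \<open>j\<close> there is a polynomial \<open>K\<close> below both branches, and the induction
  hypothesis replaces the given polynomials by those obtained from \<open>K\<close>. Distant indices
  use commutation, neighbours the braid relation.\<close>

lemma grothendieck_unique:
  assumes "w permutes {1..n}" "grothendieck n w G" "grothendieck n w H"
  shows "G = H"
  using assms
proof (induction "perm_weight n w" arbitrary: w G H rule: less_induct)
  case less
  note w = less.prems(1)
  let ?t = "\<lambda>i. Transposition.transpose i (Suc i)"
  have no_ascent: "\<not> longest_perm n i < longest_perm n (Suc i)" if "1 \<le> i" "i < n" for i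
    using that by (auto simp: longest_perm_def)
  have IH: "G' = H'" if "1 \<le> i" "i < n" "w i < w (Suc i)"
    "grothendieck n (w \<circ> ?t i) G'" "grothendieck n (w \<circ> ?t i) H'" for i G' H'
    using less.hyps[OF perm_weight_less permutes_comp_adjacent_transpose] w that by blast
  have diamond: "demazure i G' = demazure j H'"
    if "i < j" and i: "1 \<le> i" "i < n" "w i < w (Suc i)" and G': "grothendieck n (w \<circ> ?t i) G'"
      and j: "1 \<le> j" "j < n" "w j < w (Suc j)" and H': "grothendieck n (w \<circ> ?t j) H'"
    for i j G' H'
  proof (cases "j = Suc i")
    case False
    with \<open>i < j\<close> have ij: "Suc i < j" by simp
    have ti: "(w \<circ> ?t i) permutes {1..n}" and tj: "(w \<circ> ?t j) permutes {1..n}"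
      using permutes_comp_adjacent_transpose w i j by blast+
    obtain K where K: "grothendieck n (w \<circ> ?t i \<circ> ?t j) K"
      using grothendieck_exists permutes_comp_adjacent_transpose ti j by blast
    have eq: "w \<circ> ?t i \<circ> ?t j = w \<circ> ?t j \<circ> ?t i"
      using ij by (auto simp: fun_eq_iff Transposition.transpose_def)
    have "grothendieck n (w \<circ> ?t i) (demazure j K)"
      by (rule grothendieck_demazure[OF ti]) (use K ij j in \<open>auto simp: Transposition.transpose_def\<close>)
    moreover have "grothendieck n (w \<circ> ?t j) (demazure i K)"
      by (rule grothendieck_demazure[OF tj]) (use K ij i eq in \<open>auto simp: Transposition.transpose_def\<close>)
    ultimately show ?thesis
      using IH[OF i G'] IH[OF j H'] demazure_commute[OF ij, of K] by simp
  next
    case True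
    have ti: "(w \<circ> ?t i) permutes {1..n}" and tj: "(w \<circ> ?t j) permutes {1..n}"
      using permutes_comp_adjacent_transpose w i j by blast+
    have tij: "(w \<circ> ?t i \<circ> ?t j) permutes {1..n}" and tji: "(w \<circ> ?t j \<circ> ?t i) permutes {1..n}"
      using permutes_comp_adjacent_transpose ti tj i j by blast+
    \<comment> \<open>The three values at \<open>i\<close>, \<open>i + 1\<close>,
      \<open>i + 2\<close> increase, so both ways of reversing them by adjacent exchanges pass
      through ascents only and meet at \<open>K\<close>.\<close>
    obtain K where K: "grothendieck n (w \<circ> ?t i \<circ> ?t j \<circ> ?t i) K"
      using grothendieck_exists permutes_comp_adjacent_transpose tij i by blast
    have eq: "w \<circ> ?t i \<circ> ?t j \<circ> ?t i = w \<circ> ?t j \<circ> ?t i \<circ> ?t j"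
      using True by (auto simp: fun_eq_iff Transposition.transpose_def)
    have prev: "grothendieck n (w \<circ> ?t i \<circ> ?t j) (demazure i K)"
      by (rule grothendieck_demazure[OF tij]) (use K i j True in \<open>auto simp: Transposition.transpose_def\<close>)
    have "grothendieck n (w \<circ> ?t i) (demazure j (demazure i K))"
      by (rule grothendieck_demazure[OF ti]) (use prev i j True in \<open>auto simp: Transposition.transpose_def\<close>)
    moreover have prev: "grothendieck n (w \<circ> ?t j \<circ> ?t i) (demazure j K)"
      by (rule grothendieck_demazure[OF tji]) (use K i j True eq in \<open>auto simp: Transposition.transpose_def\<close>)
    have "grothendieck n (w \<circ> ?t j) (demazure i (demazure j K))"
      by (rule grothendieck_demazure[OF tj]) (use prev i j True in \<open>auto simp: Transposition.transpose_def\<close>)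
    ultimately show ?thesis
      using IH[OF i G'] IH[OF j H'] demazure_braid[of i K] True by simp
  qed
  from less.prems(2) show ?case
  proof cases
    case longest
    from less.prems(3) show ?thesis
    proof cases
      case longest
      with \<open>G = _\<close> show ?thesis by simp
    next
      case (step i H')
      with no_ascent \<open>w = longest_perm n\<close> show ?thesis by simp
    qed
  next
    case G: (step i G')
    from less.prems(3) show ?thesis
    proof cases
      case longest
      with no_ascent G show ?thesis by simp
    next
      case H: (step j H')
      consider "i < j" | "j < i" | "i = j" by linarith
      then show ?thesis
      proof cases
        case 1
        then show ?thesis using diamond[of i j G' H'] G H by (simp add: demazure_def)
      next
        case 2
        then show ?thesis using diamond[of j i H' G'] G H by (simp add: demazure_def)
      next
        case 3
        then show ?thesis using IH[of i G' H'] G H by simp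
      qed
    qed
  qed
qed

section \<open>Column polynomials\<close>

definition prefix_card :: "nat set \<Rightarrow> nat \<Rightarrow> nat" where
  "prefix_card S t = card (S \<inter> {1..t})"

lemma prefix_card_0 [simp]: "prefix_card S 0 = 0"
  by (simp add: prefix_card_def)

lemma prefix_card_Suc: "prefix_card S (Suc t) = prefix_card S t + of_bool (Suc t \<in> S)"
proof (cases "Suc t \<in> S")
  case True
  then have "S \<inter> {1..Suc t} = insert (Suc t) (S \<inter> {1..t})" by auto
  then show ?thesis using True by (simp add: prefix_card_def)
next
  case False
  then have "S \<inter> {1..Suc t} = S \<inter> {1..t}" by (auto simp: le_Suc_eq)
  then show ?thesis using False by (simp add: prefix_card_def)
qed

lemma prefix_card_insert:
  "1 \<le> i \<Longrightarrow> i \<notin> S \<Longrightarrow> prefix_card (insert i S) t = prefix_card S t + of_bool (i \<le> t)"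
  by (induction t) (auto simp: prefix_card_Suc le_Suc_eq)

lemma prefix_card_mono: "s \<le> t \<Longrightarrow> prefix_card S s \<le> prefix_card S t"
  by (auto simp: prefix_card_def intro!: card_mono)

definition dominates :: "nat set \<Rightarrow> nat set \<Rightarrow> bool" where
  "dominates S R \<longleftrightarrow> (\<forall>t. prefix_card R t \<le> prefix_card S t)"

text \<open>The Lagrange basis of the cube: for \<open>T\<close> inside \<open>A\<close>, among 0/1
  vectors supported in \<open>A\<close> it takes the value 1 at the indicator of \<open>T\<close>
  and 0 elsewhere.\<close>

definition ml_weight :: "nat set \<Rightarrow> nat set \<Rightarrow> mpoly" where
  "ml_weight A T = (\<Prod>k\<in>T. X k) * (\<Prod>k\<in>A - T. 1 - X k)"

definition multilinear_ext :: "nat set \<Rightarrow> (nat set \<Rightarrow> bool) \<Rightarrow> mpoly" where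
  "multilinear_ext A g = (\<Sum>T\<in>Pow A. of_bool (g T) * ml_weight A T)"

definition column_poly :: "nat \<Rightarrow> nat set \<Rightarrow> mpoly" where
  "column_poly n R = multilinear_ext {1..n} (\<lambda>T. dominates T R)"

lemma sum_Pow_insert:
  assumes "finite A" "a \<notin> A"
  shows "(\<Sum>T\<in>Pow (insert a A). f T) = (\<Sum>T\<in>Pow A. f T + f (insert a T))"
proof -
  have "inj_on (insert a) (Pow A)" using assms by (auto simp: inj_on_def)
  moreover have "Pow A \<inter> insert a ` Pow A = {}" using assms by auto
  ultimately show ?thesis
    using assms by (simp add: Pow_insert sum.union_disjoint sum.reindex sum.distrib)
qed

lemma ml_weight_insert:
  assumes "finite A" "a \<notin> A" "T \<subseteq> A"
  shows "ml_weight (insert a A) T = (1 - X a) * ml_weight A T"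
    and "ml_weight (insert a A) (insert a T) = X a * ml_weight A T"
proof -
  have "insert a A - T = insert a (A - T)" "insert a A - insert a T = A - T"
    using assms by auto
  moreover have "finite T" "a \<notin> T" using assms finite_subset by auto
  ultimately show "ml_weight (insert a A) T = (1 - X a) * ml_weight A T"
    "ml_weight (insert a A) (insert a T) = X a * ml_weight A T"
    using assms by (simp_all add: ml_weight_def algebra_simps)
qed

lemma swap_vars_ml_weight:
  assumes "i \<notin> A" "Suc i \<notin> A" "T \<subseteq> A"
  shows "swap_vars i (ml_weight A T) = ml_weight A T"
proof -
  have "swap_vars i (X k) = X k" if "k \<in> A" for k
    using that assms by (auto simp: Transposition.transpose_def)
  then show ?thesis
    using assms(3) unfolding ml_weight_def swap_vars_mult swap_vars_prod swap_vars_diff swap_vars_1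
    by (intro arg_cong2[of _ _ _ _ "(*)"] prod.cong) auto
qed

text \<open>Isolates the four possible traces of a set on \<open>i\<close> and \<open>Suc i\<close>.
  The operators at \<open>i\<close> act on the bracket alone, since \<open>ml_weight B T\<close>
  contains neither variable.\<close>

lemma multilinear_ext_split:
  assumes "finite B" "i \<notin> B" "Suc i \<notin> B"
  shows "multilinear_ext (insert i (insert (Suc i) B)) g
    = (\<Sum>T\<in>Pow B. ml_weight B T * (of_bool (g T) * (1 - X i) * (1 - X (Suc i))
        + of_bool (g (insert i T)) * X i * (1 - X (Suc i))
        + of_bool (g (insert (Suc i) T)) * (1 - X i) * X (Suc i)
        + of_bool (g (insert i (insert (Suc i) T))) * X i * X (Suc i)))"
proof -
  define C where "C = insert (Suc i) B"
  have C: "finite C" "i \<notin> C" using assms by (auto simp: C_def)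
  have sub: "T \<subseteq> C" "insert (Suc i) T \<subseteq> C" if "T \<subseteq> B" for T
    using that by (auto simp: C_def)
  have "multilinear_ext (insert i C) g
     = (\<Sum>T\<in>Pow C. of_bool (g T) * ml_weight (insert i C) T + of_bool (g (insert i T)) * ml_weight (insert i C) (insert i T))"
    unfolding multilinear_ext_def by (rule sum_Pow_insert[OF C])
  also have "\<dots> = (\<Sum>T\<in>Pow B. of_bool (g T) * ml_weight (insert i C) T + of_bool (g (insert i T)) * ml_weight (insert i C) (insert i T)
    + (of_bool (g (insert (Suc i) T)) * ml_weight (insert i C) (insert (Suc i) T)
      + of_bool (g (insert i (insert (Suc i) T))) * ml_weight (insert i C) (insert i (insert (Suc i) T))))"
    unfolding C_def by (rule sum_Pow_insert) (use assms in auto)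
  also have "\<dots> = (\<Sum>T\<in>Pow B. ml_weight B T * (of_bool (g T) * (1 - X i) * (1 - X (Suc i))
        + of_bool (g (insert i T)) * X i * (1 - X (Suc i))
        + of_bool (g (insert (Suc i) T)) * (1 - X i) * X (Suc i)
        + of_bool (g (insert i (insert (Suc i) T))) * X i * X (Suc i)))"
  proof (rule sum.cong[OF refl])
    fix T assume "T \<in> Pow B"
    then have T: "T \<subseteq> B" by simp
    show "of_bool (g T) * ml_weight (insert i C) T + of_bool (g (insert i T)) * ml_weight (insert i C) (insert i T)
    + (of_bool (g (insert (Suc i) T)) * ml_weight (insert i C) (insert (Suc i) T)
      + of_bool (g (insert i (insert (Suc i) T))) * ml_weight (insert i C) (insert i (insert (Suc i) T)))
      = ml_weight B T * (of_bool (g T) * (1 - X i) * (1 - X (Suc i))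
        + of_bool (g (insert i T)) * X i * (1 - X (Suc i))
        + of_bool (g (insert (Suc i) T)) * (1 - X i) * X (Suc i)
        + of_bool (g (insert i (insert (Suc i) T))) * X i * X (Suc i))"
      unfolding ml_weight_insert[OF C sub(1)[OF T]] ml_weight_insert[OF C sub(2)[OF T]]
      unfolding C_def ml_weight_insert[OF assms(1,3) T]
      by (simp add: algebra_simps)
  qed
  finally show ?thesis by (simp add: C_def)
qed

lemma swap_vars_of_bool [simp]: "swap_vars i (of_bool b) = of_bool b"
  by (cases b) auto

lemma swap_vars_multilinear_ext:
  assumes "finite B" "i \<notin> B" "Suc i \<notin> B"
    and "\<And>T. T \<subseteq> B \<Longrightarrow> g (insert i T) \<longleftrightarrow> g (insert (Suc i) T)"
  shows "swap_vars i (multilinear_ext (insert i (insert (Suc i) B)) g)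
    = multilinear_ext (insert i (insert (Suc i) B)) g"
  unfolding multilinear_ext_split[OF assms(1-3)] swap_vars_sum
proof (rule sum.cong[OF refl])
  fix T assume "T \<in> Pow B"
  then have T: "T \<subseteq> B" by simp
  show "swap_vars i (ml_weight B T * (of_bool (g T) * (1 - X i) * (1 - X (Suc i))
        + of_bool (g (insert i T)) * X i * (1 - X (Suc i))
        + of_bool (g (insert (Suc i) T)) * (1 - X i) * X (Suc i)
        + of_bool (g (insert i (insert (Suc i) T))) * X i * X (Suc i)))
    = ml_weight B T * (of_bool (g T) * (1 - X i) * (1 - X (Suc i))
        + of_bool (g (insert i T)) * X i * (1 - X (Suc i))
        + of_bool (g (insert (Suc i) T)) * (1 - X i) * X (Suc i)
        + of_bool (g (insert i (insert (Suc i) T))) * X i * X (Suc i))"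
    unfolding swap_vars_add swap_vars_mult swap_vars_diff swap_vars_1 swap_vars_of_bool swap_vars_X
      swap_vars_ml_weight[OF assms(2,3) T] assms(4)[OF T] transpose_apply_first transpose_apply_second
    by algebra
qed

text \<open>With the factor \<open>X i\<close>, the term of \<open>insert (Suc i) T\<close> contains
  X i (1 - X i) X (Suc i), which the operator sends to 0; so \<open>g'\<close> may differ from
  \<open>g\<close> there. The term of \<open>insert i T\<close> is sent to X i (1 - X (Suc i)) + (1
  - X i) X (Suc i), which refills that place with the same value, in accordance with the symmetry of
  \<open>g\<close>.\<close>

lemma demazure_multilinear_ext:
  assumes B: "finite B" "i \<notin> B" "Suc i \<notin> B"
    and sym: "\<And>T. T \<subseteq> B \<Longrightarrow> g (insert i T) \<longleftrightarrow> g (insert (Suc i) T)"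
    and eq: "\<And>T. T \<subseteq> B \<Longrightarrow> g' T \<longleftrightarrow> g T" "\<And>T. T \<subseteq> B \<Longrightarrow> g' (insert i T) \<longleftrightarrow> g (insert i T)"
      "\<And>T. T \<subseteq> B \<Longrightarrow> g' (insert i (insert (Suc i) T)) \<longleftrightarrow> g (insert i (insert (Suc i) T))"
  shows "demazure i (X i * multilinear_ext (insert i (insert (Suc i) B)) g')
    = multilinear_ext (insert i (insert (Suc i) B)) g"
proof (rule demazure_eqI)
  let ?x = "X i" and ?y = "X (Suc i)"
  show "(?x - ?y) * multilinear_ext (insert i (insert (Suc i) B)) g =
    (1 - ?y) * (?x * multilinear_ext (insert i (insert (Suc i) B)) g') -
    (1 - ?x) * swap_vars i (?x * multilinear_ext (insert i (insert (Suc i) B)) g')"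
    unfolding multilinear_ext_split[OF B] swap_vars_mult swap_vars_sum sum_distrib_left sum_subtractf[symmetric]
  proof (rule sum.cong[OF refl])
    fix T assume "T \<in> Pow B"
    then have T: "T \<subseteq> B" by simp
    define m :: mpoly where "m = ml_weight B T"
    define a b c d :: mpoly where "a = of_bool (g T)" and "b = of_bool (g (insert i T))"
      and "c = of_bool (g' (insert (Suc i) T))" and "d = of_bool (g (insert i (insert (Suc i) T)))"
    show "(?x - ?y) * (ml_weight B T * (of_bool (g T) * (1 - ?x) * (1 - ?y) + of_bool (g (insert i T)) * ?x * (1 - ?y)
         + of_bool (g (insert (Suc i) T)) * (1 - ?x) * ?y + of_bool (g (insert i (insert (Suc i) T))) * ?x * ?y)) =
      (1 - ?y) * (?x * (ml_weight B T * (of_bool (g' T) * (1 - ?x) * (1 - ?y) + of_bool (g' (insert i T)) * ?x * (1 - ?y)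
         + of_bool (g' (insert (Suc i) T)) * (1 - ?x) * ?y + of_bool (g' (insert i (insert (Suc i) T))) * ?x * ?y))) -
      (1 - ?x) * (swap_vars i ?x * (swap_vars i (ml_weight B T) * swap_vars i (of_bool (g' T) * (1 - ?x) * (1 - ?y) + of_bool (g' (insert i T)) * ?x * (1 - ?y)
         + of_bool (g' (insert (Suc i) T)) * (1 - ?x) * ?y + of_bool (g' (insert i (insert (Suc i) T))) * ?x * ?y)))"
      unfolding swap_vars_ml_weight[OF B(2,3) T] swap_vars_add swap_vars_mult swap_vars_diff swap_vars_1
        swap_vars_of_bool swap_vars_X transpose_apply_first transpose_apply_second
        eq[OF T] sym[OF T, symmetric]
      unfolding m_def[symmetric] a_def[symmetric] b_def[symmetric] c_def[symmetric] d_def[symmetric]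
      by algebra
  qed
qed

lemma demazure_mult_symmetric:
  assumes "swap_vars i q = q"
  shows "demazure i (f * q) = demazure i f * q"
proof (rule demazure_eqI)
  have "(X i - X (Suc i)) * (demazure i f * q) = ((1 - X (Suc i)) * f - (1 - X i) * swap_vars i f) * q"
    by (simp add: demazure_exact flip: mult.assoc)
  then show "(X i - X (Suc i)) * (demazure i f * q) = (1 - X (Suc i)) * (f * q) - (1 - X i) * swap_vars i (f * q)"
    by (simp add: assms algebra_simps)
qed

text \<open>The numerator is \<open>q\<close> times X i (1 - X (Suc i)) - X (Suc i) (1 - X i), and
  the latter is the denominator.\<close>

lemma demazure_X_mult_symmetric:
  assumes "swap_vars i q = q"
  shows "demazure i (X i * q) = q"
  by (rule demazure_eqI) (simp add: assms algebra_simps)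

section \<open>Domination under exchange of adjacent indices\<close>

lemma dominates_insert_adjacent:
  assumes "1 \<le> i" "i \<notin> T" "Suc i \<notin> T" and R: "i \<in> R \<Longrightarrow> Suc i \<in> R"
  shows "dominates (insert i T) R \<longleftrightarrow> dominates (insert (Suc i) T) R"
proof
  assume "dominates (insert (Suc i) T) R"
  then have "prefix_card R t \<le> prefix_card T t + of_bool (Suc i \<le> t)" for t
    using assms by (simp add: dominates_def prefix_card_insert)
  moreover have "of_bool (Suc i \<le> t) \<le> (of_bool (i \<le> t) :: nat)" for t by simp
  ultimately show "dominates (insert i T) R"
    using assms unfolding dominates_def by (metis add_left_mono order_trans prefix_card_insert)
next
  assume "dominates (insert i T) R"
  then have le: "prefix_card R t \<le> prefix_card T t + of_bool (i \<le> t)" for t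
    using assms by (simp add: dominates_def prefix_card_insert)
  obtain i' where i': "i = Suc i'" using assms(1) by (cases i) auto
  have "prefix_card R i \<le> prefix_card T i"
    using le[of i'] le[of "Suc i"] assms by (cases "i \<in> R") (auto simp: prefix_card_Suc i')
  then have "prefix_card R t \<le> prefix_card T t + of_bool (Suc i \<le> t)" for t
    using le[of t] by (cases "t = i") (auto split: if_splits)
  then show "dominates (insert (Suc i) T) R"
    using assms by (simp add: dominates_def prefix_card_insert)
qed

text \<open>Only t = i matters, where the row \<open>i\<close> demands one element more than the row
  \<open>Suc i\<close>. If the set avoids both indices, this demand follows from the condition at i
  + 1; if it contains \<open>i\<close>, from the condition at i - 1. The remaining trace,
  \<open>Suc i\<close> without \<open>i\<close>, is the one annihilated in
  \<open>demazure_multilinear_ext\<close>.\<close>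

lemma dominates_shift:
  assumes i: "1 \<le> i" and T: "i \<notin> T" "Suc i \<notin> T" and R: "i \<notin> R" "Suc i \<notin> R"
  shows "dominates T (insert i R) \<longleftrightarrow> dominates T (insert (Suc i) R)"
    and "dominates (insert i T) (insert i R) \<longleftrightarrow> dominates (insert i T) (insert (Suc i) R)"
    and "dominates (insert i (insert (Suc i) T)) (insert i R)
      \<longleftrightarrow> dominates (insert i (insert (Suc i) T)) (insert (Suc i) R)"
proof -
  obtain i' where i': "i = Suc i'" using i by (cases i) auto
  have T': "i \<notin> insert (Suc i) T" using T by simp
  have eqI: "(\<forall>t. prefix_card R t + of_bool (i \<le> t) \<le> f t) \<longleftrightarrow> (\<forall>t. prefix_card R t + of_bool (Suc i \<le> t) \<le> f t)"
    if "(\<forall>t. prefix_card R t + of_bool (Suc i \<le> t) \<le> f t) \<Longrightarrow> prefix_card R i + 1 \<le> f i" for f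
  proof
    assume L: "\<forall>t. prefix_card R t + of_bool (Suc i \<le> t) \<le> f t"
    show "\<forall>t. prefix_card R t + of_bool (i \<le> t) \<le> f t"
    proof
      fix t show "prefix_card R t + of_bool (i \<le> t) \<le> f t"
        using that[OF L] spec[OF L, of t] by (cases "t = i") (auto split: if_splits)
    qed
  next
    assume L: "\<forall>t. prefix_card R t + of_bool (i \<le> t) \<le> f t"
    show "\<forall>t. prefix_card R t + of_bool (Suc i \<le> t) \<le> f t"
    proof
      fix t show "prefix_card R t + of_bool (Suc i \<le> t) \<le> f t"
        using spec[OF L, of t] by (auto split: if_splits)
    qed
  qed
  note defs = dominates_def prefix_card_insert[OF i T(1)] prefix_card_insert[OF i R(1)]
    prefix_card_insert[OF le_SucI[OF i] T(2)] prefix_card_insert[OF le_SucI[OF i] R(2)] prefix_card_insert[OF i T'(1)]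
  show "dominates T (insert i R) \<longleftrightarrow> dominates T (insert (Suc i) R)"
    unfolding defs
  proof (rule eqI)
    assume "\<forall>t. prefix_card R t + of_bool (Suc i \<le> t) \<le> prefix_card T t"
    then show "prefix_card R i + 1 \<le> prefix_card T i"
      by - (drule spec[of _ "Suc i"], use T R in \<open>simp add: prefix_card_Suc\<close>)
  qed
  show "dominates (insert i T) (insert i R) \<longleftrightarrow> dominates (insert i T) (insert (Suc i) R)"
    unfolding defs
  proof (rule eqI)
    assume "\<forall>t. prefix_card R t + of_bool (Suc i \<le> t) \<le> prefix_card T t + of_bool (i \<le> t)"
    from spec[OF this, of i'] show "prefix_card R i + 1 \<le> prefix_card T i + of_bool (i \<le> i)"
      using T R by (simp add: i' prefix_card_Suc)
  qed
  show "dominates (insert i (insert (Suc i) T)) (insert i R)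
      \<longleftrightarrow> dominates (insert i (insert (Suc i) T)) (insert (Suc i) R)"
    unfolding defs
  proof (rule eqI)
    assume "\<forall>t. prefix_card R t + of_bool (Suc i \<le> t) \<le> prefix_card T t + of_bool (Suc i \<le> t) + of_bool (i \<le> t)"
    from spec[OF this, of i'] show "prefix_card R i + 1 \<le> prefix_card T i + of_bool (Suc i \<le> i) + of_bool (i \<le> i)"
      using T R by (simp add: i' prefix_card_Suc)
  qed
qed

lemma interval_split_adjacent:
  assumes "1 \<le> i" "i < n"
  shows "{1..n} = insert i (insert (Suc i) ({1..n} - {i, Suc i}))"
  using assms by auto

lemma swap_vars_column_poly:
  assumes "1 \<le> i" "i < n" "i \<in> R \<Longrightarrow> Suc i \<in> R"
  shows "swap_vars i (column_poly n R) = column_poly n R"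
  unfolding column_poly_def
proof (subst (1 2) interval_split_adjacent[OF assms(1,2)], rule swap_vars_multilinear_ext)
  fix T assume "T \<subseteq> {1..n} - {i, Suc i}"
  then show "dominates (insert i T) R \<longleftrightarrow> dominates (insert (Suc i) T) R"
    using assms by (intro dominates_insert_adjacent) auto
qed auto

lemma demazure_column_poly:
  assumes "1 \<le> i" "i < n" "i \<notin> R" "Suc i \<notin> R"
  shows "demazure i (X i * column_poly n (insert i R)) = column_poly n (insert (Suc i) R)"
  unfolding column_poly_def
proof (subst (1 2) interval_split_adjacent[OF assms(1,2)], rule demazure_multilinear_ext)
  fix T assume "T \<subseteq> {1..n} - {i, Suc i}"
  then have T: "i \<notin> T" "Suc i \<notin> T" by auto
  show "dominates (insert i T) (insert (Suc i) R) \<longleftrightarrow> dominates (insert (Suc i) T) (insert (Suc i) R)"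
    using assms T by (intro dominates_insert_adjacent) auto
  show "dominates T (insert i R) \<longleftrightarrow> dominates T (insert (Suc i) R)"
    and "dominates (insert i T) (insert i R) \<longleftrightarrow> dominates (insert i T) (insert (Suc i) R)"
    and "dominates (insert i (insert (Suc i) T)) (insert i R)
      \<longleftrightarrow> dominates (insert i (insert (Suc i) T)) (insert (Suc i) R)"
    by (rule dominates_shift[OF assms(1) T assms(3,4)])+
qed auto

lemma prefix_card_interval: "prefix_card {1..m} t = min m t"
  by (simp add: prefix_card_def min.commute)

lemma dominates_interval: "dominates T {1..m} \<longleftrightarrow> {1..m} \<subseteq> T"
proof
  assume "dominates T {1..m}"
  then have "m \<le> card (T \<inter> {1..m})"
    unfolding dominates_def prefix_card_interval by (metis min.idem prefix_card_def)
  then have "T \<inter> {1..m} = {1..m}"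
    by (intro card_seteq) auto
  then show "{1..m} \<subseteq> T" by blast
next
  assume "{1..m} \<subseteq> T"
  then have "card ({1..m} \<inter> {1..t}) \<le> card (T \<inter> {1..t})" for t by (intro card_mono) auto
  then show "dominates T {1..m}"
    unfolding dominates_def prefix_card_def by blast
qed

lemma column_poly_interval:
  assumes "m \<le> n"
  shows "column_poly n {1..m} = (\<Prod>k\<in>{1..m}. X k)"
proof -
  \<comment> \<open>A zero complementary factor on \<open>{1..m}\<close> discards exactly the sets
    missing one of these indices. The sum then factors into \<open>X k + g k\<close>, which is 1 for
    k > m.\<close>
  define g where "g k = (if k \<in> {1..m} then 0 else 1 - X k)" for k
  have "column_poly n {1..m} = (\<Sum>T\<in>Pow {1..n}. (\<Prod>k\<in>T. X k) * (\<Prod>k\<in>{1..n} - T. g k))"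
    unfolding column_poly_def multilinear_ext_def
  proof (rule sum.cong[OF refl])
    fix T assume T: "T \<in> Pow {1..n}"
    show "of_bool (dominates T {1..m}) * ml_weight {1..n} T = (\<Prod>k\<in>T. X k) * (\<Prod>k\<in>{1..n} - T. g k)"
    proof (cases "{1..m} \<subseteq> T")
      case True
      then have "(\<Prod>k\<in>{1..n} - T. g k) = (\<Prod>k\<in>{1..n} - T. 1 - X k)"
        by (intro prod.cong) (auto simp: g_def)
      then show ?thesis using True by (simp add: dominates_interval ml_weight_def del: One_nat_def)
    next
      case False
      then have "\<exists>k\<in>{1..n} - T. g k = 0" using assms by (auto simp: g_def)
      then have "(\<Prod>k\<in>{1..n} - T. g k) = 0" by (intro prod_zero) auto
      then show ?thesis using False by (simp add: dominates_interval del: One_nat_def)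
    qed
  qed
  also have "\<dots> = (\<Prod>k\<in>{1..n}. X k + g k)" by (rule prod_add[symmetric]) simp
  also have "\<dots> = (\<Prod>k\<in>{1..m}. X k)"
    using assms by (intro prod.mono_neutral_cong_right) (auto simp: g_def)
  finally show ?thesis .
qed

section \<open>Diagram columns and pattern occurrences\<close>

definition diagram_column :: "(nat \<Rightarrow> nat) \<Rightarrow> nat \<Rightarrow> nat set" where
  "diagram_column w q = {t. 1 \<le> t \<and> t < q \<and> w q < w t}"

lemma avoids_patternD4:
  assumes "avoids_pattern n w [x, y, z, u]"
    and "1 \<le> a" "a < b" "b < c" "c < d" "d \<le> n"
    and "\<And>i j. i < 4 \<Longrightarrow> j < 4 \<Longrightarrow> w ([a,b,c,d] ! i) < w ([a,b,c,d] ! j) \<longleftrightarrow> [x,y,z,u] ! i < [x,y,z,u] ! j"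
  shows False
proof -
  have "contains_pattern n w [x, y, z, u]"
    unfolding contains_pattern_def
  proof (intro exI[of _ "(!) [a,b,c,d]"] conjI)
    show "strict_mono_on {..<length [x,y,z,u]} ((!) [a,b,c,d])"
      using assms by (auto simp: strict_mono_on_def less_Suc_eq nth_Cons')
    show "(!) [a,b,c,d] ` {..<length [x,y,z,u]} \<subseteq> {1..n}"
      using assms by (auto simp: less_Suc_eq nth_Cons')
  qed (use assms(7) in simp)
  then show False using assms(1) by (simp add: avoids_pattern_def)
qed

lemma avoids_1432D:
  assumes "avoids_pattern n w [1,4,3,2]" "1 \<le> a" "a < b" "b < c" "c < d" "d \<le> n"
    "w a < w d" "w d < w c" "w c < w b"
  shows False
  by (rule avoids_patternD4[OF assms(1-6)]) (use assms(7-9) in \<open>auto simp: less_Suc_eq numeral_eq_Suc\<close>)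

lemma avoids_1423D:
  assumes "avoids_pattern n w [1,4,2,3]" "1 \<le> a" "a < b" "b < c" "c < d" "d \<le> n"
    "w a < w c" "w c < w d" "w d < w b"
  shows False
  by (rule avoids_patternD4[OF assms(1-6)]) (use assms(7-9) in \<open>auto simp: less_Suc_eq numeral_eq_Suc\<close>)

lemma avoids_13254D:
  assumes "avoids_pattern n w [1,3,2,5,4]" "1 \<le> a" "a < b" "b < c" "c < d" "d < e" "e \<le> n"
    "w a < w c" "w c < w b" "w b < w e" "w e < w d"
  shows False
proof -
  have "contains_pattern n w [1,3,2,5,4]"
    unfolding contains_pattern_def
  proof (intro exI[of _ "(!) [a,b,c,d,e]"] conjI)
    show "strict_mono_on {..<length [1,3,2,5,4::nat]} ((!) [a,b,c,d,e])"
      using assms by (auto simp: strict_mono_on_def less_Suc_eq nth_Cons')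
    show "(!) [a,b,c,d,e] ` {..<length [1,3,2,5,4::nat]} \<subseteq> {1..n}"
      using assms by (auto simp: less_Suc_eq nth_Cons')
    show "\<forall>i<length [1,3,2,5,4::nat]. \<forall>j<length [1,3,2,5,4::nat].
      (w ([a,b,c,d,e] ! i) < w ([a,b,c,d,e] ! j)) \<longleftrightarrow> [1,3,2,5,4::nat] ! i < [1,3,2,5,4] ! j"
      using assms by (auto simp: less_Suc_eq numeral_eq_Suc)
  qed
  then show False using assms(1) by (simp add: avoids_pattern_def)
qed

text \<open>An occurrence after the exchange that does not use both positions \<open>i\<close> and
  \<open>Suc i\<close> is carried back by the transposition. If it uses both, they carry a descent
  of the pattern, so its smallest letter sits at an earlier position, with a value below
  \<open>w i\<close>; but all values before \<open>i\<close> are larger than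
  \<open>w i\<close>.\<close>

lemma avoids_pattern_first_ascent:
  assumes av: "avoids_pattern n w \<tau>"
    and i: "1 \<le> i" "i < n" "w i < w (Suc i)"
    and dec: "\<And>a. 1 \<le> a \<Longrightarrow> a < i \<Longrightarrow> w i < w a"
    and \<tau>: "\<And>x. 0 < x \<Longrightarrow> x < length \<tau> \<Longrightarrow> \<tau> ! 0 < \<tau> ! x"
  shows "avoids_pattern n (w \<circ> Transposition.transpose i (Suc i)) \<tau>"
  unfolding avoids_pattern_def
proof
  let ?t = "Transposition.transpose i (Suc i)"
  assume "contains_pattern n (w \<circ> ?t) \<tau>"
  then obtain p where mono: "strict_mono_on {..<length \<tau>} p" and p: "p ` {..<length \<tau>} \<subseteq> {1..n}"
    and ord: "\<And>a b. a < length \<tau> \<Longrightarrow> b < length \<tau> \<Longrightarrow> w (?t (p a)) < w (?t (p b)) \<longleftrightarrow> \<tau> ! a < \<tau> ! b"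
    unfolding contains_pattern_def by auto
  show False
  proof (cases "\<exists>a b. a < b \<and> b < length \<tau> \<and> p a = i \<and> p b = Suc i")
    case True
    then obtain a b where ab: "a < b" "b < length \<tau>" "p a = i" "p b = Suc i" by blast
    have "\<tau> ! b < \<tau> ! a" using ord[of b a] ab i by simp
    then have "0 < a" using \<tau>[of b] ab by (cases "a = 0") auto
    then have "p 0 < i" using strict_mono_onD[OF mono, of 0 a] ab by (cases "\<tau> = []") auto
    moreover have "1 \<le> p 0" using p ab by force
    moreover have "w (?t (p 0)) < w (?t (p b))" using ord[of 0 b] \<tau>[of b] ab by (cases "\<tau> = []") auto
    ultimately show False using dec[of "p 0"] ab by (simp add: Transposition.transpose_def)
  next
    case False
    have "strict_mono_on {..<length \<tau>} (?t \<circ> p)"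
    proof (rule strict_mono_onI)
      fix a b assume "a \<in> {..<length \<tau>}" "b \<in> {..<length \<tau>}" "a < b"
      then have "p a < p b" "\<not> (p a = i \<and> p b = Suc i)"
        using mono False by (auto simp: strict_mono_on_def)
      then show "(?t \<circ> p) a < (?t \<circ> p) b" by (auto simp: Transposition.transpose_def)
    qed
    moreover have "(?t \<circ> p) ` {..<length \<tau>} \<subseteq> {1..n}"
      using p i by (force simp: Transposition.transpose_def)
    ultimately have "contains_pattern n w \<tau>"
      unfolding contains_pattern_def using ord by (intro exI[of _ "?t \<circ> p"]) auto
    then show False using av by (simp add: avoids_pattern_def)
  qed
qed

section \<open>Product formula\<close>

lemma eq_transpose_imageI:
  assumes "\<And>t. t \<in> A \<longleftrightarrow> Transposition.transpose i j t \<in> B"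
  shows "A = Transposition.transpose i j ` B"
proof (intro equalityI subsetI)
  fix t assume "t \<in> A"
  then have "Transposition.transpose i j t \<in> B" using assms[of t] by blast
  then show "t \<in> Transposition.transpose i j ` B"
    by (metis image_eqI transpose_involutory)
next
  fix t assume "t \<in> Transposition.transpose i j ` B"
  then obtain y where "y \<in> B" "t = Transposition.transpose i j y" by blast
  then show "t \<in> A" using assms[of t] by simp
qed

text \<open>The effect of the exchange on the diagram: the initial-segment column moves from
  position \<open>i\<close> to \<open>Suc i\<close> and gains the row \<open>i\<close>, the old
  column \<open>Suc i\<close> becomes column \<open>i\<close>, and every other column only has its
  rows \<open>i\<close> and \<open>Suc i\<close> interchanged.\<close>

lemma diagram_column_first_ascent:
  assumes "inj w" and i: "1 \<le> i" "w i < w (Suc i)"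
    and dec: "\<forall>a\<in>{1..<i}. w i < w a"
  defines "v \<equiv> w \<circ> Transposition.transpose i (Suc i)"
  shows "diagram_column w i = {1..i - 1}" "diagram_column v (Suc i) = {1..i}" "diagram_column v i = diagram_column w (Suc i)"
    and "i \<notin> diagram_column w (Suc i)" "Suc i \<notin> diagram_column w (Suc i)"
    and "q \<noteq> i \<Longrightarrow> q \<noteq> Suc i \<Longrightarrow> diagram_column v q = Transposition.transpose i (Suc i) ` diagram_column w q"
    and "q \<noteq> i \<Longrightarrow> q \<noteq> Suc i \<Longrightarrow> i \<in> diagram_column w q \<Longrightarrow> Suc i \<in> diagram_column w q"
proof -
  show "diagram_column w i = {1..i - 1}"
    using dec by (auto simp: diagram_column_def)
  show "diagram_column v (Suc i) = {1..i}"
    using dec i by (auto simp: diagram_column_def v_def Transposition.transpose_def less_Suc_eq)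
  show "diagram_column v i = diagram_column w (Suc i)"
    using i by (auto simp: diagram_column_def v_def Transposition.transpose_def less_Suc_eq)
  show "i \<notin> diagram_column w (Suc i)" "Suc i \<notin> diagram_column w (Suc i)"
    using i by (auto simp: diagram_column_def)
  let ?t = "Transposition.transpose i (Suc i)"
  show "diagram_column v q = ?t ` diagram_column w q" if q: "q \<noteq> i" "q \<noteq> Suc i"
  proof -
    have "t \<in> diagram_column v q \<longleftrightarrow> ?t t \<in> diagram_column w q" for t
      using q i by (auto simp: diagram_column_def v_def Transposition.transpose_def)
    then show ?thesis by (rule eq_transpose_imageI)
  qed
  show "Suc i \<in> diagram_column w q" if "q \<noteq> i" "q \<noteq> Suc i" "i \<in> diagram_column w q"
    using that i by (auto simp: diagram_column_def)
qed

lemma transpose_image_eq: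
  assumes "i \<in> S \<longleftrightarrow> j \<in> S"
  shows "Transposition.transpose i j ` S = S"
  by (rule eq_transpose_imageI[symmetric]) (use assms in \<open>auto simp: Transposition.transpose_def\<close>)

lemma prod_triangle:
  fixes f :: "nat \<Rightarrow> 'a::comm_monoid_mult"
  shows "(\<Prod>q\<in>{1..n}. \<Prod>k\<in>{1..q - 1}. f k) = (\<Prod>k=1..<n. f k ^ (n - k))"
proof (induction n)
  case (Suc n)
  have "(\<Prod>q\<in>{1..Suc n}. \<Prod>k\<in>{1..q - 1}. f k) = (\<Prod>k=1..<n. f k ^ (n - k)) * (\<Prod>k\<in>{1..n}. f k)"
    using Suc by (simp del: One_nat_def)
  also have "(\<Prod>k=1..<n. f k ^ (n - k)) = (\<Prod>k\<in>{1..n}. f k ^ (n - k))"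
    by (rule prod.mono_neutral_left) (auto simp: not_less)
  also have "\<dots> * (\<Prod>k\<in>{1..n}. f k) = (\<Prod>k\<in>{1..n}. f k ^ (Suc n - k))"
    by (subst prod.distrib[symmetric], rule prod.cong) (auto simp: Suc_diff_le mult.commute)
  also have "{1..n} = {1..<Suc n}" by auto
  finally show ?case .
qed simp

theorem grothendieck_product:
  assumes "w permutes {1..n}" "avoids_pattern n w [1,4,3,2]" "avoids_pattern n w [1,4,2,3]"
  shows "grothendieck n w (\<Prod>q\<in>{1..n}. column_poly n (diagram_column w q))"
  using assms
proof (induction "perm_weight n w" arbitrary: w rule: less_induct)
  case less
  note w = less.prems(1)
  have inj: "inj w" using permutes_inj[OF w] .
  show ?case
  proof (cases "w = longest_perm n")
    case True
    have "(\<Prod>q\<in>{1..n}. column_poly n (diagram_column w q)) = (\<Prod>q\<in>{1..n}. \<Prod>k\<in>{1..q - 1}. X k)"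
    proof (rule prod.cong[OF refl])
      fix q assume q: "q \<in> {1..n}"
      then have "diagram_column w q = {1..q - 1}"
        by (auto simp: diagram_column_def True longest_perm_def)
      moreover have "q - 1 \<le> n" using q by auto
      ultimately show "column_poly n (diagram_column w q) = (\<Prod>k\<in>{1..q - 1}. X k)"
        using column_poly_interval[of "q - 1" n] by simp
    qed
    then show ?thesis
      using grothendieck.longest[of n] by (simp only: prod_triangle True)
  next
    case False
    obtain i where i: "1 \<le> i" "i < n" "w i < w (Suc i)"
      and dec: "\<And>a b. 1 \<le> a \<Longrightarrow> a < b \<Longrightarrow> b \<le> i \<Longrightarrow> w b < w a"
      using first_ascent[OF w False] by blast
    have dec': "\<forall>a\<in>{1..<i}. w i < w a" using dec by simp
    define v where "v = w \<circ> Transposition.transpose i (Suc i)"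
    note col = diagram_column_first_ascent[OF inj i(1,3) dec', folded v_def]
    have "grothendieck n v (\<Prod>q\<in>{1..n}. column_poly n (diagram_column v q))"
      unfolding v_def
      by (intro less.hyps perm_weight_less permutes_comp_adjacent_transpose
          avoids_pattern_first_ascent i w less.prems)
         (use dec' in \<open>auto simp: less_Suc_eq\<close>)
    then have G: "grothendieck n w (demazure i (\<Prod>q\<in>{1..n}. column_poly n (diagram_column v q)))"
      unfolding v_def by (rule grothendieck_demazure[OF w i])
    define S where "S = {1..n} - {i, Suc i}"
    have S: "{1..n} = insert i (insert (Suc i) S)" "i \<notin> S" "Suc i \<notin> S" "finite S"
      using i by (auto simp: S_def)
    \<comment> \<open>By \<open>col(7)\<close> a column in \<open>S\<close> containing exactly one
      of the two rows contains \<open>Suc i\<close>, so these are the only columns in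
      \<open>S\<close> changed by the exchange.\<close>
    define special where "special q \<longleftrightarrow> i \<notin> diagram_column w q \<and> Suc i \<in> diagram_column w q" for q
    \<comment> \<open>Two special columns would have values between \<open>w i\<close> and
      \<open>w (Suc i)\<close> at positions to the right of both, completing a 1423 or a
      1432.\<close>
    have special_unique: "q = q'" if "q \<in> S" "q' \<in> S" "special q" "special q'" for q q'
    proof -
      have no: False if "q < q'" "q \<in> S" "q' \<in> S" "special q" "special q'" for q q'
      proof -
        have b: "Suc i < q" "q' \<le> n" "w i < w q" "w i < w q'" "w q < w (Suc i)" "w q' < w (Suc i)"
          using that i injD[OF inj, of i q] injD[OF inj, of i q']
          by (auto simp: special_def diagram_column_def S_def not_less le_less)
        have "w q \<noteq> w q'" using \<open>q < q'\<close> injD[OF inj, of q q'] by auto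
        then consider "w q < w q'" | "w q' < w q" by linarith
        then show False
          using avoids_1423D[OF less.prems(3) i(1), of "Suc i" q q'] that(1) b
            avoids_1432D[OF less.prems(2) i(1), of "Suc i" q q'] by cases auto
      qed
      then show ?thesis using that by (metis linorder_neqE_nat)
    qed
    have same: "diagram_column v q = diagram_column w q" "swap_vars i (column_poly n (diagram_column w q)) = column_poly n (diagram_column w q)"
      if "q \<in> S" "\<not> special q" for q
    proof -
      have q: "q \<noteq> i" "q \<noteq> Suc i" using that by (auto simp: S_def)
      then show "diagram_column v q = diagram_column w q"
        using col(6)[OF q] col(7)[OF q] that transpose_image_eq[of i "diagram_column w q" "Suc i"]
        unfolding special_def by blast
      show "swap_vars i (column_poly n (diagram_column w q)) = column_poly n (diagram_column w q)"
        using col(7)[OF q] i by (intro swap_vars_column_poly)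
    qed
    let ?P = "\<lambda>u A. \<Prod>q\<in>A. column_poly n (diagram_column u q)"
    \<comment> \<open>The row gained by the initial-segment column is the source of the factor
      \<open>X i\<close> that the operator consumes.\<close>
    have "column_poly n {1..i} = column_poly n {1..i - 1} * X i"
      using i by (cases i) (simp_all add: column_poly_interval del: One_nat_def)
    then have v_prod: "?P v {1..n} = X i * ?P v S * (column_poly n (diagram_column w (Suc i)) * column_poly n (diagram_column w i))"
      using S by (simp add: col(1-3) algebra_simps)
    have w_prod: "?P w {1..n} = ?P w S * (column_poly n (diagram_column w (Suc i)) * column_poly n (diagram_column w i))"
      using S by (simp add: algebra_simps)
    have "Suc i \<notin> diagram_column w i" "i \<notin> diagram_column w i" by (auto simp: diagram_column_def)
    then have sym: "swap_vars i (column_poly n (diagram_column w (Suc i)) * column_poly n (diagram_column w i))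
      = column_poly n (diagram_column w (Suc i)) * column_poly n (diagram_column w i)"
      using swap_vars_column_poly[OF i(1,2), of "diagram_column w i"] col(4)
        swap_vars_column_poly[OF i(1,2), of "diagram_column w (Suc i)"] by simp
    have "demazure i (X i * ?P v S) = ?P w S"
    proof (cases "\<exists>q\<in>S. special q")
      case True
      then obtain p where p: "p \<in> S" "special p" by blast
      have rest: "q \<in> S" "\<not> special q" if "q \<in> S - {p}" for q
        using that special_unique p by auto
      have "?P v (S - {p}) = ?P w (S - {p})"
        by (rule prod.cong[OF refl]) (use same(1)[OF rest] in simp)
      then have pv: "?P v S = column_poly n (diagram_column v p) * ?P w (S - {p})"
        using prod.remove[OF S(4) p(1), of "\<lambda>q. column_poly n (diagram_column v q)"] by simp
      have pw: "?P w S = column_poly n (diagram_column w p) * ?P w (S - {p})"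
        by (rule prod.remove[OF S(4) p(1)])
      have sym': "swap_vars i (?P w (S - {p})) = ?P w (S - {p})"
        unfolding swap_vars_prod by (rule prod.cong[OF refl]) (use same(2) rest in blast)
      define R where "R = diagram_column w p - {Suc i}"
      have R: "diagram_column w p = insert (Suc i) R" "i \<notin> R" "Suc i \<notin> R"
        using p by (auto simp: R_def special_def)
      have "p \<noteq> i" "p \<noteq> Suc i" using p by (auto simp: S_def)
      then have "diagram_column v p = insert i R"
        using col(6)[of p] R transpose_image_eq[of i R "Suc i"] by simp
      then have "demazure i (X i * column_poly n (diagram_column v p)) = column_poly n (diagram_column w p)"
        using demazure_column_poly[OF i(1,2) R(2,3)] R(1) by simp
      then show ?thesis
        unfolding pv pw using demazure_mult_symmetric[OF sym', of "X i * column_poly n (diagram_column v p)"]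
        by (simp add: mult.assoc)
    next
      case False
      have "?P v S = ?P w S" using same(1) False by (intro prod.cong) auto
      moreover have "swap_vars i (?P w S) = ?P w S"
        unfolding swap_vars_prod by (rule prod.cong[OF refl]) (use same(2) False in blast)
      ultimately show ?thesis using demazure_X_mult_symmetric by simp
    qed
    then show ?thesis
      using G unfolding v_prod w_prod by (simp add: demazure_mult_symmetric[OF sym])
  qed
qed

section \<open>Coefficients of column polynomials\<close>

definition monom_set :: "nat set \<Rightarrow> mpoly" where
  "monom_set S = (\<Prod>k\<in>S. X k)"

text \<open>For positive rows these are the spanning sets of the Schubert matroid without its loops.
  Inserting 0 gives the empty set of rows the bound 0, leaving only the empty set.\<close>

definition spanning :: "nat set \<Rightarrow> nat set set" where
  "spanning R = {S. S \<subseteq> {1..Max (insert 0 R)} \<and> dominates S R}"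

text \<open>The partial sums over \<open>T \<subseteq> {1..N}\<close> satisfy a deletion-contraction recursion in \<open>N\<close>, from which
  the sign of every coefficient can be read off.\<close>

definition partial_poly :: "nat set \<Rightarrow> nat \<Rightarrow> nat \<Rightarrow> mpoly" where
  "partial_poly R N r =
     multilinear_ext {1..N} (\<lambda>T. (\<forall>t<N. prefix_card R t \<le> prefix_card T t) \<and> r \<le> card T)"

lemma prefix_card_eq_card: "S \<subseteq> {1..t} \<Longrightarrow> prefix_card S t = card S"
  by (simp add: prefix_card_def Int_absorb2)

lemma prefix_card_insert_Suc: "t \<le> N \<Longrightarrow> prefix_card (insert (Suc N) T) t = prefix_card T t"
  unfolding prefix_card_def by (rule arg_cong[of _ _ card]) auto

lemma partial_poly_0: "partial_poly R 0 r = of_bool (r = 0)"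
  by (simp add: partial_poly_def multilinear_ext_def ml_weight_def)

text \<open>Split on membership of \<open>Suc N\<close>. For a subset of \<open>{1..N}\<close> the
  prefix count at \<open>N\<close> is its size, so the condition at t = N is a size bound and merges
  with \<open>r\<close> or \<open>r - 1\<close> into a \<open>max\<close>.\<close>

lemma partial_poly_Suc:
  "partial_poly R (Suc N) r = (1 - X (Suc N)) * partial_poly R N (max r (prefix_card R N))
     + X (Suc N) * partial_poly R N (max (r - 1) (prefix_card R N))"
proof -
  have A: "{1..Suc N} = insert (Suc N) {1..N}" "finite {1..N}" "Suc N \<notin> {1..N}" by auto
  define g where "g M r T \<longleftrightarrow> (\<forall>t<M. prefix_card R t \<le> prefix_card T t) \<and> r \<le> card T" for M r T
  have pp: "partial_poly R M r = (\<Sum>T\<in>Pow {1..M}. of_bool (g M r T) * ml_weight {1..M} T)" for M r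
    by (simp add: partial_poly_def multilinear_ext_def g_def)
  have "partial_poly R (Suc N) r = (\<Sum>T\<in>Pow {1..N}. of_bool (g (Suc N) r T) * ml_weight (insert (Suc N) {1..N}) T
     + of_bool (g (Suc N) r (insert (Suc N) T)) * ml_weight (insert (Suc N) {1..N}) (insert (Suc N) T))"
    unfolding pp A(1) by (rule sum_Pow_insert[OF A(2,3)])
  also have "\<dots> = (\<Sum>T\<in>Pow {1..N}. (1 - X (Suc N)) * (of_bool (g N (max r (prefix_card R N)) T) * ml_weight {1..N} T)
     + X (Suc N) * (of_bool (g N (max (r - 1) (prefix_card R N)) T) * ml_weight {1..N} T))"
  proof (rule sum.cong[OF refl])
    fix T assume "T \<in> Pow {1..N}"
    then have T: "T \<subseteq> {1..N}" by simp
    have "finite T" "Suc N \<notin> T" using T finite_subset by auto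
    then have "g (Suc N) r T \<longleftrightarrow> g N (max r (prefix_card R N)) T"
      and "g (Suc N) r (insert (Suc N) T) \<longleftrightarrow> g N (max (r - 1) (prefix_card R N)) T"
      using prefix_card_eq_card[OF T]
      by (auto simp: g_def less_Suc_eq prefix_card_insert_Suc)
    then show "of_bool (g (Suc N) r T) * ml_weight (insert (Suc N) {1..N}) T
     + of_bool (g (Suc N) r (insert (Suc N) T)) * ml_weight (insert (Suc N) {1..N}) (insert (Suc N) T)
     = (1 - X (Suc N)) * (of_bool (g N (max r (prefix_card R N)) T) * ml_weight {1..N} T)
     + X (Suc N) * (of_bool (g N (max (r - 1) (prefix_card R N)) T) * ml_weight {1..N} T)"
      unfolding ml_weight_insert[OF A(2,3) T] by (simp only: ac_simps)
  qed
  also have "\<dots> = (1 - X (Suc N)) * partial_poly R N (max r (prefix_card R N))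
     + X (Suc N) * partial_poly R N (max (r - 1) (prefix_card R N))"
    unfolding pp sum.distrib sum_distrib_left[symmetric] ..
  finally show ?thesis .
qed

text \<open>Describes the monomials of \<open>partial_poly R N r\<close>. The last clause excludes
  loops: if \<open>r\<close> elements are already demanded before \<open>s\<close>, no choice of
  exactly \<open>r\<close> elements contains \<open>s\<close>.\<close>

definition admissible :: "nat set \<Rightarrow> nat \<Rightarrow> nat \<Rightarrow> nat set \<Rightarrow> bool" where
  "admissible R N r S \<longleftrightarrow> (\<forall>t\<le>N. prefix_card R t \<le> prefix_card S t) \<and> r \<le> card S
     \<and> (\<forall>s\<in>S. prefix_card R (s - 1) < r)"

lemma admissible_Suc:
  assumes "S \<subseteq> {1..N}" "prefix_card R (Suc N) \<le> r"
  shows "admissible R (Suc N) r S \<longleftrightarrow> admissible R N r S"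
proof -
  have "prefix_card S (Suc N) = card S" using assms(1) by (intro prefix_card_eq_card) auto
  then show ?thesis using assms(2) by (auto simp: admissible_def le_Suc_eq)
qed

text \<open>The recursion read on monomials: a new index that is no loop brings in the monomials of
  both smaller polynomials. The delicate case is a set \<open>S\<close> of size r - 1, where the
  loop condition must hold for r - 1 instead of \<open>r\<close>.\<close>

lemma admissible_insert_Suc:
  assumes S: "S \<subseteq> {1..N}" and r: "prefix_card R (Suc N) \<le> r"
  shows "admissible R (Suc N) r (insert (Suc N) S) \<longleftrightarrow>
    prefix_card R N < r \<and> (admissible R N (r - 1) S \<or> admissible R N r S)"
proof -
  have fin: "finite S" "Suc N \<notin> S" using S finite_subset by auto
  have cN: "prefix_card S N = card S" "prefix_card (insert (Suc N) S) (Suc N) = Suc (card S)"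
    using S fin by (auto simp: prefix_card_eq_card prefix_card_insert_Suc prefix_card_Suc)
  have mono: "prefix_card R (s - 1) \<le> prefix_card R N" if "s \<in> S" for s
  proof -
    have "s \<in> {1..N}" using that S by blast
    then show ?thesis by (intro prefix_card_mono) auto
  qed
  \<comment> \<open>If \<open>s\<close> violates the loop condition for r - 1, then \<open>S\<close>
    has r - 1 elements before \<open>s\<close>, and \<open>s\<close> itself is one more.\<close>
  have key: "r \<le> card S" if "\<forall>t\<le>N. prefix_card R t \<le> prefix_card S t" "s \<in> S" "r - 1 \<le> prefix_card R (s - 1)"
    "0 < r" for s
  proof -
    have "s \<in> {1..N}" using that S by blast
    then have s: "s - 1 \<le> N" "Suc (s - 1) = s" "s \<le> N" by auto
    have "r - 1 \<le> prefix_card S (s - 1)" using that s by (meson le_trans)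
    then have "r \<le> prefix_card S s" using prefix_card_Suc[of S "s - 1"] that s by simp
    also have "\<dots> \<le> card S" using prefix_card_mono[OF s(3), of S] cN by simp
    finally show ?thesis .
  qed
  show ?thesis
  proof (cases "prefix_card R N < r")
    case True
    then have rmono: "prefix_card R (s - 1) < r" if "s \<in> S" for s
      using mono[OF that] by simp
    have L: "admissible R (Suc N) r (insert (Suc N) S) \<longleftrightarrow>
      (\<forall>t\<le>N. prefix_card R t \<le> prefix_card S t) \<and> r \<le> Suc (card S)"
      using fin cN True r rmono
      by (auto simp: admissible_def le_Suc_eq prefix_card_insert_Suc)
    have R: "admissible R N r S \<longleftrightarrow> (\<forall>t\<le>N. prefix_card R t \<le> prefix_card S t) \<and> r \<le> card S"
      using rmono by (auto simp: admissible_def)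
    have "admissible R N (r - 1) S"
      if "\<forall>t\<le>N. prefix_card R t \<le> prefix_card S t" "r \<le> Suc (card S)" "\<not> r \<le> card S"
    proof -
      have "prefix_card R (s - 1) < r - 1" if "s \<in> S" for s
      proof (rule ccontr)
        assume "\<not> prefix_card R (s - 1) < r - 1"
        then have "r \<le> card S"
          using key[OF \<open>\<forall>t\<le>N. _\<close> that] True by simp
        with \<open>\<not> r \<le> card S\<close> show False by simp
      qed
      then show ?thesis using that by (simp add: admissible_def)
    qed
    then show ?thesis unfolding L R using True by (auto simp: admissible_def)
  next
    case False
    then show ?thesis by (auto simp: admissible_def)
  qed
qed

lemma monom_set_insert: "finite S \<Longrightarrow> k \<notin> S \<Longrightarrow> monom_set (insert k S) = X k * monom_set S"
  by (simp add: monom_set_def)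

text \<open>The sign depends only on \<open>card S + r\<close>. In the recursion
  \<open>X (Suc N)\<close> multiplies the difference of the polynomials for r - 1 and
  \<open>r\<close>; their signs at a given monomial are opposite, so absolute values add and nothing
  cancels.\<close>

lemma partial_poly_expansion:
  assumes "prefix_card R N \<le> r"
  shows "\<exists>e :: nat set \<Rightarrow> nat.
    partial_poly R N r = (\<Sum>S\<in>Pow {1..N}. of_int ((- 1) ^ (card S + r) * int (e S)) * monom_set S) \<and>
    (\<forall>S\<in>Pow {1..N}. 0 < e S \<longleftrightarrow> admissible R N r S)"
  using assms
proof (induction N arbitrary: r)
  case 0
  show ?case
    by (intro exI[of _ "\<lambda>_. of_bool (r = 0)"]) (cases "r = 0"; auto simp: partial_poly_0 admissible_def monom_set_def)
next
  case (Suc N)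
  have A: "{1..Suc N} = insert (Suc N) {1..N}" "finite {1..N}" "Suc N \<notin> {1..N}" by auto
  have le: "prefix_card R N \<le> r" using Suc.prems by (simp add: prefix_card_Suc split: if_splits)
  obtain e0 :: "nat set \<Rightarrow> nat" where e0:
    "partial_poly R N r = (\<Sum>S\<in>Pow {1..N}. of_int ((- 1) ^ (card S + r) * int (e0 S)) * monom_set S)"
    "\<forall>S\<in>Pow {1..N}. 0 < e0 S \<longleftrightarrow> admissible R N r S"
    using Suc.IH[OF le] by blast
  have fin: "finite S" "Suc N \<notin> S" if "S \<in> Pow {1..N}" for S using that finite_subset by auto
  show ?case
  proof (cases "prefix_card R N < r")
    \<comment> \<open>Here \<open>Suc N\<close> is a loop: both maxima in the recursion equal
      \<open>r\<close>, and the new variable drops out.\<close>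
    case False
    define e where "e S = (if Suc N \<in> S then 0 else e0 S)" for S
    from False le have r: "prefix_card R N = r" by simp
    have "partial_poly R (Suc N) r = partial_poly R N r"
      unfolding partial_poly_Suc r by (simp add: algebra_simps)
    also have "\<dots> = (\<Sum>S\<in>Pow {1..Suc N}. of_int ((- 1) ^ (card S + r) * int (e S)) * monom_set S)"
      unfolding e0(1) A(1) sum_Pow_insert[OF A(2,3)]
      by (rule sum.cong[OF refl]) (use fin in \<open>simp add: e_def\<close>)
    finally have 1: "partial_poly R (Suc N) r = (\<Sum>S\<in>Pow {1..Suc N}. of_int ((- 1) ^ (card S + r) * int (e S)) * monom_set S)" .
    have 2: "0 < e S \<longleftrightarrow> admissible R (Suc N) r S" if "S \<in> Pow {1..Suc N}" for S
    proof (cases "Suc N \<in> S")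
      case True
      then show ?thesis using r by (auto simp: e_def admissible_def dest!: bspec[of S _ "Suc N"])
    next
      case False
      then have "S \<subseteq> {1..N}" using that by (auto simp: le_Suc_eq)
      then show ?thesis using e0(2) False admissible_Suc Suc.prems by (simp add: e_def)
    qed
    show ?thesis using 1 2 by blast
  next
    case True
    then have "prefix_card R N \<le> r - 1" by simp
    from Suc.IH[OF this] obtain e1 :: "nat set \<Rightarrow> nat" where e1:
      "partial_poly R N (r - 1) = (\<Sum>S\<in>Pow {1..N}. of_int ((- 1) ^ (card S + (r - 1)) * int (e1 S)) * monom_set S)"
      "\<forall>S\<in>Pow {1..N}. 0 < e1 S \<longleftrightarrow> admissible R N (r - 1) S"
      by blast
    define e where "e S = (if Suc N \<in> S then e0 (S - {Suc N}) + e1 (S - {Suc N}) else e0 S)" for S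
    have max: "max r (prefix_card R N) = r" "max (r - 1) (prefix_card R N) = r - 1"
      using True by auto
    obtain r' where r': "r = Suc r'" using True by (cases r) auto
    have "partial_poly R (Suc N) r = partial_poly R N r
        + X (Suc N) * (partial_poly R N (r - 1) - partial_poly R N r)"
      unfolding partial_poly_Suc max by (simp add: algebra_simps)
    also have "\<dots> = (\<Sum>S\<in>Pow {1..Suc N}. of_int ((- 1) ^ (card S + r) * int (e S)) * monom_set S)"
      unfolding e0(1) e1(1) A(1) sum_Pow_insert[OF A(2,3)] sum_subtractf[symmetric] sum_distrib_left sum.distrib[symmetric]
    proof (rule sum.cong[OF refl])
      fix S assume S: "S \<in> Pow {1..N}"
      show "of_int ((- 1) ^ (card S + r) * int (e0 S)) * monom_set S
        + X (Suc N) * (of_int ((- 1) ^ (card S + (r - 1)) * int (e1 S)) * monom_set S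
           - of_int ((- 1) ^ (card S + r) * int (e0 S)) * monom_set S)
        = of_int ((- 1) ^ (card S + r) * int (e S)) * monom_set S
        + of_int ((- 1) ^ (card (insert (Suc N) S) + r) * int (e (insert (Suc N) S))) * monom_set (insert (Suc N) S)"
        using fin[OF S] by (simp add: e_def monom_set_insert r' algebra_simps)
    qed
    finally have 1: "partial_poly R (Suc N) r = (\<Sum>S\<in>Pow {1..Suc N}. of_int ((- 1) ^ (card S + r) * int (e S)) * monom_set S)" .
    have 2: "0 < e S \<longleftrightarrow> admissible R (Suc N) r S" if "S \<in> Pow {1..Suc N}" for S
    proof (cases "Suc N \<in> S")
      case True
      then have S: "S - {Suc N} \<subseteq> {1..N}" "insert (Suc N) (S - {Suc N}) = S" using that by (auto simp: le_Suc_eq)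
      then show ?thesis
        using admissible_insert_Suc[OF S(1) Suc.prems] e0(2) e1(2) \<open>prefix_card R N < r\<close> True by (auto simp: e_def)
    next
      case False
      then have "S \<subseteq> {1..N}" using that by (auto simp: le_Suc_eq)
      then show ?thesis using e0(2) False admissible_Suc Suc.prems by (simp add: e_def)
    qed
    show ?thesis using 1 2 by blast
  qed
qed

lemma prefix_card_beyond: "S \<subseteq> {1..n} \<Longrightarrow> n \<le> t \<Longrightarrow> prefix_card S t = card S"
  by (rule prefix_card_eq_card) auto

lemma dominates_iff:
  assumes "R \<subseteq> {1..n}" "T \<subseteq> {1..n}"
  shows "dominates T R \<longleftrightarrow> (\<forall>t<n. prefix_card R t \<le> prefix_card T t) \<and> card R \<le> card T"
proof
  assume "dominates T R"
  then have "prefix_card R t \<le> prefix_card T t" for t by (simp add: dominates_def)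
  from this this[of n] show "(\<forall>t<n. prefix_card R t \<le> prefix_card T t) \<and> card R \<le> card T"
    by (simp add: prefix_card_beyond[OF assms(1)] prefix_card_beyond[OF assms(2)])
next
  assume L: "(\<forall>t<n. prefix_card R t \<le> prefix_card T t) \<and> card R \<le> card T"
  show "dominates T R"
    unfolding dominates_def
  proof
    fix t show "prefix_card R t \<le> prefix_card T t"
      using L prefix_card_beyond[OF assms(1), of t] prefix_card_beyond[OF assms(2), of t]
      by (cases "t < n") auto
  qed
qed

lemma column_poly_eq_partial:
  assumes "R \<subseteq> {1..n}"
  shows "column_poly n R = partial_poly R n (card R)"
  unfolding column_poly_def partial_poly_def multilinear_ext_def
  by (rule sum.cong[OF refl]) (use dominates_iff[OF assms] in simp)

text \<open>For the full column the loops are the indices beyond the largest row: the prefix before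
  \<open>s\<close> misses some row exactly when \<open>s\<close> is at most that row.\<close>

lemma admissible_iff_spanning:
  assumes R: "R \<subseteq> {1..n}" and S: "S \<subseteq> {1..n}"
  shows "admissible R n (card R) S \<longleftrightarrow> S \<in> spanning R"
proof -
  let ?m = "Max (insert 0 R)"
  have fin: "finite R" using R finite_subset by blast
  have "prefix_card R (s - 1) < card R \<longleftrightarrow> s \<le> ?m" if "s \<in> S" for s
  proof
    assume "s \<le> ?m"
    have "1 \<le> s" using that S by auto
    with \<open>s \<le> ?m\<close> have "?m \<noteq> 0" by simp
    then have "?m \<in> R" using Max_in[of "insert 0 R"] fin by auto
    moreover have "?m \<notin> {1..s - 1}" using \<open>s \<le> ?m\<close> \<open>1 \<le> s\<close> by auto
    ultimately have "R \<inter> {1..s - 1} \<subset> R" by blast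
    then show "prefix_card R (s - 1) < card R" unfolding prefix_card_def by (rule psubset_card_mono[OF fin])
  next
    assume L: "prefix_card R (s - 1) < card R"
    show "s \<le> ?m"
    proof (rule ccontr)
      assume "\<not> s \<le> ?m"
      have "t \<in> {1..s - 1}" if "t \<in> R" for t
      proof -
        have "t \<le> ?m" "1 \<le> t" using that R fin by auto
        with \<open>\<not> s \<le> ?m\<close> show ?thesis by auto
      qed
      then have "R \<subseteq> {1..s - 1}" by blast
      then show False using L prefix_card_eq_card by simp
    qed
  qed
  then have "(\<forall>s\<in>S. prefix_card R (s - 1) < card R) \<longleftrightarrow> S \<subseteq> {1..?m}"
    using S by auto
  moreover have "(\<forall>t\<le>n. prefix_card R t \<le> prefix_card S t) \<and> card R \<le> card S \<longleftrightarrow> dominates S R"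
    unfolding dominates_iff[OF R S] le_less[of _ n]
    using prefix_card_eq_card[OF R] prefix_card_eq_card[OF S] by auto
  ultimately show ?thesis unfolding admissible_def spanning_def by blast
qed

lemma spanning_subset: "R \<subseteq> {1..n} \<Longrightarrow> S \<in> spanning R \<Longrightarrow> S \<subseteq> {1..n}"
proof -
  assume "R \<subseteq> {1..n}" "S \<in> spanning R"
  then have "S \<subseteq> {1..Max (insert 0 R)}" "Max (insert 0 R) \<le> n"
    by (auto simp: spanning_def finite_subset[of R "{1..n}"])
  then show "S \<subseteq> {1..n}" by (meson atLeastatMost_subset_iff order_refl order_trans)
qed

lemma column_poly_expansion:
  assumes R: "R \<subseteq> {1..n}"
  shows "\<exists>c. column_poly n R = (\<Sum>S\<in>spanning R. of_int (c S) * monom_set S) \<and> (\<forall>S\<in>spanning R. c S \<noteq> 0)"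
proof -
  have "prefix_card R n \<le> card R" using prefix_card_eq_card[OF R] by simp
  from partial_poly_expansion[OF this] obtain e :: "nat set \<Rightarrow> nat" where
    e: "partial_poly R n (card R) = (\<Sum>S\<in>Pow {1..n}. of_int ((- 1) ^ (card S + card R) * int (e S)) * monom_set S)"
      "\<forall>S\<in>Pow {1..n}. 0 < e S \<longleftrightarrow> admissible R n (card R) S" by blast
  have sub: "spanning R \<subseteq> Pow {1..n}" using spanning_subset[OF R] by blast
  have pos: "0 < e S \<longleftrightarrow> S \<in> spanning R" if "S \<in> Pow {1..n}" for S
    using e(2) that admissible_iff_spanning[OF R, of S] by blast
  have "column_poly n R = (\<Sum>S\<in>spanning R. of_int ((- 1) ^ (card S + card R) * int (e S)) * monom_set S)"
    unfolding column_poly_eq_partial[OF R] e(1)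
  proof (rule sum.mono_neutral_right[OF _ sub])
    show "\<forall>S\<in>Pow {1..n} - spanning R. of_int ((- 1) ^ (card S + card R) * int (e S)) * monom_set S = 0"
      using pos by (metis DiffD1 DiffD2 gr0I mult_eq_0_iff of_int_0 of_nat_0)
  qed simp
  moreover have "\<forall>S\<in>spanning R. (- 1) ^ (card S + card R) * int (e S) \<noteq> 0"
    using pos sub by (metis less_numeral_extra(3) mult_eq_0_iff of_nat_eq_0_iff power_eq_0_iff
        subsetD zero_neq_neg_one)
  ultimately show ?thesis
    by (intro exI[of _ "\<lambda>S. (- 1) ^ (card S + card R) * int (e S)"] conjI)
qed

section \<open>Support of a product of column polynomials\<close>

text \<open>For finite \<open>R\<close> this counts the coloops: \<open>{1..gap R}\<close> is the
  longest initial segment inside \<open>R\<close>, and every dominating set contains it. It is one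
  less than the first missing positive index.\<close>

definition gap :: "nat set \<Rightarrow> nat" where
  "gap R = (LEAST i. Suc i \<notin> R)"

definition top_elem :: "nat set \<Rightarrow> nat" where
  "top_elem R = Max (insert 0 R)"

lemma Suc_gap_notin: "finite R \<Longrightarrow> Suc (gap R) \<notin> R"
proof -
  assume "finite R"
  have "\<exists>i. Suc i \<notin> R"
  proof (rule ccontr)
    assume "\<nexists>i. Suc i \<notin> R"
    then have "range Suc \<subseteq> R" by auto
    then have "finite (range Suc)" using \<open>finite R\<close> finite_subset by blast
    then show False using finite_imageD inj_Suc infinite_UNIV_nat by blast
  qed
  then show ?thesis unfolding gap_def by (rule LeastI_ex)
qed

lemma interval_gap_subset: "{1..gap R} \<subseteq> R"
proof
  fix i assume "i \<in> {1..gap R}"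
  then have "i - 1 < (LEAST i. Suc i \<notin> R)" "Suc (i - 1) = i" by (auto simp: gap_def)
  then show "i \<in> R" using not_less_Least by metis
qed

lemma le_top_elem: "finite R \<Longrightarrow> i \<in> R \<Longrightarrow> i \<le> top_elem R"
  by (simp add: top_elem_def)

lemma top_elem_le: "R \<subseteq> {1..n} \<Longrightarrow> top_elem R \<le> n"
  using finite_subset[of R "{1..n}"] by (auto simp: top_elem_def)

lemma top_elem_in: "finite R \<Longrightarrow> 0 < top_elem R \<Longrightarrow> top_elem R \<in> R"
  using Max_in[of "insert 0 R"] by (auto simp: top_elem_def)

lemma gap_le_top_elem: "finite R \<Longrightarrow> gap R \<le> top_elem R"
proof (cases "gap R = 0")
  case False
  then have "gap R \<in> {1..gap R}" by simp
  then have "gap R \<in> R" using interval_gap_subset by blast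
  moreover assume "finite R"
  ultimately show ?thesis by (rule le_top_elem[rotated])
qed simp

lemma prefix_card_above:
  assumes "{1..g} \<subseteq> S" "g \<le> t"
  shows "prefix_card S t = g + card (S \<inter> {g<..t})"
proof -
  have "S \<inter> {1..t} = {1..g} \<union> (S \<inter> {g<..t})" using assms by auto
  then show ?thesis
    by (simp add: prefix_card_def card_Un_disjoint Int_def disjoint_iff)
qed

text \<open>Domination at \<open>gap R\<close> forces the whole initial segment. With it removed
  both counts restart at 0, and past the largest row the count of \<open>R\<close> no longer
  grows.\<close>

lemma spanning_iff:
  assumes R: "finite R" "0 \<notin> R"
  shows "S \<in> spanning R \<longleftrightarrow> {1..gap R} \<subseteq> S \<and> S \<subseteq> {1..top_elem R} \<and>
    (\<forall>t\<in>{gap R<..top_elem R}. card (R \<inter> {gap R<..t}) \<le> card (S \<inter> {gap R<..t}))"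
    (is "?L \<longleftrightarrow> ?A \<and> ?B \<and> ?C")
proof
  assume L: ?L
  then have S: ?B "dominates S R" by (auto simp: spanning_def top_elem_def)
  have "prefix_card R (gap R) = gap R"
    using interval_gap_subset[of R] by (simp add: prefix_card_def Int_absorb1)
  then have "gap R \<le> card (S \<inter> {1..gap R})"
    using S(2) unfolding dominates_def prefix_card_def by metis
  then have "S \<inter> {1..gap R} = {1..gap R}" by (intro card_seteq) auto
  then have A: ?A by blast
  have "card (R \<inter> {gap R<..t}) \<le> card (S \<inter> {gap R<..t})" if "t \<in> {gap R<..top_elem R}" for t
    using S(2) prefix_card_above[OF A, of t] prefix_card_above[OF interval_gap_subset, of R t] that
    unfolding dominates_def by (metis add_le_cancel_left greaterThanAtMost_iff less_imp_le)
  then show "?A \<and> ?B \<and> ?C" using A S by blast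
next
  assume R': "?A \<and> ?B \<and> ?C"
  have le: "prefix_card R t \<le> prefix_card S t" if "t \<le> top_elem R" for t
  proof (cases "t \<le> gap R")
    case True
    then have "R \<inter> {1..t} \<subseteq> S \<inter> {1..t}" using R' by auto
    then show ?thesis unfolding prefix_card_def by (intro card_mono) auto
  next
    case False
    then show ?thesis
      using prefix_card_above[of "gap R" S t] prefix_card_above[OF interval_gap_subset, of R t] R' that by simp
  qed
  have "prefix_card R t \<le> prefix_card S t" for t
  proof (cases "t \<le> top_elem R")
    case False
    have "R \<subseteq> {1..top_elem R}" using R le_top_elem[OF R(1)] by (auto simp: Suc_le_eq intro: gr0I)
    then have "prefix_card R t = prefix_card R (top_elem R)"
      using False by (simp add: prefix_card_beyond)
    also have "\<dots> \<le> prefix_card S (top_elem R)" by (rule le) simp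
    also have "\<dots> \<le> prefix_card S t" using False by (intro prefix_card_mono) simp
    finally show ?thesis .
  qed (rule le)
  then show ?L using R' by (simp add: spanning_def dominates_def top_elem_def)
qed

definition indicator_vec :: "nat set \<Rightarrow> nat \<Rightarrow>\<^sub>0 nat" where
  "indicator_vec S = (\<Sum>k\<in>S. Poly_Mapping.single k 1)"

lemma lookup_indicator_vec: "finite S \<Longrightarrow> Poly_Mapping.lookup (indicator_vec S) i = of_bool (i \<in> S)"
  by (simp add: indicator_vec_def lookup_sum lookup_single when_def)

lemma prod_single: "(\<Prod>k\<in>S. Poly_Mapping.single (\<alpha> k) (c k)) = Poly_Mapping.single (\<Sum>k\<in>S. \<alpha> k) (\<Prod>k\<in>S. c k)"
  for \<alpha> :: "'b \<Rightarrow> 'a::comm_monoid_add" and c :: "'b \<Rightarrow> int"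
proof (induction S rule: infinite_finite_induct)
  case (insert k S)
  then show ?case by (simp add: mult_single)
qed simp_all

lemma monom_set_eq: "monom_set S = Poly_Mapping.single (indicator_vec S) 1"
  unfolding monom_set_def X_def prod_single indicator_vec_def by simp

lemma keys_sum_single:
  assumes "finite A" "inj_on m A" "\<And>a. a \<in> A \<Longrightarrow> c a \<noteq> 0"
  shows "Poly_Mapping.keys (\<Sum>a\<in>A. Poly_Mapping.single (m a) (c a)) = m ` A"
proof -
  have l: "Poly_Mapping.lookup (\<Sum>a\<in>A. Poly_Mapping.single (m a) (c a)) \<beta>
      = (\<Sum>a\<in>A. if m a = \<beta> then c a else 0)" for \<beta>
    by (simp add: lookup_sum lookup_single when_def)
  have 1: "Poly_Mapping.lookup (\<Sum>a\<in>A. Poly_Mapping.single (m a) (c a)) (m a) = c a" if "a \<in> A" for a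
  proof -
    have "(\<Sum>a'\<in>A. if m a' = m a then c a' else 0) = (\<Sum>a'\<in>A. if a' = a then c a' else 0)"
      by (rule sum.cong[OF refl]) (use assms(2) that in \<open>auto simp: inj_on_def\<close>)
    then show ?thesis using l that assms(1) by simp
  qed
  have 2: "Poly_Mapping.lookup (\<Sum>a\<in>A. Poly_Mapping.single (m a) (c a)) \<beta> = 0" if "\<beta> \<notin> m ` A" for \<beta>
    unfolding l using that by (intro sum.neutral) auto
  show ?thesis
    using 1 2 assms(3) by (auto simp: in_keys_iff)
qed

text \<open>Each index lies in the free range \<open>{gap<..top_elem}\<close> of at most one column, so a monomial of
  the product determines its factors.\<close>

locale disjoint_columns =
  fixes n :: nat and R :: "nat \<Rightarrow> nat set"
  assumes R_subset: "q \<in> {1..n} \<Longrightarrow> R q \<subseteq> {1..n}"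
    and disjoint: "q \<in> {1..n} \<Longrightarrow> q' \<in> {1..n} \<Longrightarrow> q \<noteq> q' \<Longrightarrow>
      {gap (R q)<..top_elem (R q)} \<inter> {gap (R q')<..top_elem (R q')} = {}"
begin

lemma R_finite: "q \<in> {1..n} \<Longrightarrow> finite (R q)" and R_0: "q \<in> {1..n} \<Longrightarrow> 0 \<notin> R q"
  using R_subset[of q] finite_subset[of "R q" "{1..n}"] by auto

definition factor_vec :: "(nat \<Rightarrow> nat set) \<Rightarrow> nat \<Rightarrow>\<^sub>0 nat" where
  "factor_vec f = (\<Sum>q\<in>{1..n}. indicator_vec (f q))"

definition factors :: "(nat \<Rightarrow> nat set) set" where
  "factors = PiE {1..n} (\<lambda>q. spanning (R q))"

text \<open>The number of columns having \<open>i\<close> as a coloop, hence the part of the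
  exponent of \<open>x_i\<close> that every monomial must have.\<close>

definition lower :: "nat \<Rightarrow> nat" where
  "lower i = (\<Sum>q\<in>{1..n}. of_bool (i \<in> {1..gap (R q)}))"

definition upper :: "nat \<Rightarrow> nat" where
  "upper i = lower i + (\<Sum>q\<in>{1..n}. of_bool (i \<in> {gap (R q)<..top_elem (R q)}))"

lemma spanning_iff': "q \<in> {1..n} \<Longrightarrow> S \<in> spanning (R q) \<longleftrightarrow> {1..gap (R q)} \<subseteq> S \<and> S \<subseteq> {1..top_elem (R q)} \<and>
    (\<forall>t\<in>{gap (R q)<..top_elem (R q)}. card (R q \<inter> {gap (R q)<..t}) \<le> card (S \<inter> {gap (R q)<..t}))"
  by (rule spanning_iff[OF R_finite R_0])

lemma factorsD: "f \<in> factors \<Longrightarrow> q \<in> {1..n} \<Longrightarrow> f q \<in> spanning (R q)"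
  by (auto simp: factors_def)

lemma factor_finite: "f \<in> factors \<Longrightarrow> q \<in> {1..n} \<Longrightarrow> finite (f q)"
  using factorsD[of f q] spanning_iff'[of q] finite_subset by (meson finite_atLeastAtMost)

lemma lookup_factor_vec:
  "(\<And>q. q \<in> {1..n} \<Longrightarrow> finite (f q)) \<Longrightarrow>
    Poly_Mapping.lookup (factor_vec f) i = (\<Sum>q\<in>{1..n}. of_bool (i \<in> f q))"
  unfolding factor_vec_def lookup_sum by (rule sum.cong[OF refl]) (simp add: lookup_indicator_vec)

text \<open>At an index in the range of \<open>q\<close>, membership is forced in every other
  factor, so the exponent there reveals membership in \<open>f q\<close>.\<close>

lemma inj_on_factor_vec: "inj_on factor_vec factors"
proof (rule inj_onI)
  fix f f' assume f: "f \<in> factors" and f': "f' \<in> factors" and eq: "factor_vec f = factor_vec f'"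
  have "f q = f' q" if q: "q \<in> {1..n}" for q
  proof (rule set_eqI)
    fix i
    show "i \<in> f q \<longleftrightarrow> i \<in> f' q"
    proof (cases "i \<in> {gap (R q)<..top_elem (R q)}")
      case False
      then have "i \<in> f q \<longleftrightarrow> i \<in> {1..gap (R q)}" "i \<in> f' q \<longleftrightarrow> i \<in> {1..gap (R q)}"
        using factorsD[OF f q] factorsD[OF f' q] gap_le_top_elem[OF R_finite[OF q]] unfolding spanning_iff'[OF q] by auto
      then show ?thesis by simp
    next
      case True
      have other: "of_bool (i \<in> f q') = (of_bool (i \<in> f' q') :: nat)" if q': "q' \<in> {1..n} - {q}" for q'
      proof -
        have "i \<notin> {gap (R q')<..top_elem (R q')}" using disjoint[of q q'] q' q True by blast
        then have "i \<in> f q' \<longleftrightarrow> i \<in> {1..gap (R q')}" "i \<in> f' q' \<longleftrightarrow> i \<in> {1..gap (R q')}"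
          using factorsD[OF f, of q'] factorsD[OF f', of q'] q' gap_le_top_elem[OF R_finite, of q']
            spanning_iff'[of q'] by auto
        then show ?thesis by simp
      qed
      have "(\<Sum>q\<in>{1..n}. of_bool (i \<in> f q) :: nat) = (\<Sum>q\<in>{1..n}. of_bool (i \<in> f' q))"
        using eq lookup_factor_vec[of f i] lookup_factor_vec[of f' i] factor_finite[OF f] factor_finite[OF f'] by simp
      moreover have "(\<Sum>q'\<in>{1..n} - {q}. of_bool (i \<in> f q') :: nat) = (\<Sum>q'\<in>{1..n} - {q}. of_bool (i \<in> f' q'))"
        by (rule sum.cong[OF refl other])
      ultimately have "of_bool (i \<in> f q) = (of_bool (i \<in> f' q) :: nat)"
        unfolding sum.remove[OF finite_atLeastAtMost q] by (simp only: add_right_cancel)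
      then show ?thesis by (simp only: of_bool_eq_iff)
    qed
  qed
  then show "f = f'" using f f' unfolding factors_def by (intro PiE_ext[of f]) auto
qed

lemma finite_factors: "finite factors"
  unfolding factors_def
proof (rule finite_PiE)
  fix q assume "q \<in> {1..n}"
  then have "spanning (R q) \<subseteq> Pow {1..n}" using spanning_subset R_subset by blast
  then show "finite (spanning (R q))" by (rule finite_subset) simp
qed simp

text \<open>The expanded product has one term per choice of spanning sets. By injectivity no two
  terms share an exponent, and each coefficient is a product of nonzero integers.\<close>

lemma keys_prod_column_poly:
  "Poly_Mapping.keys (\<Prod>q\<in>{1..n}. column_poly n (R q)) = factor_vec ` factors"
proof -
  have "\<forall>q\<in>{1..n}. \<exists>c. column_poly n (R q) = (\<Sum>S\<in>spanning (R q). of_int (c S) * monom_set S)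
    \<and> (\<forall>S\<in>spanning (R q). c S \<noteq> 0)"
    using column_poly_expansion R_subset by blast
  then obtain c where c: "\<And>q. q \<in> {1..n} \<Longrightarrow> column_poly n (R q) = (\<Sum>S\<in>spanning (R q). of_int (c q S) * monom_set S)"
    "\<And>q S. q \<in> {1..n} \<Longrightarrow> S \<in> spanning (R q) \<Longrightarrow> c q S \<noteq> 0"
    by metis
  have single: "of_int a * monom_set S = Poly_Mapping.single (indicator_vec S) a" for a S
    by (simp add: monom_set_eq of_int_mpoly mult_single)
  have fin: "finite (spanning (R q))" if "q \<in> {1..n}" for q
    using that spanning_subset[OF R_subset] finite_subset[of "spanning (R q)" "Pow {1..n}"] by blast
  have "(\<Prod>q\<in>{1..n}. column_poly n (R q))
      = (\<Prod>q\<in>{1..n}. \<Sum>S\<in>spanning (R q). Poly_Mapping.single (indicator_vec S) (c q S))"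
    by (rule prod.cong[OF refl]) (simp add: c(1) single)
  also have "\<dots> = (\<Sum>f\<in>factors. \<Prod>q\<in>{1..n}. Poly_Mapping.single (indicator_vec (f q)) (c q (f q)))"
    unfolding factors_def by (rule prod_sum_PiE) (use fin in auto)
  also have "\<dots> = (\<Sum>f\<in>factors. Poly_Mapping.single (factor_vec f) (\<Prod>q\<in>{1..n}. c q (f q)))"
    unfolding prod_single factor_vec_def ..
  finally have "Poly_Mapping.keys (\<Prod>q\<in>{1..n}. column_poly n (R q)) = Poly_Mapping.keys \<dots>" by simp
  also have "\<dots> = factor_vec ` factors"
    by (rule keys_sum_single[OF finite_factors inj_on_factor_vec]) (use c(2) factorsD in \<open>auto simp: prod_zero_iff\<close>)
  finally show ?thesis .
qed

lemma upper_eq: "(\<Sum>q\<in>{1..n}. of_bool (i \<in> {1..top_elem (R q)})) = upper i"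
  if "1 \<le> i"
  unfolding upper_def lower_def sum.distrib[symmetric]
proof (rule sum.cong[OF refl])
  fix q assume "q \<in> {1..n}"
  then show "of_bool (i \<in> {1..top_elem (R q)})
    = of_bool (i \<in> {1..gap (R q)}) + (of_bool (i \<in> {gap (R q)<..top_elem (R q)}) :: nat)"
    using gap_le_top_elem[OF R_finite, of q] that by auto
qed

lemma upper_on_range:
  assumes q: "q \<in> {1..n}" and i: "i \<in> {gap (R q)<..top_elem (R q)}"
  shows "upper i = lower i + 1"
proof -
  have "(\<Sum>q'\<in>{1..n} - {q}. of_bool (i \<in> {gap (R q')<..top_elem (R q')})) = (0 :: nat)"
  proof (rule sum.neutral, rule ballI)
    fix q' assume "q' \<in> {1..n} - {q}"
    then have "i \<notin> {gap (R q')<..top_elem (R q')}" using disjoint[of q q'] q i by blast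
    then show "of_bool (i \<in> {gap (R q')<..top_elem (R q')}) = (0 :: nat)" by simp
  qed
  then show ?thesis
    unfolding upper_def sum.remove[OF finite_atLeastAtMost q] using i by simp
qed

text \<open>The factors can be read off from \<alpha>: on the range of \<open>q\<close> the exponent
  exceeds \<open>lower\<close> by 0 or 1, and this excess is the indicator of the free part of the
  factor. The prefix conditions of the column thereby become interval sums of \<alpha>.\<close>

theorem factor_vec_factors_iff:
  "\<alpha> \<in> factor_vec ` factors \<longleftrightarrow>
    Poly_Mapping.keys \<alpha> \<subseteq> {1..n} \<and>
    (\<forall>i\<in>{1..n}. lower i \<le> Poly_Mapping.lookup \<alpha> i \<and> Poly_Mapping.lookup \<alpha> i \<le> upper i) \<and>
    (\<forall>q\<in>{1..n}. \<forall>t\<in>{gap (R q)<..top_elem (R q)}.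
      (\<Sum>i\<in>{gap (R q)<..t}. lower i) + card (R q \<inter> {gap (R q)<..t})
        \<le> (\<Sum>i\<in>{gap (R q)<..t}. Poly_Mapping.lookup \<alpha> i))"
  (is "?L \<longleftrightarrow> ?A \<and> ?B \<and> ?C")
proof
  assume ?L
  then obtain f where f: "f \<in> factors" and \<alpha>: "\<alpha> = factor_vec f" by blast
  have l: "Poly_Mapping.lookup \<alpha> i = (\<Sum>q\<in>{1..n}. of_bool (i \<in> f q))" for i
    unfolding \<alpha> by (rule lookup_factor_vec[OF factor_finite[OF f]])
  have sub: "{1..gap (R q)} \<subseteq> f q" "f q \<subseteq> {1..top_elem (R q)}" if "q \<in> {1..n}" for q
    using factorsD[OF f that] spanning_iff'[OF that] by auto
  have A: ?A
  proof
    fix i assume "i \<in> Poly_Mapping.keys \<alpha>"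
    then have "(\<Sum>q\<in>{1..n}. of_bool (i \<in> f q)) \<noteq> (0 :: nat)" by (simp add: in_keys_iff l)
    then obtain q where q: "q \<in> {1..n}" "i \<in> f q" by (metis (mono_tags, lifting) of_bool_eq_0_iff sum.neutral)
    then have "i \<in> {1..top_elem (R q)}" using sub by blast
    moreover have "top_elem (R q) \<le> n" by (rule top_elem_le[OF R_subset[OF q(1)]])
    ultimately show "i \<in> {1..n}" by auto
  qed
  have B: ?B
  proof (intro ballI conjI)
    fix i assume i: "i \<in> {1..n}"
    show "lower i \<le> Poly_Mapping.lookup \<alpha> i"
      unfolding l lower_def
    proof (rule sum_mono)
      fix q assume "q \<in> {1..n}"
      then have "i \<in> {1..gap (R q)} \<Longrightarrow> i \<in> f q" using sub by blast
      then show "of_bool (i \<in> {1..gap (R q)}) \<le> (of_bool (i \<in> f q) :: nat)" by (cases "i \<in> {1..gap (R q)}") auto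
    qed
    have "Poly_Mapping.lookup \<alpha> i \<le> (\<Sum>q\<in>{1..n}. of_bool (i \<in> {1..top_elem (R q)}))"
      unfolding l
    proof (rule sum_mono)
      fix q assume "q \<in> {1..n}"
      then have "i \<in> f q \<Longrightarrow> i \<in> {1..top_elem (R q)}" using sub by blast
      then show "of_bool (i \<in> f q) \<le> (of_bool (i \<in> {1..top_elem (R q)}) :: nat)" by (cases "i \<in> f q") auto
    qed
    then show "Poly_Mapping.lookup \<alpha> i \<le> upper i" using i upper_eq[of i] by simp
  qed
  have C: ?C
  proof (intro ballI)
    fix q t assume q: "q \<in> {1..n}" and t: "t \<in> {gap (R q)<..top_elem (R q)}"
    let ?I = "{gap (R q)<..t}"
    have count: "(\<Sum>i\<in>?I. of_bool (i \<in> S)) = card (S \<inter> ?I)" for S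
      by (simp add: Int_commute of_bool_def sum.inter_filter[symmetric] Int_def conj_commute)
    \<comment> \<open>Column \<open>q\<close> itself contributes nothing, because its coloops
      precede its range.\<close>
    have 1: "(\<Sum>i\<in>?I. lower i) = (\<Sum>q'\<in>{1..n} - {q}. card ({1..gap (R q')} \<inter> ?I))"
    proof -
      have "(\<Sum>i\<in>?I. lower i) = (\<Sum>q'\<in>{1..n}. card ({1..gap (R q')} \<inter> ?I))"
        unfolding lower_def by (subst sum.swap) (simp only: count)
      also have "\<dots> = (\<Sum>q'\<in>{1..n} - {q}. card ({1..gap (R q')} \<inter> ?I))"
        unfolding sum.remove[OF finite_atLeastAtMost q] by (simp add: disjoint_iff)
      finally show ?thesis .
    qed
    have 2: "(\<Sum>i\<in>?I. Poly_Mapping.lookup \<alpha> i) = card (f q \<inter> ?I) + (\<Sum>q'\<in>{1..n} - {q}. card (f q' \<inter> ?I))"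
      unfolding l by (subst sum.swap) (simp only: count sum.remove[OF finite_atLeastAtMost q])
    have 3: "card ({1..gap (R q')} \<inter> ?I) \<le> card (f q' \<inter> ?I)" if "q' \<in> {1..n} - {q}" for q'
      using sub(1)[of q'] that by (intro card_mono) auto
    have 4: "card (R q \<inter> ?I) \<le> card (f q \<inter> ?I)"
      using factorsD[OF f q] spanning_iff'[OF q] t by blast
    show "(\<Sum>i\<in>?I. lower i) + card (R q \<inter> ?I) \<le> (\<Sum>i\<in>?I. Poly_Mapping.lookup \<alpha> i)"
    proof -
      have "(\<Sum>q'\<in>{1..n} - {q}. card ({1..gap (R q')} \<inter> ?I)) \<le> (\<Sum>q'\<in>{1..n} - {q}. card (f q' \<inter> ?I))"
        by (rule sum_mono[OF 3])
      then show ?thesis unfolding 1 2 using 4 by linarith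
    qed
  qed
  show "?A \<and> ?B \<and> ?C" using A B C by blast
next
  assume ABC: "?A \<and> ?B \<and> ?C"
  \<comment> \<open>The value \<open>undefined\<close> outside \<open>{1..n}\<close> makes
    \<open>f\<close> extensional, as \<open>PiE\<close> demands.\<close>
  define f where "f q = (if q \<in> {1..n} then {1..gap (R q)} \<union>
    {i \<in> {gap (R q)<..top_elem (R q)}. lower i < Poly_Mapping.lookup \<alpha> i} else undefined)" for q
  have fin: "finite (f q)" if "q \<in> {1..n}" for q using that by (simp add: f_def)
  have bounds: "lower i \<le> Poly_Mapping.lookup \<alpha> i" "Poly_Mapping.lookup \<alpha> i \<le> upper i" if "i \<in> {1..n}" for i
    using ABC that by auto
  have range: "i \<in> {1..n}" if "q \<in> {1..n}" "i \<in> {gap (R q)<..top_elem (R q)}" for q i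
    using top_elem_le[OF R_subset[OF that(1)]] that(2) by auto
  have excess: "Poly_Mapping.lookup \<alpha> i = lower i + of_bool (lower i < Poly_Mapping.lookup \<alpha> i)"
    if "q \<in> {1..n}" "i \<in> {gap (R q)<..top_elem (R q)}" for q i
    using bounds[OF range[OF that]] upper_on_range[OF that] by auto
  have f: "f \<in> factors"
    unfolding factors_def
  proof (rule PiE_I)
    fix q assume q: "q \<in> {1..n}"
    have "card (R q \<inter> {gap (R q)<..t}) \<le> card (f q \<inter> {gap (R q)<..t})" if t: "t \<in> {gap (R q)<..top_elem (R q)}" for t
    proof -
      let ?I = "{gap (R q)<..t}"
      have "(\<Sum>i\<in>?I. Poly_Mapping.lookup \<alpha> i) = (\<Sum>i\<in>?I. lower i + of_bool (i \<in> f q))"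
      proof (rule sum.cong[OF refl])
        fix i assume i: "i \<in> ?I"
        then have "i \<in> {gap (R q)<..top_elem (R q)}" using t by auto
        then show "Poly_Mapping.lookup \<alpha> i = lower i + of_bool (i \<in> f q)"
          using excess[OF q] q i by (auto simp: f_def)
      qed
      also have "\<dots> = (\<Sum>i\<in>?I. lower i) + card (f q \<inter> ?I)"
        unfolding sum.distrib by (simp add: Int_commute of_bool_def sum.inter_filter[symmetric] Int_def conj_commute)
      finally show ?thesis using ABC q t by fastforce
    qed
    moreover have "f q \<subseteq> {1..top_elem (R q)}"
      using q gap_le_top_elem[OF R_finite[OF q]] by (auto simp: f_def)
    ultimately show "f q \<in> spanning (R q)"
      unfolding spanning_iff'[OF q] using q by (simp add: f_def)
  next
    fix q assume "q \<notin> {1..n}"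
    then show "f q = undefined" unfolding f_def by (rule if_not_P)
  qed
  have "Poly_Mapping.lookup \<alpha> i = Poly_Mapping.lookup (factor_vec f) i" for i
  proof (cases "i \<in> {1..n}")
    case True
    have "(\<Sum>q\<in>{1..n}. of_bool (i \<in> f q)) = (\<Sum>q\<in>{1..n}. of_bool (i \<in> {1..gap (R q)})
        + (of_bool (i \<in> {gap (R q)<..top_elem (R q)} \<and> lower i < Poly_Mapping.lookup \<alpha> i) :: nat))"
      by (rule sum.cong[OF refl]) (auto simp: f_def)
    also have "\<dots> = lower i + (\<Sum>q\<in>{1..n}. of_bool (i \<in> {gap (R q)<..top_elem (R q)} \<and> lower i < Poly_Mapping.lookup \<alpha> i))"
      unfolding sum.distrib lower_def ..
    also have "\<dots> = Poly_Mapping.lookup \<alpha> i"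
    proof (cases "lower i < Poly_Mapping.lookup \<alpha> i")
      case less: True
      have "upper i \<le> lower i + 1"
      proof (cases "\<exists>q\<in>{1..n}. i \<in> {gap (R q)<..top_elem (R q)}")
        case False
        then have "(\<Sum>q\<in>{1..n}. of_bool (i \<in> {gap (R q)<..top_elem (R q)})) = (0 :: nat)"
          by (intro sum.neutral) simp
        then show ?thesis unfolding upper_def by simp
      qed (use upper_on_range in auto)
      then have "Poly_Mapping.lookup \<alpha> i = upper i" using bounds[OF True] less by simp
      then show ?thesis using less unfolding upper_def by simp
    next
      case False
      then show ?thesis using bounds[OF True] by simp
    qed
    finally show ?thesis using lookup_factor_vec[of f i] fin by simp
  next
    case False
    then have "i \<notin> f q" if "q \<in> {1..n}" for q
      using that top_elem_le[OF R_subset[OF that]] gap_le_top_elem[OF R_finite[OF that]] by (auto simp: f_def)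
    moreover have "Poly_Mapping.lookup \<alpha> i = 0" using ABC False by (auto simp: in_keys_iff)
    ultimately show ?thesis using lookup_factor_vec[of f i] fin by simp
  qed
  then have "\<alpha> = factor_vec f" by (intro poly_mapping_eqI)
  then show ?L using f by blast
qed

end

section \<open>Integrality of difference constraints\<close>

lemma lookup_scaleR [simp]: "Poly_Mapping.lookup (r *\<^sub>R x) i = r * Poly_Mapping.lookup x i"
  for x :: "'a \<Rightarrow>\<^sub>0 real"
proof -
  have "finite {i. r *\<^sub>R Poly_Mapping.lookup x i \<noteq> 0}"
    by (rule finite_subset[OF _ finite_keys[of x]]) (auto simp: in_keys_iff)
  then show ?thesis by (simp add: scaleR_poly_mapping_def)
qed

definition partial_sum :: "(nat \<Rightarrow>\<^sub>0 real) \<Rightarrow> nat \<Rightarrow> real" where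
  "partial_sum x t = (\<Sum>i\<in>{1..t}. Poly_Mapping.lookup x i)"

lemma partial_sum_0 [simp]: "partial_sum x 0 = 0"
  by (simp add: partial_sum_def)

lemma partial_sum_Suc: "partial_sum x (Suc t) = partial_sum x t + Poly_Mapping.lookup x (Suc t)"
  by (simp add: partial_sum_def)

lemma partial_sum_add: "partial_sum (x + y) t = partial_sum x t + partial_sum y t"
  by (simp add: partial_sum_def lookup_add sum.distrib)

lemma partial_sum_scaleR: "partial_sum (r *\<^sub>R x) t = r * partial_sum x t"
  by (simp add: partial_sum_def sum_distrib_left)

lemma partial_sum_diff: "s \<le> t \<Longrightarrow> partial_sum x t - partial_sum x s = (\<Sum>i\<in>{s<..t}. Poly_Mapping.lookup x i)"
proof -
  assume "s \<le> t"
  then have "{1..t} = {1..s} \<union> {s<..t}" "{1..s} \<inter> {s<..t} = {}" by auto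
  then show ?thesis by (simp add: partial_sum_def sum.union_disjoint del: One_nat_def)
qed

lemma real_space_iff: "x \<in> real_space n \<longleftrightarrow> (\<forall>i. i \<notin> {1..n} \<longrightarrow> Poly_Mapping.lookup x i = 0)"
  unfolding real_space_def by (auto simp: in_keys_iff subset_iff)

lemma real_space_add_scaleR:
  "x \<in> real_space n \<Longrightarrow> y \<in> real_space n \<Longrightarrow> x + r *\<^sub>R y \<in> real_space n"
  by (simp add: real_space_iff lookup_add)

lemma partial_sum_beyond:
  assumes "x \<in> real_space n" "n \<le> t"
  shows "partial_sum x t = partial_sum x n"
  unfolding partial_sum_def
  by (rule sum.mono_neutral_right) (use assms in \<open>auto simp: real_space_def in_keys_iff\<close>)

text \<open>The coordinates are differences of consecutive indicator values; constancy of
  \<open>D\<close> from \<open>n\<close> on lets them vanish beyond \<open>n\<close>.\<close>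

lemma exists_indicator_partial_sum:
  assumes "0 \<notin> D" "\<And>t. n \<le> t \<Longrightarrow> t \<in> D \<longleftrightarrow> n \<in> D"
  obtains d where "d \<in> real_space n" "\<And>t. partial_sum d t = of_bool (t \<in> D)"
proof -
  define h :: "nat \<Rightarrow> real" where "h i = (if i \<in> {1..n} then of_bool (i \<in> D) - of_bool (i - 1 \<in> D) else 0)" for i
  define d where "d = Abs_poly_mapping h"
  have "finite {i. h i \<noteq> 0}" by (rule finite_subset[of _ "{1..n}"]) (auto simp: h_def)
  then have l: "Poly_Mapping.lookup d i = h i" for i by (simp add: d_def)
  have "partial_sum d t = of_bool (t \<in> D)" for t
  proof (induction t)
    case (Suc t)
    show ?case
    proof (cases "Suc t \<le> n")
      case False
      then have "Suc t \<in> D \<longleftrightarrow> t \<in> D" using assms(2)[of t] assms(2)[of "Suc t"] by simp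
      then show ?thesis using Suc False by (simp add: partial_sum_Suc l h_def)
    qed (use Suc in \<open>simp add: partial_sum_Suc l h_def\<close>)
  qed (use assms in simp)
  moreover have "d \<in> real_space n"
    by (auto simp: real_space_def in_keys_iff l h_def split: if_splits)
  ultimately show thesis using that by blast
qed

text \<open>A fractional point of a system of difference constraints \<open>k \<le> X\<^sub>t - X\<^sub>s\<close> with integral
  bounds may be shifted in both directions simultaneously at all indices with fractional \<open>X\<^sub>t\<close>,
  until one of these values becomes integral.\<close>

lemma difference_constraints_integral:
  fixes C :: "(nat \<times> nat \<times> int) set"
  assumes "x \<in> real_space n" "\<forall>(s, t, k)\<in>C. of_int k \<le> partial_sum x t - partial_sum x s"
  shows "x \<in> convex hull {z \<in> int_lattice n. \<forall>(s, t, k)\<in>C. of_int k \<le> partial_sum z t - partial_sum z s}"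
    (is "_ \<in> convex hull ?Z")
  using assms
proof (induction "card {t \<in> {1..n}. partial_sum x t \<notin> \<int>}" arbitrary: x rule: less_induct)
  case less
  \<comment> \<open>Constraints may involve indices beyond \<open>n\<close>, where the partial sum
    repeats its value at \<open>n\<close>. So all of \<open>D\<close> has to move, while the finite
    set \<open>D'\<close> already represents every value.\<close>
  define D where "D = {t. partial_sum x t \<notin> \<int>}"
  define D' where "D' = D \<inter> {1..n}"
  have D'_eq: "{t \<in> {1..n}. partial_sum x t \<notin> \<int>} = D'" by (auto simp: D_def D'_def)
  have beyond: "t \<in> D \<longleftrightarrow> n \<in> D" if "n \<le> t" for t
    using partial_sum_beyond[OF less.prems(1) that] by (simp add: D_def)
  have "0 \<notin> D" by (simp add: D_def)
  show ?case
  proof (cases "D' = {}")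
    case True
    have "D = {}"
    proof (rule ccontr)
      assume "D \<noteq> {}"
      then obtain t where t: "t \<in> D" by blast
      then have "min t n \<in> D" using beyond[of t] by (cases "t \<le> n") (auto simp: min_def)
      then show False using True \<open>0 \<notin> D\<close> by (cases "min t n = 0") (auto simp: D'_def)
    qed
    then have "partial_sum x t \<in> \<int>" for t by (auto simp: D_def)
    moreover have "Poly_Mapping.lookup x i = partial_sum x i - partial_sum x (i - 1)" if "i \<noteq> 0" for i
      using that by (cases i) (auto simp: partial_sum_Suc)
    moreover have "Poly_Mapping.lookup x 0 = 0"
      using less.prems(1) by (auto simp: real_space_def in_keys_iff)
    ultimately have "Poly_Mapping.lookup x i \<in> \<int>" for i by (cases "i = 0") auto
    then have "x \<in> ?Z" using less.prems by (auto simp: int_lattice_def)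
    then show ?thesis by (rule hull_inc)
  next
    case False
    obtain d where d: "d \<in> real_space n" "\<And>t. partial_sum d t = of_bool (t \<in> D)"
      using exists_indicator_partial_sum[of D n] beyond \<open>0 \<notin> D\<close> by blast
    have finD': "finite D'" by (simp add: D'_def)
    have in_D': "\<exists>t'\<in>D'. partial_sum x t = partial_sum x t'" if "t \<in> D" for t
    proof -
      have "min t n \<in> D" using that beyond[of t] by (cases "t \<le> n") (auto simp: min_def)
      moreover have "min t n \<noteq> 0" using calculation \<open>0 \<notin> D\<close> by metis
      ultimately have "min t n \<in> D'" by (simp add: D'_def)
      moreover have "partial_sum x t = partial_sum x (min t n)"
        using partial_sum_beyond[OF less.prems(1), of t] by (simp add: min_def)
      ultimately show ?thesis by blast
    qed
    \<comment> \<open>\<delta> and \<mu> are the largest common shifts down and up that carry no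
      fractional partial sum past an integer; each makes at least one of them integral.\<close>
    define \<delta> where "\<delta> = Min ((\<lambda>t. frac (partial_sum x t)) ` D')"
    define \<mu> where "\<mu> = Min ((\<lambda>t. 1 - frac (partial_sum x t)) ` D')"
    have \<delta>_le: "\<delta> \<le> frac (partial_sum x t)" and \<mu>_le: "\<mu> \<le> 1 - frac (partial_sum x t)" if t: "t \<in> D" for t
    proof -
      obtain t' where "t' \<in> D'" "partial_sum x t = partial_sum x t'" using in_D'[OF t] by blast
      then show "\<delta> \<le> frac (partial_sum x t)" "\<mu> \<le> 1 - frac (partial_sum x t)"
        unfolding \<delta>_def \<mu>_def using finD' by auto
    qed
    obtain t1 where t1: "t1 \<in> D'" "\<delta> = frac (partial_sum x t1)"
    proof -
      have "\<delta> \<in> (\<lambda>t. frac (partial_sum x t)) ` D'" unfolding \<delta>_def by (rule Min_in) (use finD' False in auto)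
      then show thesis using that by blast
    qed
    obtain t2 where t2: "t2 \<in> D'" "\<mu> = 1 - frac (partial_sum x t2)"
    proof -
      have "\<mu> \<in> (\<lambda>t. 1 - frac (partial_sum x t)) ` D'" unfolding \<mu>_def by (rule Min_in) (use finD' False in auto)
      then show thesis using that by blast
    qed
    have \<delta>: "0 < \<delta>" using t1 by (simp add: frac_gt_0_iff D'_def D_def)
    have \<mu>: "0 < \<mu>" using t2 frac_lt_1[of "partial_sum x t2"] by simp
    have step: "x + r *\<^sub>R d \<in> convex hull ?Z"
      if t0: "t0 \<in> D'" "partial_sum x t0 + r \<in> \<int>" and r: "\<And>t. t \<in> D \<Longrightarrow> \<lfloor>partial_sum x t\<rfloor> \<le> partial_sum x t + r"
        "\<And>t. t \<in> D \<Longrightarrow> partial_sum x t + r \<le> \<lfloor>partial_sum x t\<rfloor> + 1" for t0 r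
    proof (rule less.hyps)
      have ps: "partial_sum (x + r *\<^sub>R d) t = partial_sum x t + r * of_bool (t \<in> D)" for t
        by (simp add: partial_sum_add partial_sum_scaleR d)
      have "{t \<in> {1..n}. partial_sum (x + r *\<^sub>R d) t \<notin> \<int>} \<subset> D'"
      proof
        show "{t \<in> {1..n}. partial_sum (x + r *\<^sub>R d) t \<notin> \<int>} \<subseteq> D'"
          unfolding ps by (auto simp: D'_def D_def)
        show "{t \<in> {1..n}. partial_sum (x + r *\<^sub>R d) t \<notin> \<int>} \<noteq> D'"
        proof -
          have "t0 \<in> D" using t0(1) by (simp add: D'_def)
          then have "partial_sum (x + r *\<^sub>R d) t0 \<in> \<int>" using t0(2) by (simp add: ps)
          then show ?thesis using t0(1) by blast
        qed
      qed
      then show "card {t \<in> {1..n}. partial_sum (x + r *\<^sub>R d) t \<notin> \<int>} < card {t \<in> {1..n}. partial_sum x t \<notin> \<int>}"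
        unfolding D'_eq by (rule psubset_card_mono[OF finD'])
      show "x + r *\<^sub>R d \<in> real_space n" by (rule real_space_add_scaleR[OF less.prems(1) d(1)])
      have "of_int k \<le> partial_sum x t + r * of_bool (t \<in> D) - (partial_sum x s + r * of_bool (s \<in> D))"
        if "(s, t, k) \<in> C" for s t k
      proof -
        from that have k: "of_int k \<le> partial_sum x t - partial_sum x s" using less.prems(2) by auto
        \<comment> \<open>If both or neither of the sums move, the difference is unchanged. If one
          moves, the other is an integer, so the bound holds even with the moving sum rounded down
          or up, and it stays between these two integers.\<close>
        consider "s \<in> D \<longleftrightarrow> t \<in> D" | "t \<in> D" "s \<notin> D" | "s \<in> D" "t \<notin> D" by blast
        then show ?thesis
        proof cases
          case 2
          then obtain m where m: "partial_sum x s = of_int m" by (auto simp: D_def elim: Ints_cases)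
          then have "k + m \<le> \<lfloor>partial_sum x t\<rfloor>" using k by (simp add: le_floor_iff)
          then have "of_int k + of_int m \<le> partial_sum x t + r" using r(1)[OF 2(1)] by linarith
          then show ?thesis using 2 m by simp
        next
          case 3
          then obtain m where m: "partial_sum x t = of_int m" by (auto simp: D_def elim: Ints_cases)
          have "partial_sum x s \<noteq> of_int (m - k)" using 3 by (auto simp: D_def)
          then have "partial_sum x s < of_int (m - k)" using k m by simp
          then have "\<lfloor>partial_sum x s\<rfloor> < m - k" by (simp only: floor_less_iff)
          then have "\<lfloor>partial_sum x s\<rfloor> + 1 \<le> m - k" by simp
          then have "partial_sum x s + r \<le> of_int m - of_int k" using r(2)[OF 3(1)] by linarith
          then show ?thesis using 3 m by simp
        qed (use k in auto)
      qed
      then show "\<forall>(s, t, k)\<in>C. of_int k \<le> partial_sum (x + r *\<^sub>R d) t - partial_sum (x + r *\<^sub>R d) s"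
        unfolding ps by blast
    qed
    have "x + (- \<delta>) *\<^sub>R d \<in> convex hull ?Z"
    proof (rule step[OF t1(1)])
      show "partial_sum x t1 + - \<delta> \<in> \<int>" unfolding t1(2) by (simp add: frac_def)
      show "\<lfloor>partial_sum x t\<rfloor> \<le> partial_sum x t + - \<delta>" if "t \<in> D" for t
        using \<delta>_le[OF that] by (simp add: frac_def)
      show "partial_sum x t + - \<delta> \<le> \<lfloor>partial_sum x t\<rfloor> + 1" for t
        using \<delta> frac_lt_1[of "partial_sum x t"] unfolding frac_def by linarith
    qed
    moreover have "x + \<mu> *\<^sub>R d \<in> convex hull ?Z"
    proof (rule step[OF t2(1)])
      have "partial_sum x t2 + \<mu> = of_int (\<lfloor>partial_sum x t2\<rfloor> + 1)" unfolding t2(2) by (simp add: frac_def)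
      then show "partial_sum x t2 + \<mu> \<in> \<int>" by (metis Ints_of_int)
      show "partial_sum x t + \<mu> \<le> \<lfloor>partial_sum x t\<rfloor> + 1" if "t \<in> D" for t
        using \<mu>_le[OF that] by (simp add: frac_def)
      show "\<lfloor>partial_sum x t\<rfloor> \<le> partial_sum x t + \<mu>" for t
        using \<mu> of_int_floor_le[of "partial_sum x t"] by linarith
    qed
    \<comment> \<open>Each end point is weighted by the length of the opposite shift, so that the
      displacements cancel.\<close>
    ultimately have "(\<mu> / (\<delta> + \<mu>)) *\<^sub>R (x + (- \<delta>) *\<^sub>R d) + (\<delta> / (\<delta> + \<mu>)) *\<^sub>R (x + \<mu> *\<^sub>R d) \<in> convex hull ?Z"
      using \<delta> \<mu> by (intro convexD[OF convex_convex_hull]) (auto simp flip: add_divide_distrib)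
    moreover have "(\<mu> / (\<delta> + \<mu>)) *\<^sub>R (x + (- \<delta>) *\<^sub>R d) + (\<delta> / (\<delta> + \<mu>)) *\<^sub>R (x + \<mu> *\<^sub>R d) = x"
      (is "?l = _")
    proof (rule poly_mapping_eqI)
      have combine: "\<mu> / (\<delta> + \<mu>) * (u + - \<delta> * v) + \<delta> / (\<delta> + \<mu>) * (u + \<mu> * v) = u" for u v
      proof -
        have "\<mu> / (\<delta> + \<mu>) * (u + - \<delta> * v) + \<delta> / (\<delta> + \<mu>) * (u + \<mu> * v)
            = (\<mu> * (u + - \<delta> * v) + \<delta> * (u + \<mu> * v)) / (\<delta> + \<mu>)"
          by (simp add: add_divide_distrib)
        also have "\<mu> * (u + - \<delta> * v) + \<delta> * (u + \<mu> * v) = (\<delta> + \<mu>) * u"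
          by (simp add: algebra_simps)
        finally show ?thesis using \<delta> \<mu> by simp
      qed
      show "Poly_Mapping.lookup ?l i = Poly_Mapping.lookup x i" for i
        unfolding lookup_add lookup_scaleR by (rule combine)
    qed
    ultimately show ?thesis by simp
  qed
qed

section \<open>Generalized polymatroids from interval bounds\<close>

text \<open>\<open>lo\<close> is the forced exponent, \<open>{g q<..b q}\<close> the range of
  \<open>q\<close>, and \<open>c q t\<close> the excess over \<open>lo\<close> demanded on
  \<open>{g q<..t}\<close>. As the excess on a range is at most 1 per index, \<open>c_le\<close>
  says that the demand can be met.\<close>

locale interval_bounds =
  fixes n :: nat and Q :: "nat set" and lo g b :: "nat \<Rightarrow> nat" and c :: "nat \<Rightarrow> nat \<Rightarrow> nat"
  assumes Q_finite: "finite Q"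
    and g_le_b: "q \<in> Q \<Longrightarrow> g q \<le> b q" and b_le_n: "q \<in> Q \<Longrightarrow> b q \<le> n"
    and ranges_disjoint: "q \<in> Q \<Longrightarrow> q' \<in> Q \<Longrightarrow> q \<noteq> q' \<Longrightarrow> {g q<..b q} \<inter> {g q'<..b q'} = {}"
    and c_start: "q \<in> Q \<Longrightarrow> c q (g q) = 0"
    and c_le: "q \<in> Q \<Longrightarrow> g q \<le> t \<Longrightarrow> t \<le> b q \<Longrightarrow> c q t \<le> t - g q"
begin

definition hi :: "nat \<Rightarrow> nat" where
  "hi i = lo i + (\<Sum>q\<in>Q. of_bool (i \<in> {g q<..b q}))"

definition polytope :: "(nat \<Rightarrow>\<^sub>0 real) set" where
  "polytope = {x \<in> real_space n.
     (\<forall>i\<in>{1..n}. real (lo i) \<le> Poly_Mapping.lookup x i \<and> Poly_Mapping.lookup x i \<le> real (hi i)) \<and>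
     (\<forall>q\<in>Q. \<forall>t\<in>{g q<..b q}. (\<Sum>i\<in>{g q<..t}. real (lo i)) + real (c q t)
        \<le> (\<Sum>i\<in>{g q<..t}. Poly_Mapping.lookup x i))}"

text \<open>A triple (s, t, k) bounds the partial sum at \<open>t\<close> minus that at
  \<open>s\<close> from below by \<open>k\<close>; upper bounds appear with indices reversed and the
  bound negated.\<close>

definition constraints :: "(nat \<times> nat \<times> int) set" where
  "constraints = {(i - 1, i, int (lo i)) |i. i \<in> {1..n}} \<union> {(i, i - 1, - int (hi i)) |i. i \<in> {1..n}} \<union>
     {(g q, t, int (\<Sum>i\<in>{g q<..t}. lo i) + int (c q t)) |q t. q \<in> Q \<and> t \<in> {g q<..b q}}"

lemma polytope_eq:
  "polytope = {x \<in> real_space n. \<forall>(s, t, k)\<in>constraints. of_int k \<le> partial_sum x t - partial_sum x s}"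
proof -
  have step: "partial_sum x i - partial_sum x (i - 1) = Poly_Mapping.lookup x i" if "i \<in> {1..n}" for x i
    using that by (cases i) (auto simp: partial_sum_Suc)
  have "(\<forall>(s, t, k)\<in>constraints. of_int k \<le> partial_sum x t - partial_sum x s) \<longleftrightarrow>
    (\<forall>i\<in>{1..n}. of_int (int (lo i)) \<le> partial_sum x i - partial_sum x (i - 1)) \<and>
    (\<forall>i\<in>{1..n}. of_int (- int (hi i)) \<le> partial_sum x (i - 1) - partial_sum x i) \<and>
    (\<forall>q\<in>Q. \<forall>t\<in>{g q<..b q}. of_int (int (\<Sum>i\<in>{g q<..t}. lo i) + int (c q t)) \<le> partial_sum x t - partial_sum x (g q))" for x
    unfolding constraints_def by blast
  moreover have "(\<forall>i\<in>{1..n}. of_int (int (lo i)) \<le> partial_sum x i - partial_sum x (i - 1)) \<longleftrightarrow>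
    (\<forall>i\<in>{1..n}. real (lo i) \<le> Poly_Mapping.lookup x i)" for x
    by (rule ball_cong[OF refl]) (simp only: step of_int_of_nat_eq)
  moreover have "(\<forall>i\<in>{1..n}. of_int (- int (hi i)) \<le> partial_sum x (i - 1) - partial_sum x i) \<longleftrightarrow>
    (\<forall>i\<in>{1..n}. Poly_Mapping.lookup x i \<le> real (hi i))" for x
  proof (rule ball_cong[OF refl])
    fix i assume "i \<in> {1..n}"
    from step[OF this, of x] show "of_int (- int (hi i)) \<le> partial_sum x (i - 1) - partial_sum x i
      \<longleftrightarrow> Poly_Mapping.lookup x i \<le> real (hi i)" by auto
  qed
  moreover have "(\<forall>q\<in>Q. \<forall>t\<in>{g q<..b q}. of_int (int (\<Sum>i\<in>{g q<..t}. lo i) + int (c q t)) \<le> partial_sum x t - partial_sum x (g q))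
    \<longleftrightarrow> (\<forall>q\<in>Q. \<forall>t\<in>{g q<..b q}. (\<Sum>i\<in>{g q<..t}. real (lo i)) + real (c q t)
        \<le> (\<Sum>i\<in>{g q<..t}. Poly_Mapping.lookup x i))" for x
    by (intro ball_cong refl) (simp add: partial_sum_diff)
  ultimately show ?thesis
    unfolding polytope_def by (intro Collect_cong) (simp only: ball_conj_distrib conj_assoc)
qed

lemma convex_polytope: "convex polytope"
  unfolding polytope_eq
proof (rule convexI)
  fix x y :: "nat \<Rightarrow>\<^sub>0 real" and u v :: real
  assume x: "x \<in> {x \<in> real_space n. \<forall>(s, t, k)\<in>constraints. of_int k \<le> partial_sum x t - partial_sum x s}"
    and y: "y \<in> {x \<in> real_space n. \<forall>(s, t, k)\<in>constraints. of_int k \<le> partial_sum x t - partial_sum x s}"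
    and uv: "0 \<le> u" "0 \<le> v" "u + v = 1"
  have "of_int k \<le> partial_sum (u *\<^sub>R x + v *\<^sub>R y) t - partial_sum (u *\<^sub>R x + v *\<^sub>R y) s"
    if "(s, t, k) \<in> constraints" for s t k
  proof -
    have "of_int k \<le> partial_sum x t - partial_sum x s" "of_int k \<le> partial_sum y t - partial_sum y s"
      using x y that by auto
    then have "u * of_int k + v * of_int k \<le> u * (partial_sum x t - partial_sum x s) + v * (partial_sum y t - partial_sum y s)"
      using uv by (intro add_mono mult_left_mono)
    moreover have "u * of_int k + v * of_int k = of_int k" using uv by (simp flip: distrib_right)
    ultimately show ?thesis by (simp add: partial_sum_add partial_sum_scaleR algebra_simps)
  qed
  moreover have "u *\<^sub>R x + v *\<^sub>R y \<in> real_space n"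
    using x y by (simp add: real_space_iff lookup_add)
  ultimately show "u *\<^sub>R x + v *\<^sub>R y \<in> {x \<in> real_space n. \<forall>(s, t, k)\<in>constraints. of_int k \<le> partial_sum x t - partial_sum x s}"
    by blast
qed

lemma polytope_eq_hull: "polytope = convex hull (polytope \<inter> int_lattice n)"
proof
  show "convex hull (polytope \<inter> int_lattice n) \<subseteq> polytope"
    by (rule hull_minimal) (auto simp: convex_polytope)
  show "polytope \<subseteq> convex hull (polytope \<inter> int_lattice n)"
  proof
    fix x assume "x \<in> polytope"
    then have "x \<in> convex hull {z \<in> int_lattice n. \<forall>(s, t, k)\<in>constraints. of_int k \<le> partial_sum z t - partial_sum z s}"
      by (intro difference_constraints_integral) (auto simp: polytope_eq)
    also have "{z \<in> int_lattice n. \<forall>(s, t, k)\<in>constraints. of_int k \<le> partial_sum z t - partial_sum z s} = polytope \<inter> int_lattice n"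
      by (auto simp: polytope_eq int_lattice_def)
    finally show "x \<in> convex hull (polytope \<inter> int_lattice n)" .
  qed
qed

text \<open>In the complementary coordinates \<open>u = hi - x\<close> the constraints become \<open>u \<ge> 0\<close>, \<open>u \<le> 1\<close> on the ranges and
  \<open>u {g q<..t} \<le> slack q t\<close>: an independence polytope of a matroid given by a chain of sets, whose rank
  function minimizes over one member of the chain.\<close>

definition slack :: "nat \<Rightarrow> nat \<Rightarrow> nat" where
  "slack q t = t - g q - c q t"

definition rank :: "nat \<Rightarrow> nat set \<Rightarrow> nat" where
  "rank q I = Min ((\<lambda>t. slack q t + card (I \<inter> {t<..b q})) ` {g q..b q})"

lemma rank_le: "q \<in> Q \<Longrightarrow> t \<in> {g q..b q} \<Longrightarrow> rank q I \<le> slack q t + card (I \<inter> {t<..b q})"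
  unfolding rank_def by (rule Min_le) auto

lemma rank_attained:
  assumes "q \<in> Q"
  obtains t where "t \<in> {g q..b q}" "rank q I = slack q t + card (I \<inter> {t<..b q})"
proof -
  have "rank q I \<in> (\<lambda>t. slack q t + card (I \<inter> {t<..b q})) ` {g q..b q}"
    unfolding rank_def by (rule Min_in) (use g_le_b[OF assms] in auto)
  then show thesis using that by blast
qed

lemma rank_mono: "q \<in> Q \<Longrightarrow> I \<subseteq> J \<Longrightarrow> rank q I \<le> rank q J"
proof -
  assume q: "q \<in> Q" and "I \<subseteq> J"
  obtain t where t: "t \<in> {g q..b q}" "rank q J = slack q t + card (J \<inter> {t<..b q})"
    using rank_attained[OF q] .
  have "card (I \<inter> {t<..b q}) \<le> card (J \<inter> {t<..b q})"
    using \<open>I \<subseteq> J\<close> by (intro card_mono) auto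
  then show ?thesis using rank_le[OF q t(1), of I] t(2) by simp
qed

lemma rank_le_card: "q \<in> Q \<Longrightarrow> rank q I \<le> card (I \<inter> {g q<..b q})"
  using rank_le[of q "g q" I] g_le_b[of q] by (simp add: slack_def)

text \<open>Take minimizing thresholds s \<le> t of the two sets and use \<open>s\<close> for the
  intersection, \<open>t\<close> for the union. Beyond \<open>t\<close> the counts balance; between
  \<open>s\<close> and \<open>t\<close> the intersection counts no more than the set belonging to
  \<open>s\<close>.\<close>

lemma rank_submodular:
  assumes q: "q \<in> Q"
  shows "rank q (I \<union> J) + rank q (I \<inter> J) \<le> rank q I + rank q J"
proof -
  have le: "rank q (I \<union> J) + rank q (I \<inter> J) \<le> rank q I + rank q J"
    if s: "s \<in> {g q..b q}" "rank q I = slack q s + card (I \<inter> {s<..b q})"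
      and t: "t \<in> {g q..b q}" "rank q J = slack q t + card (J \<inter> {t<..b q})" and "s \<le> t"
    for I J s t
  proof -
    have "card ((I \<inter> J) \<inter> {s<..b q}) + card ((I \<union> J) \<inter> {t<..b q})
      \<le> card (I \<inter> {s<..b q}) + card (J \<inter> {t<..b q})"
    proof -
      have split: "card (S \<inter> {s<..b q}) = card (S \<inter> {s<..t}) + card (S \<inter> {t<..b q})" for S
      proof -
        have "S \<inter> {s<..b q} = S \<inter> {s<..t} \<union> S \<inter> {t<..b q}" using \<open>s \<le> t\<close> t(1) by auto
        moreover have "card (S \<inter> {s<..t} \<union> S \<inter> {t<..b q}) = card (S \<inter> {s<..t}) + card (S \<inter> {t<..b q})"
          by (rule card_Un_disjoint) auto
        ultimately show ?thesis by simp
      qed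
      have "card (I \<inter> J \<inter> {s<..t}) \<le> card (I \<inter> {s<..t})" by (intro card_mono) auto
      moreover have "card (I \<inter> J \<inter> {t<..b q}) + card ((I \<union> J) \<inter> {t<..b q})
        = card (I \<inter> {t<..b q}) + card (J \<inter> {t<..b q})"
        using card_Un_Int[of "I \<inter> {t<..b q}" "J \<inter> {t<..b q}"]
        by (simp add: Int_Un_distrib2 Int_ac)
      ultimately show ?thesis unfolding split[of "I \<inter> J"] split[of I] by linarith
    qed
    then show ?thesis
      using rank_le[OF q s(1), of "I \<inter> J"] rank_le[OF q t(1), of "I \<union> J"] s(2) t(2) by linarith
  qed
  obtain s where s: "s \<in> {g q..b q}" "rank q I = slack q s + card (I \<inter> {s<..b q})"
    using rank_attained[OF q] .
  obtain t where t: "t \<in> {g q..b q}" "rank q J = slack q t + card (J \<inter> {t<..b q})"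
    using rank_attained[OF q] .
  show ?thesis
    using le[OF s t] le[OF t s] by (cases "s \<le> t") (simp_all add: Un_commute Int_commute add.commute)
qed

definition upper_fun :: "nat set \<Rightarrow> real" where
  "upper_fun I = (\<Sum>i\<in>I. real (hi i))"

definition total_rank :: "nat set \<Rightarrow> nat" where
  "total_rank I = (\<Sum>q\<in>Q. rank q I)"

text \<open>The rank bounds sums of the slacks \<open>hi - x\<close> from above; rewritten for
  \<open>x\<close> this is a lower bound.\<close>

definition lower_fun :: "nat set \<Rightarrow> real" where
  "lower_fun I = upper_fun I - real (total_rank I)"

lemma upper_fun_modular:
  "I \<subseteq> {1..n} \<Longrightarrow> J \<subseteq> {1..n} \<Longrightarrow> upper_fun (I \<union> J) + upper_fun (I \<inter> J) = upper_fun I + upper_fun J"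
  unfolding upper_fun_def by (rule sum.union_inter) (auto dest: finite_subset)

lemma total_rank_submodular: "total_rank (I \<union> J) + total_rank (I \<inter> J) \<le> total_rank I + total_rank J"
  unfolding total_rank_def sum.distrib[symmetric] by (intro sum_mono rank_submodular)

lemma total_rank_mono: "I \<subseteq> J \<Longrightarrow> total_rank I \<le> total_rank J"
  unfolding total_rank_def by (intro sum_mono rank_mono)

text \<open>The upper function is modular and cancels everywhere. Supermodularity of the lower one
  is submodularity of the rank, and the cross inequality reduces to monotonicity of the rank from
  \<open>J - I\<close> to \<open>J\<close>.\<close>

lemma paramodular: "paramodular n lower_fun upper_fun"
  unfolding paramodular_def
proof (intro conjI allI impI)
  show z0: "upper_fun {} = 0" by (simp add: upper_fun_def)
  have "total_rank {} = 0"
    unfolding total_rank_def using rank_le_card[of _ "{}"] by (intro sum.neutral) auto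
  then show "lower_fun {} = 0" by (simp add: lower_fun_def z0)
  show "supermodular n lower_fun"
    unfolding supermodular_def
  proof (intro allI impI)
    fix I J assume "I \<subseteq> {1..n}" "J \<subseteq> {1..n}"
    then have "upper_fun (I \<union> J) + upper_fun (I \<inter> J) = upper_fun I + upper_fun J"
      by (rule upper_fun_modular)
    moreover have "real (total_rank (I \<union> J)) + real (total_rank (I \<inter> J)) \<le> real (total_rank I) + real (total_rank J)"
      using total_rank_submodular[of I J] by linarith
    ultimately show "lower_fun I + lower_fun J \<le> lower_fun (I \<union> J) + lower_fun (I \<inter> J)"
      unfolding lower_fun_def by linarith
  qed
  show "submodular n upper_fun"
    unfolding submodular_def by (simp add: upper_fun_modular)
  fix I J assume I: "I \<subseteq> {1..n}" and J: "J \<subseteq> {1..n}"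
  have diff: "upper_fun A = upper_fun (A - B) + upper_fun (A \<inter> B)" if "A \<subseteq> {1..n}" for A B
    using that finite_subset unfolding upper_fun_def
    by (metis (no_types, lifting) add.commute finite_atLeastAtMost sum.Int_Diff)
  have "upper_fun I = upper_fun (I - J) + upper_fun (I \<inter> J)" by (rule diff[OF I])
  moreover have "upper_fun J = upper_fun (J - I) + upper_fun (I \<inter> J)" using diff[OF J, of I] by (simp add: Int_commute)
  moreover have "total_rank (J - I) \<le> total_rank J" by (rule total_rank_mono) blast
  ultimately show "upper_fun (I - J) - lower_fun (J - I) \<le> upper_fun I - lower_fun J"
    unfolding lower_fun_def by linarith
qed

lemma hi_on_range:
  assumes q: "q \<in> Q" and i: "i \<in> {g q<..b q}"
  shows "hi i = lo i + 1"
proof -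
  have "(\<Sum>q'\<in>Q - {q}. of_bool (i \<in> {g q'<..b q'})) = (0 :: nat)"
  proof (rule sum.neutral, rule ballI)
    fix q' assume "q' \<in> Q - {q}"
    then have "i \<notin> {g q'<..b q'}" using ranges_disjoint[of q q'] q i by blast
    then show "of_bool (i \<in> {g q'<..b q'}) = (0 :: nat)" by simp
  qed
  then show ?thesis
    unfolding hi_def sum.remove[OF Q_finite q] using i by simp
qed

lemma hi_off_ranges:
  assumes "\<And>q. q \<in> Q \<Longrightarrow> i \<notin> {g q<..b q}"
  shows "hi i = lo i"
proof -
  have "(\<Sum>q\<in>Q. of_bool (i \<in> {g q<..b q})) = (0 :: nat)"
  proof (rule sum.neutral, rule ballI)
    fix q assume "q \<in> Q"
    from assms[OF this] show "of_bool (i \<in> {g q<..b q}) = (0 :: nat)" by simp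
  qed
  then show ?thesis by (simp only: hi_def add_0_right)
qed

text \<open>Split the range at a threshold \<open>t\<close> attaining the rank: up to
  \<open>t\<close> the interval constraint bounds the slacks by \<open>slack q t\<close>, and beyond
  \<open>t\<close> each slack is at most 1.\<close>

lemma polytope_le_rank:
  assumes x: "x \<in> polytope" and I: "I \<subseteq> {1..n}" and q: "q \<in> Q"
  shows "(\<Sum>i\<in>I \<inter> {g q<..b q}. real (hi i) - Poly_Mapping.lookup x i) \<le> real (rank q I)"
proof -
  define u where "u i = real (hi i) - Poly_Mapping.lookup x i" for i
  obtain t where t: "t \<in> {g q..b q}" "rank q I = slack q t + card (I \<inter> {t<..b q})"
    using rank_attained[OF q] .
  have range: "i \<in> {1..n}" if "i \<in> {g q<..b q}" for i using that b_le_n[OF q] by auto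
  have u: "0 \<le> u i" "u i \<le> 1" if "i \<in> {g q<..b q}" for i
    using x range[OF that] hi_on_range[OF q that] unfolding polytope_def u_def by fastforce+
  have "I \<inter> {g q<..b q} = I \<inter> {g q<..t} \<union> I \<inter> {t<..b q}" using t(1) by auto
  moreover have "sum u (I \<inter> {g q<..t} \<union> I \<inter> {t<..b q}) = sum u (I \<inter> {g q<..t}) + sum u (I \<inter> {t<..b q})"
    by (rule sum.union_disjoint) auto
  ultimately have split: "sum u (I \<inter> {g q<..b q}) = sum u (I \<inter> {g q<..t}) + sum u (I \<inter> {t<..b q})" by simp
  have "sum u (I \<inter> {t<..b q}) \<le> (\<Sum>i\<in>I \<inter> {t<..b q}. 1)"
    by (rule sum_mono) (use u(2) t(1) in auto)
  then have 1: "sum u (I \<inter> {t<..b q}) \<le> card (I \<inter> {t<..b q})" by simp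
  have "sum u (I \<inter> {g q<..t}) \<le> sum u {g q<..t}"
    by (rule sum_mono2) (use u(1) t(1) in auto)
  also have "sum u {g q<..t} \<le> real (slack q t)"
  proof (cases "t = g q")
    case False
    then have t': "t \<in> {g q<..b q}" using t(1) by auto
    have "(\<Sum>i\<in>{g q<..t}. real (hi i)) = (\<Sum>i\<in>{g q<..t}. real (lo i) + 1)"
      by (rule sum.cong[OF refl]) (use hi_on_range[OF q] t' in simp)
    then have "sum u {g q<..t} = (\<Sum>i\<in>{g q<..t}. real (lo i)) + real (t - g q) - (\<Sum>i\<in>{g q<..t}. Poly_Mapping.lookup x i)"
      unfolding u_def sum_subtractf by (simp add: sum.distrib)
    moreover have "(\<Sum>i\<in>{g q<..t}. real (lo i)) + real (c q t) \<le> (\<Sum>i\<in>{g q<..t}. Poly_Mapping.lookup x i)"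
      using x q t' unfolding polytope_def by blast
    moreover have "slack q t + c q t = t - g q"
      using c_le[OF q, of t] t' unfolding slack_def by simp
    then have "real (slack q t) = real (t - g q) - real (c q t)" by linarith
    ultimately show ?thesis by linarith
  qed simp
  finally show ?thesis using 1 split t(2) unfolding u_def by linarith
qed

text \<open>Slack sums decompose along the disjoint ranges and vanish outside them, which gives one
  inclusion. Conversely, singletons return the coordinate bounds and the sets
  \<open>{g q<..t}\<close> the interval constraints, as no other range contributes to their
  rank.\<close>

theorem polytope_eq_paramodular:
  "polytope = {x \<in> real_space n. \<forall>I. I \<subseteq> {1..n} \<longrightarrow>
     lower_fun I \<le> (\<Sum>i\<in>I. Poly_Mapping.lookup x i) \<and> (\<Sum>i\<in>I. Poly_Mapping.lookup x i) \<le> upper_fun I}"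
  (is "_ = ?P")
proof
  show "polytope \<subseteq> ?P"
  proof
    fix x assume x: "x \<in> polytope"
    have "lower_fun I \<le> (\<Sum>i\<in>I. Poly_Mapping.lookup x i) \<and> (\<Sum>i\<in>I. Poly_Mapping.lookup x i) \<le> upper_fun I"
      if I: "I \<subseteq> {1..n}" for I
    proof
      have fin: "finite I" using I finite_subset by blast
      show "(\<Sum>i\<in>I. Poly_Mapping.lookup x i) \<le> upper_fun I"
        unfolding upper_fun_def by (rule sum_mono) (use x I in \<open>auto simp: polytope_def\<close>)
      define u where "u i = real (hi i) - Poly_Mapping.lookup x i" for i
      define E where "E = (\<Union>q\<in>Q. I \<inter> {g q<..b q})"
      have "sum u I = sum u E + sum u (I - E)"
        using fin by (subst sum.subset_diff[of E]) (auto simp: E_def)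
      moreover have "sum u (I - E) \<le> 0"
      proof (rule sum_nonpos)
        fix i assume i: "i \<in> I - E"
        then have "hi i = lo i" by (intro hi_off_ranges) (auto simp: E_def)
        then show "u i \<le> 0" using x i I unfolding polytope_def u_def by auto
      qed
      moreover have "sum u E = (\<Sum>q\<in>Q. sum u (I \<inter> {g q<..b q}))"
        unfolding E_def by (rule sum.UNION_disjoint) (use Q_finite fin ranges_disjoint in blast)+
      moreover have "\<dots> \<le> (\<Sum>q\<in>Q. real (rank q I))"
        unfolding u_def by (rule sum_mono) (rule polytope_le_rank[OF x I])
      moreover have "(\<Sum>q\<in>Q. real (rank q I)) = real (total_rank I)" by (simp add: total_rank_def)
      moreover have "sum u I = upper_fun I - (\<Sum>i\<in>I. Poly_Mapping.lookup x i)"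
        by (simp add: u_def upper_fun_def sum_subtractf)
      ultimately show "lower_fun I \<le> (\<Sum>i\<in>I. Poly_Mapping.lookup x i)"
        unfolding lower_fun_def by linarith
    qed
    then show "x \<in> ?P" using x by (auto simp: polytope_def)
  qed
  show "?P \<subseteq> polytope"
  proof
    fix x assume x: "x \<in> ?P"
    then have lowerD: "lower_fun I \<le> (\<Sum>i\<in>I. Poly_Mapping.lookup x i)"
      and upperD: "(\<Sum>i\<in>I. Poly_Mapping.lookup x i) \<le> upper_fun I" if "I \<subseteq> {1..n}" for I
      using that by auto
    have "real (lo i) \<le> Poly_Mapping.lookup x i" "Poly_Mapping.lookup x i \<le> real (hi i)" if i: "i \<in> {1..n}" for i
    proof -
      show "Poly_Mapping.lookup x i \<le> real (hi i)"
        using upperD[of "{i}"] i by (simp add: upper_fun_def)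
      have "total_rank {i} \<le> (\<Sum>q\<in>Q. of_bool (i \<in> {g q<..b q}))"
        unfolding total_rank_def
      proof (rule sum_mono)
        fix q assume "q \<in> Q"
        from rank_le_card[OF this, of "{i}"] show "rank q {i} \<le> of_bool (i \<in> {g q<..b q})"
          by (cases "i \<in> {g q<..b q}") auto
      qed
      then have "lo i + total_rank {i} \<le> hi i" unfolding hi_def by (simp only: add_le_cancel_left)
      then have "real (lo i) \<le> real (hi i) - real (total_rank {i})" by linarith
      then show "real (lo i) \<le> Poly_Mapping.lookup x i"
        using lowerD[of "{i}"] i by (simp add: lower_fun_def upper_fun_def)
    qed
    moreover have "(\<Sum>i\<in>{g q<..t}. real (lo i)) + real (c q t) \<le> (\<Sum>i\<in>{g q<..t}. Poly_Mapping.lookup x i)"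
      if q: "q \<in> Q" and t: "t \<in> {g q<..b q}" for q t
    proof -
      let ?I = "{g q<..t}"
      have I: "?I \<subseteq> {1..n}" using t b_le_n[OF q] by auto
      have "rank q ?I \<le> slack q t"
        using rank_le[OF q, of t ?I] t by simp
      moreover have "(\<Sum>q'\<in>Q - {q}. rank q' ?I) = 0"
      proof (rule sum.neutral, rule ballI)
        fix q' assume q': "q' \<in> Q - {q}"
        then have "{g q<..b q} \<inter> {g q'<..b q'} = {}" using ranges_disjoint[of q q'] q by blast
        moreover have "?I \<subseteq> {g q<..b q}" using t by auto
        ultimately have "?I \<inter> {g q'<..b q'} = {}" by blast
        then have "card (?I \<inter> {g q'<..b q'}) = 0" by (simp only: card.empty)
        moreover have "q' \<in> Q" using q' by blast
        ultimately show "rank q' ?I = 0" using rank_le_card[of q' ?I] by linarith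
      qed
      ultimately have "total_rank ?I \<le> slack q t"
        unfolding total_rank_def sum.remove[OF Q_finite q] by simp
      moreover have "slack q t + c q t = t - g q"
        using c_le[OF q, of t] t unfolding slack_def by simp
      ultimately have "real (total_rank ?I) + real (c q t) \<le> real (t - g q)" by linarith
      moreover have "upper_fun ?I = (\<Sum>i\<in>?I. real (lo i)) + real (t - g q)"
      proof -
        have "upper_fun ?I = (\<Sum>i\<in>?I. real (lo i) + 1)"
          unfolding upper_fun_def by (rule sum.cong[OF refl]) (use hi_on_range[OF q] t in simp)
        then show ?thesis by (simp add: sum.distrib)
      qed
      ultimately show ?thesis using lowerD[OF I] unfolding lower_fun_def by linarith
    qed
    moreover have "x \<in> real_space n" using x by blast
    ultimately show "x \<in> polytope" unfolding polytope_def by blast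
  qed
qed

corollary generalized_polymatroid_polytope: "generalized_polymatroid n polytope"
  unfolding generalized_polymatroid_def using paramodular polytope_eq_paramodular by blast

end

section \<open>Structure of the support\<close>

lemma disjoint_diagram_columns:
  assumes w: "w permutes {1..n}" and av: "avoids_pattern n w [1,4,3,2]" "avoids_pattern n w [1,4,2,3]"
    "avoids_pattern n w [1,3,2,5,4]"
  shows "disjoint_columns n (diagram_column w)"
proof
  show sub: "diagram_column w q \<subseteq> {1..n}" if "q \<in> {1..n}" for q
    using that by (auto simp: diagram_column_def)
  have inj: "w i \<noteq> w j" if "i \<noteq> j" for i j
    using permutes_inj[OF w] that by (auto dest: injD)
  have le: False
    if q: "q \<in> {1..n}" "q' \<in> {1..n}" "w q < w q'"
      and i: "i \<in> {gap (diagram_column w q)<..top_elem (diagram_column w q)}"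
        "i \<in> {gap (diagram_column w q')<..top_elem (diagram_column w q')}" for q q' i
  proof -
    \<comment> \<open>\<open>a\<close> is the first row missing from column \<open>q\<close>, so
      \<open>w a < w q\<close>; \<open>b\<close> and \<open>b'\<close> are the last rows of the two
      columns. The common index \<open>i\<close> places \<open>a\<close> at or before both.\<close>
    define a b b' where "a = Suc (gap (diagram_column w q))" and "b = top_elem (diagram_column w q)"
      and "b' = top_elem (diagram_column w q')"
    have fin: "finite (diagram_column w q)" "finite (diagram_column w q')"
      using sub q finite_subset by blast+
    have "b \<in> diagram_column w q" unfolding b_def by (rule top_elem_in[OF fin(1)]) (use i in auto)
    then have b: "b < q" "w q < w b" by (auto simp: diagram_column_def)
    have "b' \<in> diagram_column w q'" unfolding b'_def by (rule top_elem_in[OF fin(2)]) (use i in auto)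
    then have b': "b' < q'" "w q' < w b'" by (auto simp: diagram_column_def)
    have a: "a \<notin> diagram_column w q" "1 \<le> a" "a \<le> b" "a \<le> b'"
      using Suc_gap_notin[OF fin(1)] i by (auto simp: a_def b_def b'_def)
    then have "\<not> w q < w a" using b by (auto simp: diagram_column_def)
    then have wa: "w a < w q" using inj[of a q] a b by auto
    have ab: "a < b" "a < b'"
      using a wa b b' q(3) by (auto simp: le_less)
    \<comment> \<open>Such a \<open>p\<close> would play the 4 with \<open>a\<close> as the 1; the
      order of \<open>q\<close> and \<open>q'\<close> decides between 1423 and 1432.\<close>
    have no: False if "a < p" "p < q" "p < q'" "w q' < w p" for p
    proof (cases "q < q'")
      case True
      then show False using avoids_1423D[OF av(2) a(2), of p q q'] that wa q by auto
    next
      case False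
      then have "q' < q" using q(3) by (cases "q = q'") auto
      then show False using avoids_1432D[OF av(1) a(2), of p q' q] that wa q by auto
    qed
    have "q \<noteq> b'" using b' q(3) by auto
    have "q < b'"
    proof (rule ccontr)
      assume "\<not> q < b'"
      then show False using no[OF ab(2) _ b'] \<open>q \<noteq> b'\<close> by simp
    qed
    moreover have "w b < w q'"
    proof (rule ccontr)
      assume "\<not> w b < w q'"
      moreover have "b < q'" using b(1) \<open>q < b'\<close> b'(1) by simp
      ultimately show False using no[OF ab(1) b(1)] inj[of b q'] by force
    qed
    \<comment> \<open>Now the positions a < b < q < b' < q' carry the pattern 13254.\<close>
    ultimately show False
      using avoids_13254D[OF av(3) a(2) ab(1) b(1) _ b'(1)] q wa b b' by auto
  qed
  show "{gap (diagram_column w q)<..top_elem (diagram_column w q)} \<inter>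
      {gap (diagram_column w q')<..top_elem (diagram_column w q')} = {}"
    if "q \<in> {1..n}" "q' \<in> {1..n}" "q \<noteq> q'" for q q'
    using le[of q q'] le[of q' q] inj[OF that(3)] that by (metis disjoint_iff linorder_neqE_nat)
qed

section \<open>Evaluation at the all-ones vector\<close>

definition coeff_sum :: "mpoly \<Rightarrow> int" where
  "coeff_sum f = (\<Sum>\<alpha>\<in>Poly_Mapping.keys f. Poly_Mapping.lookup f \<alpha>)"

lemma coeff_sum_0 [simp]: "coeff_sum 0 = 0"
  by (simp add: coeff_sum_def)

lemma coeff_sum_single [simp]: "coeff_sum (Poly_Mapping.single \<alpha> c) = c"
  by (simp add: coeff_sum_def)

lemma coeff_sum_add [simp]: "coeff_sum (f + g) = coeff_sum f + coeff_sum g"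
  unfolding coeff_sum_def by (rule setsum_keys_plus_distrib) auto

lemma coeff_sum_diff [simp]: "coeff_sum (f - g) = coeff_sum f - coeff_sum g"
  using coeff_sum_add[of "f - g" g] by simp

lemma coeff_sum_mult [simp]: "coeff_sum (f * g) = coeff_sum f * coeff_sum g"
proof (induction f rule: poly_mapping_single_induct)
  case (single \<alpha> c)
  show ?case
    by (induction g rule: poly_mapping_single_induct) (simp_all add: mult_single distrib_left)
qed (simp_all add: distrib_right)

lemma coeff_sum_1 [simp]: "coeff_sum 1 = 1"
  by (simp add: coeff_sum_def)

lemma coeff_sum_X [simp]: "coeff_sum (X i) = 1"
  unfolding X_def by (rule coeff_sum_single)

lemma coeff_sum_sum: "coeff_sum (sum f A) = (\<Sum>a\<in>A. coeff_sum (f a))"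
  by (induction A rule: infinite_finite_induct) auto

lemma coeff_sum_prod: "coeff_sum (prod f A) = (\<Prod>a\<in>A. coeff_sum (f a))"
  by (induction A rule: infinite_finite_induct) auto

text \<open>At the all-ones vector each weight with a factor \<open>1 - X k\<close> vanishes. Only
  \<open>T = {1..n}\<close> survives, and it dominates \<open>R\<close>.\<close>

lemma coeff_sum_column_poly:
  assumes "R \<subseteq> {1..n}"
  shows "coeff_sum (column_poly n R) = 1"
proof -
  have "prefix_card R t \<le> prefix_card {1..n} t" for t
    unfolding prefix_card_def by (rule card_mono) (use assms in auto)
  then have dom: "dominates {1..n} R" by (simp add: dominates_def)
  have "coeff_sum (column_poly n R) = (\<Sum>T\<in>Pow {1..n}. coeff_sum (of_bool (dominates T R) * ml_weight {1..n} T))"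
    by (simp only: column_poly_def multilinear_ext_def coeff_sum_sum)
  also have "\<dots> = (\<Sum>T\<in>{{1..n}}. coeff_sum (of_bool (dominates T R) * ml_weight {1..n} T))"
  proof (rule sum.mono_neutral_right)
    show "\<forall>T\<in>Pow {1..n} - {{1..n}}. coeff_sum (of_bool (dominates T R) * ml_weight {1..n} T) = 0"
    proof
      fix T assume "T \<in> Pow {1..n} - {{1..n}}"
      then have "{1..n} - T \<noteq> {}" by blast
      then show "coeff_sum (of_bool (dominates T R) * ml_weight {1..n} T) = 0"
        by (simp add: ml_weight_def coeff_sum_prod card_gt_0_iff del: Diff_eq_empty_iff)
    qed
  qed auto
  also have "\<dots> = 1" using dom by (simp add: ml_weight_def coeff_sum_prod)
  finally show ?thesis .
qed

lemma lookup_map: "f 0 = 0 \<Longrightarrow> Poly_Mapping.lookup (Poly_Mapping.map f p) i = f (Poly_Mapping.lookup p i)"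
  by (simp add: Poly_Mapping.map.rep_eq when_def)

lemma exp_size_eq:
  assumes "Poly_Mapping.keys \<alpha> \<subseteq> {1..n}"
  shows "exp_size \<alpha> = (\<Sum>i\<in>{1..n}. Poly_Mapping.lookup \<alpha> i)"
  unfolding exp_size_def by (rule sum.mono_neutral_left) (use assms in \<open>auto simp: in_keys_iff\<close>)

section \<open>Upward moves and the greatest support vector\<close>

context disjoint_columns
begin

abbreviation product_poly :: mpoly where
  "product_poly \<equiv> \<Prod>q\<in>{1..n}. column_poly n (R q)"

lemma keys_product_iff: "\<alpha> \<in> Poly_Mapping.keys product_poly \<longleftrightarrow>
    Poly_Mapping.keys \<alpha> \<subseteq> {1..n} \<and>
    (\<forall>i\<in>{1..n}. lower i \<le> Poly_Mapping.lookup \<alpha> i \<and> Poly_Mapping.lookup \<alpha> i \<le> upper i) \<and>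
    (\<forall>q\<in>{1..n}. \<forall>t\<in>{gap (R q)<..top_elem (R q)}.
      (\<Sum>i\<in>{gap (R q)<..t}. lower i) + card (R q \<inter> {gap (R q)<..t})
        \<le> (\<Sum>i\<in>{gap (R q)<..t}. Poly_Mapping.lookup \<alpha> i))"
  unfolding keys_prod_column_poly by (rule factor_vec_factors_iff)

text \<open>Raising coordinates preserves every lower bound, so only the coordinate upper bounds
  have to be checked again. Both interval closure and the existence of covers come from
  this.\<close>

lemma keys_product_interval:
  assumes "\<alpha> \<in> Poly_Mapping.keys product_poly" "Poly_Mapping.keys \<beta> \<subseteq> {1..n}"
    and "Poly_Mapping.lookup \<alpha> \<le> Poly_Mapping.lookup \<beta>"
    and "\<And>i. i \<in> {1..n} \<Longrightarrow> Poly_Mapping.lookup \<beta> i \<le> upper i"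
  shows "\<beta> \<in> Poly_Mapping.keys product_poly"
proof -
  have le: "Poly_Mapping.lookup \<alpha> i \<le> Poly_Mapping.lookup \<beta> i" for i
    using assms(3) by (simp add: le_fun_def)
  have "(\<Sum>i\<in>I. Poly_Mapping.lookup \<alpha> i) \<le> (\<Sum>i\<in>I. Poly_Mapping.lookup \<beta> i)" for I
    by (rule sum_mono) (rule le)
  then show ?thesis
    using assms(1,2,4) le unfolding keys_product_iff by (meson le_trans)
qed

definition top_vec :: "nat \<Rightarrow>\<^sub>0 nat" where
  "top_vec = Abs_poly_mapping (\<lambda>i. if i \<in> {1..n} then upper i else 0)"

lemma lookup_top_vec: "Poly_Mapping.lookup top_vec i = (if i \<in> {1..n} then upper i else 0)"
proof -
  have "finite {i. (if i \<in> {1..n} then upper i else 0) \<noteq> 0}"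
    by (rule finite_subset[of _ "{1..n}"]) auto
  then show ?thesis unfolding top_vec_def by simp
qed

lemma top_vec_in_keys: "top_vec \<in> Poly_Mapping.keys product_poly"
  unfolding keys_product_iff
proof (intro conjI ballI)
  show "Poly_Mapping.keys top_vec \<subseteq> {1..n}"
    by (auto simp: in_keys_iff lookup_top_vec split: if_splits)
  fix i assume "i \<in> {1..n}"
  then show "lower i \<le> Poly_Mapping.lookup top_vec i" "Poly_Mapping.lookup top_vec i \<le> upper i"
    unfolding lookup_top_vec upper_def by simp_all
next
  fix q t assume q: "q \<in> {1..n}" and t: "t \<in> {gap (R q)<..top_elem (R q)}"
  let ?I = "{gap (R q)<..t}"
  have "(\<Sum>i\<in>?I. Poly_Mapping.lookup top_vec i) = (\<Sum>i\<in>?I. lower i + 1)"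
  proof (rule sum.cong[OF refl])
    fix i assume "i \<in> ?I"
    then have "i \<in> {gap (R q)<..top_elem (R q)}" using t by auto
    moreover from this have "i \<in> {1..n}" using top_elem_le[OF R_subset[OF q]] by auto
    ultimately show "Poly_Mapping.lookup top_vec i = lower i + 1"
      using upper_on_range[OF q] by (simp add: lookup_top_vec)
  qed
  also have "\<dots> = (\<Sum>i\<in>?I. lower i) + card ?I" unfolding sum.distrib by simp
  finally show "(\<Sum>i\<in>?I. lower i) + card (R q \<inter> ?I) \<le> (\<Sum>i\<in>?I. Poly_Mapping.lookup top_vec i)"
    using card_mono[of ?I "R q \<inter> ?I"] by simp
qed

lemma le_top_vec: "\<alpha> \<in> Poly_Mapping.keys product_poly \<Longrightarrow> Poly_Mapping.lookup \<alpha> \<le> Poly_Mapping.lookup top_vec"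
  unfolding keys_product_iff le_fun_def lookup_top_vec by (auto simp: in_keys_iff)

lemma exp_size_le_top:
  assumes "\<alpha> \<in> Poly_Mapping.keys product_poly"
  shows "exp_size \<alpha> \<le> exp_size top_vec"
proof -
  have "Poly_Mapping.keys \<alpha> \<subseteq> {1..n}" "Poly_Mapping.keys top_vec \<subseteq> {1..n}"
    using assms top_vec_in_keys unfolding keys_product_iff by auto
  then show ?thesis
    using le_top_vec[OF assms] by (simp add: exp_size_eq le_fun_def sum_mono)
qed

lemma poly_deg_product: "poly_deg product_poly = exp_size top_vec"
  unfolding poly_deg_def by (rule Max_eqI) (use exp_size_le_top top_vec_in_keys in auto)

lemma exists_not_top:
  assumes "\<alpha> \<in> Poly_Mapping.keys product_poly" "\<alpha> \<noteq> top_vec"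
  obtains i where "i \<in> {1..n}" "Poly_Mapping.lookup \<alpha> i < upper i"
proof (rule ccontr)
  assume "\<not> thesis"
  then have "Poly_Mapping.lookup top_vec i \<le> Poly_Mapping.lookup \<alpha> i" for i
    using that by (auto simp: lookup_top_vec not_less[symmetric])
  then have "\<alpha> = top_vec"
    using le_top_vec[OF assms(1)] by (intro poly_mapping_eqI antisym) (auto simp: le_fun_def)
  then show False using assms(2) by simp
qed

lemma exists_cover:
  assumes \<alpha>: "\<alpha> \<in> Poly_Mapping.keys product_poly" and "\<alpha> \<noteq> top_vec"
  obtains \<beta> where "\<beta> \<in> Poly_Mapping.keys product_poly" "Poly_Mapping.lookup \<alpha> < Poly_Mapping.lookup \<beta>"
    "exp_size \<beta> = exp_size \<alpha> + 1"
proof -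
  obtain i where i: "i \<in> {1..n}" "Poly_Mapping.lookup \<alpha> i < upper i"
    using exists_not_top[OF assms] .
  define \<beta> where "\<beta> = \<alpha> + Poly_Mapping.single i 1"
  have l: "Poly_Mapping.lookup \<beta> k = Poly_Mapping.lookup \<alpha> k + (if k = i then 1 else 0)" for k
    by (simp add: \<beta>_def lookup_add lookup_single when_def)
  have "Poly_Mapping.keys \<alpha> \<subseteq> {1..n}" using \<alpha> unfolding keys_product_iff by blast
  moreover have "Poly_Mapping.keys \<beta> \<subseteq> insert i (Poly_Mapping.keys \<alpha>)"
    by (auto simp: in_keys_iff l split: if_splits)
  ultimately have keys: "Poly_Mapping.keys \<alpha> \<subseteq> {1..n}" "Poly_Mapping.keys \<beta> \<subseteq> {1..n}"
    using i(1) by blast+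
  have le: "Poly_Mapping.lookup \<alpha> \<le> Poly_Mapping.lookup \<beta>" by (simp add: le_fun_def l)
  have "\<beta> \<in> Poly_Mapping.keys product_poly"
  proof (rule keys_product_interval[OF \<alpha> keys(2) le])
    fix k assume "k \<in> {1..n}"
    then show "Poly_Mapping.lookup \<beta> k \<le> upper k"
      using \<alpha> i(2) unfolding keys_product_iff l by auto
  qed
  moreover have "Poly_Mapping.lookup \<alpha> < Poly_Mapping.lookup \<beta>"
    unfolding less_le_not_le
  proof (intro conjI notI le)
    assume "Poly_Mapping.lookup \<beta> \<le> Poly_Mapping.lookup \<alpha>"
    then have "Poly_Mapping.lookup \<beta> i \<le> Poly_Mapping.lookup \<alpha> i" by (rule le_funD)
    then show False by (simp add: l)
  qed
  moreover have "exp_size \<beta> = exp_size \<alpha> + 1"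
    unfolding exp_size_eq[OF keys(1)] exp_size_eq[OF keys(2)] l sum.distrib using i by simp
  ultimately show thesis using that by blast
qed

lemma coeff_sum_product: "coeff_sum product_poly = 1"
  unfolding coeff_sum_prod using coeff_sum_column_poly[OF R_subset] by simp

section \<open>Lattice points and the Newton polytope\<close>

sublocale bounds: interval_bounds n "{1..n}" lower "\<lambda>q. gap (R q)" "\<lambda>q. top_elem (R q)"
  "\<lambda>q t. card (R q \<inter> {gap (R q)<..t})"
proof
  fix q t :: nat assume "gap (R q) \<le> t"
  then show "card (R q \<inter> {gap (R q)<..t}) \<le> t - gap (R q)"
    using card_mono[of "{gap (R q)<..t}" "R q \<inter> {gap (R q)<..t}"] by simp
qed (use gap_le_top_elem[OF R_finite] top_elem_le[OF R_subset] disjoint in auto)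

lemma bounds_hi: "bounds.hi = upper"
  by (rule ext) (simp only: bounds.hi_def upper_def)

text \<open>On lattice points the inequalities of \<open>polytope\<close> are those of
  \<open>keys_product_iff\<close>. The bound by \<open>lower\<close> gives nonnegativity, so passing
  through floor and \<open>nat\<close> loses nothing.\<close>

lemma supp_real_product: "supp_real product_poly = bounds.polytope \<inter> int_lattice n"
proof (intro equalityI subsetI)
  fix x assume "x \<in> supp_real product_poly"
  then obtain \<alpha> where \<alpha>: "\<alpha> \<in> Poly_Mapping.keys product_poly" and x: "x = Poly_Mapping.map real \<alpha>"
    by (auto simp: supp_real_def)
  have l: "Poly_Mapping.lookup x i = real (Poly_Mapping.lookup \<alpha> i)" for i by (simp add: x lookup_map)
  have "x \<in> real_space n"
    using \<alpha> unfolding keys_product_iff real_space_iff l by (auto simp: in_keys_iff)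
  moreover have "(\<Sum>i\<in>I. real (lower i)) + real c \<le> (\<Sum>i\<in>I. Poly_Mapping.lookup x i)"
    if "(\<Sum>i\<in>I. lower i) + c \<le> (\<Sum>i\<in>I. Poly_Mapping.lookup \<alpha> i)" for I c
    using that unfolding l of_nat_sum[symmetric] of_nat_add[symmetric] of_nat_le_iff .
  ultimately show "x \<in> bounds.polytope \<inter> int_lattice n"
    using \<alpha> unfolding keys_product_iff bounds.polytope_def int_lattice_def bounds_hi
    by (auto simp: l)
next
  fix x assume x: "x \<in> bounds.polytope \<inter> int_lattice n"
  define \<alpha> where "\<alpha> = Poly_Mapping.map (\<lambda>r. nat \<lfloor>r\<rfloor>) x"
  have x0: "Poly_Mapping.lookup x i = 0" if "i \<notin> {1..n}" for i
    using x that unfolding int_lattice_def real_space_iff by blast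
  have nonneg: "0 \<le> Poly_Mapping.lookup x i" for i
  proof (cases "i \<in> {1..n}")
    case True
    then have "real (lower i) \<le> Poly_Mapping.lookup x i" using x unfolding bounds.polytope_def by blast
    then show ?thesis by (rule order_trans[rotated]) simp
  qed (simp add: x0)
  have int: "Poly_Mapping.lookup x i \<in> \<int>" for i using x by (auto simp: int_lattice_def)
  have l: "Poly_Mapping.lookup x i = real (Poly_Mapping.lookup \<alpha> i)" for i
    using nonneg[of i] int[of i] by (auto simp: \<alpha>_def lookup_map elim: Ints_cases)
  have "Poly_Mapping.keys \<alpha> \<subseteq> {1..n}"
  proof
    fix i assume "i \<in> Poly_Mapping.keys \<alpha>"
    then show "i \<in> {1..n}" using x0[of i] l[of i] by (cases "i \<in> {1..n}") (simp_all add: in_keys_iff)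
  qed
  moreover have "(\<Sum>i\<in>I. lower i) + c \<le> (\<Sum>i\<in>I. Poly_Mapping.lookup \<alpha> i)"
    if "(\<Sum>i\<in>I. real (lower i)) + real c \<le> (\<Sum>i\<in>I. Poly_Mapping.lookup x i)" for I c
    using that unfolding l of_nat_sum[symmetric] of_nat_add[symmetric] of_nat_le_iff .
  moreover have "lower i \<le> Poly_Mapping.lookup \<alpha> i \<and> Poly_Mapping.lookup \<alpha> i \<le> upper i" if "i \<in> {1..n}" for i
  proof -
    have "real (lower i) \<le> Poly_Mapping.lookup x i \<and> Poly_Mapping.lookup x i \<le> real (upper i)"
      using x that unfolding bounds.polytope_def bounds_hi by blast
    then show ?thesis unfolding l of_nat_le_iff .
  qed
  ultimately have "\<alpha> \<in> Poly_Mapping.keys product_poly"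
    using x unfolding keys_product_iff bounds.polytope_def by blast
  moreover have "x = Poly_Mapping.map real \<alpha>"
    by (rule poly_mapping_eqI) (simp add: lookup_map l)
  ultimately show "x \<in> supp_real product_poly" by (auto simp: supp_real_def)
qed

lemma newton_product: "newton product_poly = bounds.polytope"
  unfolding newton_def supp_real_product by (rule bounds.polytope_eq_hull[symmetric])

lemma supp_int_interval:
  assumes \<alpha>: "\<alpha> \<in> supp_int product_poly" and \<gamma>: "\<gamma> \<in> supp_int product_poly"
    and \<beta>: "Poly_Mapping.keys \<beta> \<subseteq> {1..n}" "Poly_Mapping.lookup \<alpha> \<le> Poly_Mapping.lookup \<beta>"
      "Poly_Mapping.lookup \<beta> \<le> Poly_Mapping.lookup \<gamma>"
  shows "\<beta> \<in> supp_int product_poly"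
proof -
  obtain a c where a: "a \<in> Poly_Mapping.keys product_poly" "\<alpha> = Poly_Mapping.map int a"
    and c: "c \<in> Poly_Mapping.keys product_poly" "\<gamma> = Poly_Mapping.map int c"
    using \<alpha> \<gamma> by (auto simp: supp_int_def)
  \<comment> \<open>\<beta> lies above the nonnegative vector \<alpha>, so \<open>nat\<close>
    truncates nothing.\<close>
  define b where "b = Poly_Mapping.map nat \<beta>"
  have le: "int (Poly_Mapping.lookup a i) \<le> Poly_Mapping.lookup \<beta> i"
    "Poly_Mapping.lookup \<beta> i \<le> int (Poly_Mapping.lookup c i)" for i
    using \<beta>(2,3) by (simp_all add: a c le_fun_def lookup_map)
  have l: "Poly_Mapping.lookup \<beta> i = int (Poly_Mapping.lookup b i)" for i
    using le(1)[of i] by (simp add: b_def lookup_map)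
  have "b \<in> Poly_Mapping.keys product_poly"
  proof (rule keys_product_interval[OF a(1)])
    show "Poly_Mapping.keys b \<subseteq> {1..n}" using \<beta>(1) by (auto simp: in_keys_iff l)
    show "Poly_Mapping.lookup a \<le> Poly_Mapping.lookup b" using le(1) by (simp add: le_fun_def l)
    show "Poly_Mapping.lookup b i \<le> upper i" if "i \<in> {1..n}" for i
      using le(2)[of i] c(1) that unfolding keys_product_iff l of_nat_le_iff by (meson le_trans)
  qed
  moreover have "\<beta> = Poly_Mapping.map int b"
    by (rule poly_mapping_eqI) (simp add: lookup_map l)
  ultimately show ?thesis by (auto simp: supp_int_def)
qed

end

theorem theorem5p6:
  fixes n :: nat and w :: "nat \<Rightarrow> nat" and G :: mpoly
  assumes "w permutes {1..n}"
    and "avoids_pattern n w [1,4,3,2]"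
    and "avoids_pattern n w [1,4,2,3]"
    and "avoids_pattern n w [1,3,2,5,4]"
    and "grothendieck n w G"
  shows "(\<forall>\<alpha> \<in> Poly_Mapping.keys G. exp_size \<alpha> < poly_deg G \<longrightarrow>
            (\<exists>\<beta> \<in> Poly_Mapping.keys G.
               Poly_Mapping.lookup \<alpha> < Poly_Mapping.lookup \<beta> \<and> exp_size \<beta> = exp_size \<alpha> + 1))
       \<and> (\<forall>\<alpha> \<in> supp_int G. \<forall>\<gamma> \<in> supp_int G. \<forall>\<beta> :: nat \<Rightarrow>\<^sub>0 int.
            Poly_Mapping.keys \<beta> \<subseteq> {1..n} \<longrightarrow>
            Poly_Mapping.lookup \<alpha> \<le> Poly_Mapping.lookup \<beta> \<longrightarrow>
            Poly_Mapping.lookup \<beta> \<le> Poly_Mapping.lookup \<gamma> \<longrightarrow> \<beta> \<in> supp_int G)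
       \<and> saturated_newton_polytope n G
       \<and> generalized_polymatroid n (newton G)
       \<and> (\<forall>\<beta> \<in> Poly_Mapping.keys G. exp_size \<beta> = poly_deg G \<longrightarrow>
            (\<Sum>\<alpha> | \<alpha> \<in> Poly_Mapping.keys G \<and> Poly_Mapping.lookup \<alpha> \<le> Poly_Mapping.lookup \<beta>.
               Poly_Mapping.lookup G \<alpha>) = 1)"
proof -
  interpret disjoint_columns n "diagram_column w"
    using assms(1-4) by (rule disjoint_diagram_columns)
  \<comment> \<open>The product formula was obtained along one chain; uniqueness transfers it to the
    given \<open>G\<close>.\<close>
  have G: "G = product_poly"
    using grothendieck_unique[OF assms(1,5)] grothendieck_product[OF assms(1-3)] by blast
  show ?thesis
    unfolding G
  proof (intro conjI ballI impI allI)
    fix \<alpha> assume \<alpha>: "\<alpha> \<in> Poly_Mapping.keys product_poly" "exp_size \<alpha> < poly_deg product_poly"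
    then have "\<alpha> \<noteq> top_vec" unfolding poly_deg_product by blast
    from exists_cover[OF \<alpha>(1) this] show "\<exists>\<beta>\<in>Poly_Mapping.keys product_poly.
      Poly_Mapping.lookup \<alpha> < Poly_Mapping.lookup \<beta> \<and> exp_size \<beta> = exp_size \<alpha> + 1" by metis
  next
    show "saturated_newton_polytope n product_poly"
      unfolding saturated_newton_polytope_def newton_product supp_real_product ..
    show "generalized_polymatroid n (newton product_poly)"
      unfolding newton_product by (rule bounds.generalized_polymatroid_polytope)
  next
    fix \<beta> assume \<beta>: "\<beta> \<in> Poly_Mapping.keys product_poly" "exp_size \<beta> = poly_deg product_poly"
    \<comment> \<open>Any other vector would have a cover exceeding the degree. Hence the sum below
      \<beta> runs over the whole support.\<close>
    have "\<beta> = top_vec"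
    proof (rule ccontr)
      assume "\<beta> \<noteq> top_vec"
      then obtain \<gamma> where "\<gamma> \<in> Poly_Mapping.keys product_poly" "exp_size \<gamma> = exp_size \<beta> + 1"
        using exists_cover[OF \<beta>(1)] by metis
      then show False using exp_size_le_top \<beta>(2) poly_deg_product by fastforce
    qed
    then have "{\<alpha>. \<alpha> \<in> Poly_Mapping.keys product_poly \<and> Poly_Mapping.lookup \<alpha> \<le> Poly_Mapping.lookup \<beta>}
      = Poly_Mapping.keys product_poly"
      using le_top_vec by blast
    then show "(\<Sum>\<alpha> | \<alpha> \<in> Poly_Mapping.keys product_poly \<and> Poly_Mapping.lookup \<alpha> \<le> Poly_Mapping.lookup \<beta>.
      Poly_Mapping.lookup product_poly \<alpha>) = 1"
      using coeff_sum_product unfolding coeff_sum_def by simp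
  qed (rule supp_int_interval)
qed

end
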